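(* Let $M\ge 0$ be an integer, and for every $j=0,1,\ldots,M$ let $(R_j(n))_{n\ge 1}$ be an inhomogeneous linear recurrence sequence (ILRS) of order $d_j\ge 1$. Write $f(n)=(R_0\circ R_1\circ\cdots\circ R_M)(n)$, where $(S\circ T)(n)=S(T(n))$. Suppose that (1) for every $j=1,2,\ldots,M$, the sequence $(R_j(n))_{n\ge1}$ is reversible and positive; (2) $(R_1\circ\cdots\circ R_M)(n)\to\infty$ as $n\to\infty$; (3') $|f(n)|/\log n\to\infty$ as $n\to\infty$; where, when $M=0$, only hypothesis (3') is assumed. Then there exist an absolute constant $C>0$ and a function $\delta$ satisfying $$\delta(n)=\frac{\log n}{2d_0\cdots d_M}+O\!\left(\frac{\log n}{d_0\cdots d_M}\exp\bigl(-C\sqrt{\log\log n}\bigr)\right)$$ for every sufficiently large $n$, such that the open intervals $\bigl(|f(n)|-\delta(n),\ |f(n)|+\delta(n)\bigr)$ contain no prime number for infinitely many integers $n\ge1$.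
   Context: A sequence $(R(n))_{n\ge1}$ is an inhomogeneous linear recurrence sequence (ILRS) of order $d\ge1$ if it is a sequence of integers and there are integers $a_0,\ldots,a_{d-1},b$ with $a_0\ne0$ such that $R(n+d)=a_{d-1}R(n+d-1)+\cdots+a_0R(n)+b$ for every integer $n\ge1$ (the inhomogeneous term $b$ is a constant). Such a sequence is called reversible if this holds with $a_0\in\{-1,1\}$. Positive means $R(n)>0$ for all $n\ge1$. The notation $g=h+O(k)$ means $|g-h|\le c\,k$ for some constant $c>0$. *)

theory Defs
  imports Complex_Main "HOL-Computational_Algebra.Primes"
begin

text \<open>
  A sequence (R(n)) with n \<ge> 1 is a function of type \<open>nat \<Rightarrow> int\<close>; its value at 0 is never
  constrained and never used.
\<close>

definition ilrs_recurrence :: "nat \<Rightarrow> (nat \<Rightarrow> int) \<Rightarrow> int \<Rightarrow> (nat \<Rightarrow> int) \<Rightarrow> bool" where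
  "ilrs_recurrence d a b R \<longleftrightarrow> (\<forall>n\<ge>1. R (n + d) = (\<Sum>i<d. a i * R (n + i)) + b)"

text \<open>The order is not required to be minimal.\<close>

definition ilrs :: "nat \<Rightarrow> (nat \<Rightarrow> int) \<Rightarrow> bool" where
  "ilrs d R \<longleftrightarrow> d \<ge> 1 \<and> (\<exists>a b. a 0 \<noteq> 0 \<and> ilrs_recurrence d a b R)"

definition reversible_ilrs :: "nat \<Rightarrow> (nat \<Rightarrow> int) \<Rightarrow> bool" where
  "reversible_ilrs d R \<longleftrightarrow> d \<ge> 1 \<and> (\<exists>a b. a 0 \<in> {-1, 1} \<and> ilrs_recurrence d a b R)"

definition positive_seq :: "(nat \<Rightarrow> int) \<Rightarrow> bool" where
  "positive_seq R \<longleftrightarrow> (\<forall>n\<ge>1. R n > 0)"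

text \<open>
  The coercion \<open>nat\<close> turns a value of the inner sequence into an index of the outer one.  It is
  harmless when the inner sequence is positive, the only case in which the composition is meant.
\<close>

definition seq_comp :: "(nat \<Rightarrow> int) \<Rightarrow> (nat \<Rightarrow> int) \<Rightarrow> nat \<Rightarrow> int" where
  "seq_comp S T n = S (nat (T n))"

text \<open>
  The composition of R i, R (i + 1), ..., R j, the last one applied first.  The
  coercion \<open>int\<close> is a right identity of \<^const>\<open>seq_comp\<close>, and is the empty composition
  (j < i).
\<close>

definition seq_comps :: "(nat \<Rightarrow> nat \<Rightarrow> int) \<Rightarrow> nat \<Rightarrow> nat \<Rightarrow> nat \<Rightarrow> int" where
  "seq_comps R i j = foldr seq_comp (map R [i..<Suc j]) int"

end

theory Submission
  imports Defs "HOL-Complex_Analysis.Complex_Analysis" "HOL-Number_Theory.Number_Theory"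
    "HOL-Probability.Sinc_Integral" "HOL-Real_Asymp.Real_Asymp" "HOL-Library.Discrete_Functions"
    "HOL-Computational_Algebra.Squarefree"
begin

text \<open>
  Put \<open>F = \<bar>f(n0)\<bar>\<close>.  If \<open>f(n) \<equiv> f(n0)\<close> modulo all primes up to \<open>2F\<close>, then every integer at distance
  less than \<open>F - 1\<close> from \<open>\<bar>f(n)\<bar>\<close> is divisible by one of these primes, because the integers strictly
  between \<open>1\<close> and \<open>2F - 1\<close> are.  So it is enough to find a small common period of \<open>f\<close> modulo
  these primes.  A pigeonhole argument bounds the period modulo \<open>p\<close> by \<open>p ^ (d0 * \<dots> * dM)\<close>; with
  the prime number theorem this gives windows of the right length up to lower order terms.

  Only the upper half \<open>\<psi>(x) \<le> (1 + o(1)) x\<close> of the prime number theorem is needed here, without an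
  error term, since the periods can be reduced by a constant factor in the exponent: a homogeneous
  recurrence modulo \<open>p\<close> returns to its starting point up to a scalar after about \<open>p ^ (d - 1)\<close> steps,
  so its period divides \<open>t * (p - 1)\<close> with \<open>t\<close> of this size, and the least common multiple of the numbers
  \<open>p - 1\<close> with \<open>p \<le> y\<close> divides \<open>2 lcm(1, \<dots>, y div 2)\<close>, which is about \<open>exp (y / 2)\<close> instead of \<open>exp y\<close>.
  This makes \<open>\<delta>(n) = log n / (2 d0 * \<dots> * dM)\<close> admissible.  The one recurrence without such a
  reduction is \<open>R(n + 1) = R(n) + b\<close>: composed with further sequences it is absorbed into the next one,
  and for \<open>M = 0\<close> a window around an integer congruent to a fixed small value is used instead.
\<close>

text \<open>The order of the choices shapes the proof. The index n0 is fixed before F and before the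
  primes up to 2 F are known, so the periodicity of the outer sequence must start at an index that
  does not depend on these primes. Only primes below a bound attached to the recurrence can spoil
  periodicity from index 1, and they are treated as a finite exceptional set. The inner sequences
  are reduced modulo periods of the sequences outside them, hence modulo composite numbers. A
  coefficient a_0 = 1 or -1 is a unit for every modulus, so the recurrence runs backwards and the
  periods hold from index 1. A multiple of a small prime could still be that prime itself. Therefore
  n is taken so far out that, by the growth of |f|, the whole window lies above 2 F; this costs
  nothing, since log n has size at least F anyway. The saving in log n is a fixed multiple of F,
  while the bound for psi loses only \<epsilon> F. What is left over pays for passing from F to F -
  1 and for all bounded terms, so the main term of \<delta> can be kept without any error.\<close>

section \<open>The zeta function and the von Mangoldt series\<close>

text \<open>\<open>n powr (- s)\<close> with the real logarithm made explicit, so that each term is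
  visibly entire in \<open>s\<close> and multiplicative in \<open>n\<close>. Since
  \<open>ln 0 = 0\<close>, the value at \<open>n = 0\<close> is 1; in series that start at 0 it
  stands next to \<open>mangoldt 0 = 0\<close>.\<close>

definition dpow :: "nat \<Rightarrow> complex \<Rightarrow> complex" where
  "dpow n s = exp (- s * complex_of_real (ln (real n)))"

lemma dpow_mult: "m > 0 \<Longrightarrow> n > 0 \<Longrightarrow> dpow (m * n) s = dpow m s * dpow n s"
  by (simp add: dpow_def ln_mult ring_distribs exp_diff exp_minus exp_add divide_inverse)

lemma norm_dpow: "norm (dpow n s) = exp (- Re s * ln (real n))"
  by (simp add: dpow_def)

lemma norm_dpow_powr: "n > 0 \<Longrightarrow> norm (dpow n s) = real n powr (- Re s)"
  by (simp add: norm_dpow powr_def)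

lemma dpow_has_field_derivative:
  "(dpow n has_field_derivative (- complex_of_real (ln (real n)) * dpow n s)) (at s)"
  unfolding dpow_def by (auto intro!: derivative_eq_intros)

lemma dpow_conv_powr: "n > 0 \<Longrightarrow> dpow n s = of_real (real n) powr (- s)"
  by (simp add: dpow_def powr_def Ln_of_real)

lemma summable_Suc_powr: "a > 1 \<Longrightarrow> summable (\<lambda>n. real (Suc n) powr (- a))"
  using summable_real_powr_iff[of "-a"] summable_Suc_iff[of "\<lambda>n. real n powr (-a)"] by simp

lemma powr_difference_bound:
  fixes x y :: real
  assumes "0 < x" "x \<le> y" "0 < Re s"
  shows "norm (of_real y powr (- s) - of_real x powr (- s) :: complex)
          \<le> norm s * x powr (- Re s - 1) * (y - x)"
proof -
  have "norm ((of_real y :: complex) powr (- s) - of_real x powr (- s))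
      \<le> norm s * x powr (- Re s - 1) * norm (complex_of_real y - of_real x)"
  proof (rule field_differentiable_bound[where S = "of_real ` {x..y}" and f' = "\<lambda>w. -s * w powr (-s-1)"])
    show "convex (complex_of_real ` {x..y})"
      by (intro convex_linear_image) (auto simp: linear_iff scaleR_conv_of_real)
    fix z :: complex assume z: "z \<in> of_real ` {x..y}"
    then obtain w where w: "z = of_real w" "w \<in> {x..y}" by auto
    have "z \<notin> \<real>\<^sub>\<le>\<^sub>0" using w assms by auto
    then show "((\<lambda>w. w powr (-s)) has_field_derivative -s * z powr (-s-1)) (at z within of_real ` {x..y})"
      by (rule has_field_derivative_at_within[OF has_field_derivative_powr])
    have "norm (z powr (-s-1)) = w powr (- Re s - 1)"
      using w assms by (subst norm_powr_real_powr) auto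
    also have "\<dots> \<le> x powr (- Re s - 1)" using w assms by (intro powr_mono2') auto
    finally show "norm (-s * z powr (-s-1)) \<le> norm s * x powr (- Re s - 1)"
      by (simp add: norm_mult mult_left_mono)
  qed (use assms in auto)
  also have "norm (complex_of_real y - of_real x) = y - x"
    using assms by (metis abs_of_nonneg diff_ge_0_iff_ge norm_of_real of_real_diff)
  finally show ?thesis .
qed

section \<open>The function (s - 1) zeta(s) on the half-plane Re s > 0\<close>

definition zterm :: "nat \<Rightarrow> complex \<Rightarrow> complex" where
  "zterm n s = (s - 1) * dpow (Suc n) s - dpow (Suc n) (s - 1) + dpow (Suc (Suc n)) (s - 1)"

text \<open>The mean value inequality is used twice. The increment of \<phi> over [N, N + 1] is the
  term itself, and the derivative of \<phi> at w is \<open>s - 1\<close> times the difference of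
  \<open>powr (- s)\<close> at N and w, to which \<open>powr_difference_bound\<close> applies. The
  factor 1/N gained there gives convergence also for Re s between 0 and 1.\<close>

lemma norm_zterm_le:
  assumes "0 < Re s"
  shows "norm (zterm n s) \<le> norm (s - 1) * norm s * real (Suc n) powr (- Re s - 1)"
proof -
  define N where "N = real (Suc n)"
  have N: "N > 0" by (simp add: N_def)
  define \<phi> where "\<phi> = (\<lambda>w::complex. w powr (1 - s) + (s - 1) * w * of_real N powr (-s))"
  have eq: "\<phi> (of_real (N + 1)) - \<phi> (of_real N) = zterm n s"
    by (simp add: \<phi>_def zterm_def dpow_conv_powr N_def algebra_simps)
  have "norm (\<phi> (of_real (N + 1)) - \<phi> (of_real N))
      \<le> norm (s - 1) * norm s * N powr (- Re s - 1) * norm (complex_of_real (N + 1) - of_real N)"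
  proof (rule field_differentiable_bound[where S = "of_real ` {N..N+1}" and
          f' = "\<lambda>w. (s - 1) * (of_real N powr (-s) - w powr (-s))"])
    show "convex (complex_of_real ` {N..N+1})"
      by (intro convex_linear_image) (auto simp: linear_iff scaleR_conv_of_real)
    fix z :: complex assume z: "z \<in> of_real ` {N..N+1}"
    then obtain w where w: "z = of_real w" "w \<in> {N..N+1}" by auto
    have "z \<notin> \<real>\<^sub>\<le>\<^sub>0" using w N by auto
    then show "(\<phi> has_field_derivative (s - 1) * (of_real N powr (-s) - z powr (-s))) (at z within of_real ` {N..N+1})"
      unfolding \<phi>_def by (auto intro!: derivative_eq_intros simp: algebra_simps)
    have "norm ((s - 1) * (of_real N powr (-s) - z powr (-s))) =
          norm (s - 1) * norm (of_real w powr (-s) - complex_of_real N powr (-s))"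
      using w by (simp add: norm_mult norm_minus_commute)
    also have "\<dots> \<le> norm (s - 1) * (norm s * N powr (- Re s - 1) * (w - N))"
      using w N assms by (intro mult_left_mono powr_difference_bound) auto
    also have "\<dots> \<le> norm (s - 1) * (norm s * N powr (- Re s - 1) * 1)"
      using w by (intro mult_left_mono) auto
    finally show "norm ((s - 1) * (of_real N powr (-s) - z powr (-s))) \<le> norm (s - 1) * norm s * N powr (- Re s - 1)"
      by (simp add: mult.assoc)
  qed (auto simp del: of_real_add)
  also have "norm (complex_of_real (N + 1) - of_real N) = 1" by simp
  finally show ?thesis by (simp only: eq mult_1_right) (simp only: N_def)
qed

text \<open>
  \<open>zterm n s\<close> is \<open>s - 1\<close> times the difference of \<open>(n + 1) powr (- s)\<close> and the integral of \<open>x powr (- s)\<close> over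
  \<open>[n + 1, n + 2]\<close>, so that the series converges for \<open>Re s > 0\<close> and continues \<open>(s - 1) \<zeta>(s)\<close>.
\<close>

definition zeta_reg :: "complex \<Rightarrow> complex" where
  "zeta_reg s = 1 + (\<Sum>n. zterm n s)"

lemma zeta_reg_1 [simp]: "zeta_reg 1 = 1"
  by (simp add: zeta_reg_def zterm_def dpow_def)

lemma zterm_local_bound:
  assumes "Re s > 0"
  shows "\<exists>d h. 0 < d \<and> summable h \<and>
          (\<forall>\<^sub>F n in sequentially. \<forall>y\<in>ball s d \<inter> {s. Re s > 0}. norm (zterm n y) \<le> h n)"
proof -
  define d where "d = Re s / 2"
  define B where "B = (norm s + d + 1) * (norm s + d)"
  have d: "d > 0" using assms by (simp add: d_def)
  have "norm (zterm n y) \<le> B * real (Suc n) powr (- (d + 1))" if y: "y \<in> ball s d" for n y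
  proof -
    have n1: "norm y \<le> norm s + d"
      using y norm_triangle_sub[of y s] by (simp add: dist_norm norm_minus_commute)
    have "\<bar>Re (s - y)\<bar> \<le> norm (s - y)" by (rule abs_Re_le_cmod)
    then have re: "Re y \<ge> d" using y d_def by (simp add: dist_norm)
    have n2: "norm (y - 1) \<le> norm s + d + 1" using n1 norm_triangle_ineq4[of y 1] by simp
    have "norm (zterm n y) \<le> norm (y - 1) * norm y * real (Suc n) powr (- Re y - 1)"
      using re d by (intro norm_zterm_le) auto
    also have "\<dots> \<le> B * real (Suc n) powr (- (d + 1))"
      unfolding B_def using n1 n2 re d by (intro mult_mono powr_mono) auto
    finally show ?thesis .
  qed
  moreover have "summable (\<lambda>n. B * real (Suc n) powr (- (d + 1)))"
    using d by (intro summable_mult summable_Suc_powr) auto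
  ultimately show ?thesis using d by (intro exI[of _ d] exI[of _ "\<lambda>n. B * real (Suc n) powr (- (d + 1))"]) auto
qed

lemma open_Re_gt: "open {s. Re s > c}"
  by (rule open_halfspace_Re_gt)

lemma zterm_has_field_derivative: "\<exists>D. \<forall>s. (zterm n has_field_derivative D s) (at s)"
proof -
  have "\<exists>D. (zterm n has_field_derivative D) (at s)" for s
    unfolding zterm_def dpow_def by (rule exI) (rule derivative_eq_intros refl)+
  then show ?thesis by metis
qed

lemma holomorphic_zeta_reg: "zeta_reg holomorphic_on {s. Re s > 0}"
proof -
  obtain D where D: "\<And>n s. (zterm n has_field_derivative D n s) (at s)"
    using zterm_has_field_derivative by metis
  have "\<exists>g g'. \<forall>x \<in> {s. Re s > 0}. ((\<lambda>n. zterm n x) sums g x) \<and> ((\<lambda>n. D n x) sums g' x) \<and> (g has_field_derivative g' x) (at x)"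
    by (rule series_and_derivative_comparison_local[OF open_Re_gt D]) (use zterm_local_bound in auto)
  then obtain g g' where g: "\<And>x. Re x > 0 \<Longrightarrow> (\<lambda>n. zterm n x) sums g x"
     "\<And>x. Re x > 0 \<Longrightarrow> (g has_field_derivative g' x) (at x)" by auto
  have "(\<lambda>s. 1 + g s) holomorphic_on {s. Re s > 0}"
    using g(2) by (intro holomorphic_intros) (auto simp: holomorphic_on_open open_Re_gt)
  then show ?thesis
    by (rule holomorphic_transform) (use g(1) sums_unique in \<open>fastforce simp: zeta_reg_def\<close>)
qed

lemma zeta_series:
  obtains Z Z' where
    "\<And>s. Re s > 1 \<Longrightarrow> (\<lambda>n. dpow (Suc n) s) sums Z s"
    "\<And>s. Re s > 1 \<Longrightarrow> (\<lambda>n. - of_real (ln (real (Suc n))) * dpow (Suc n) s) sums Z' s"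
    "\<And>s. Re s > 1 \<Longrightarrow> (Z has_field_derivative Z' s) (at s)"
proof -
  have "\<exists>d h. 0 < d \<and> summable h \<and>
          (\<forall>\<^sub>F n in sequentially. \<forall>y\<in>ball s d \<inter> {s. Re s > 1}. norm (dpow (Suc n) y) \<le> h n)"
    if "Re s > 1" for s
  proof -
    define d where "d = (Re s - 1) / 2"
    have d: "d > 0" using that by (simp add: d_def)
    have "norm (dpow (Suc n) y) \<le> real (Suc n) powr (- (d + 1))" if y: "y \<in> ball s d" for n y
    proof -
      have "\<bar>Re (s - y)\<bar> \<le> norm (s - y)" by (rule abs_Re_le_cmod)
      then have re: "Re y \<ge> d + 1" using y d_def by (simp add: dist_norm field_simps)
      then show ?thesis by (subst norm_dpow_powr) (auto intro!: powr_mono)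
    qed
    moreover have "summable (\<lambda>n. real (Suc n) powr (- (d + 1)))"
      using d by (intro summable_Suc_powr) auto
    ultimately show ?thesis using d by (intro exI[of _ d] exI[of _ "\<lambda>n. real (Suc n) powr (- (d + 1))"]) auto
  qed
  then have "\<exists>g g'. \<forall>x \<in> {s. Re s > 1}. ((\<lambda>n. dpow (Suc n) x) sums g x) \<and>
     ((\<lambda>n. - of_real (ln (real (Suc n))) * dpow (Suc n) x) sums g' x) \<and> (g has_field_derivative g' x) (at x)"
    by (intro series_and_derivative_comparison_local[OF open_Re_gt dpow_has_field_derivative]) auto
  then show ?thesis using that by auto
qed

text \<open>All of \<open>zterm\<close> except its first summand telescopes, with sum -1; the
  leading 1 in \<open>zeta_reg\<close> compensates this.\<close>

lemma zeta_reg_eq: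
  assumes s: "Re s > 1" and Z: "(\<lambda>n. dpow (Suc n) s) sums Z"
  shows "zeta_reg s = (s - 1) * Z"
proof -
  have lim: "(\<lambda>n. dpow (Suc n) (s - 1)) \<longlonglongrightarrow> 0"
  proof (rule tendsto_norm_zero_cancel)
    have "filterlim (\<lambda>n. real (Suc n)) at_top sequentially"
      using filterlim_Suc filterlim_real_sequentially by (rule filterlim_compose[rotated])
    then show "(\<lambda>n. norm (dpow (Suc n) (s - 1))) \<longlonglongrightarrow> 0"
      using s by (subst norm_dpow_powr) (auto intro!: tendsto_neg_powr)
  qed
  have "(\<lambda>n. dpow (Suc (Suc n)) (s - 1) - dpow (Suc n) (s - 1)) sums (0 - dpow (Suc 0) (s - 1))"
    by (rule telescope_sums[OF lim])
  from sums_add[OF sums_mult[OF Z, of "s - 1"] this]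
  have "(\<lambda>n. zterm n s) sums ((s - 1) * Z - 1)"
    by (simp add: zterm_def algebra_simps dpow_def)
  then show ?thesis by (simp add: zeta_reg_def sums_iff)
qed

section \<open>The Dirichlet series of the von Mangoldt function\<close>

lemma has_sum_atLeast_1_iff:
  "(f has_sum S) {1::nat..} \<longleftrightarrow> ((\<lambda>n. f (Suc n)) has_sum S) UNIV"
proof -
  have "bij_betw Suc UNIV {1..}"
    by (rule bij_betwI[where g = "\<lambda>n. n - 1"]) auto
  from has_sum_reindex_bij_betw[OF this, of f S] show ?thesis by simp
qed

lemma summable_norm_ln_dpow:
  assumes "Re s > 1"
  shows "summable (\<lambda>n. norm (of_real (ln (real (Suc n))) * dpow (Suc n) s))"
proof -
  \<comment> \<open>At the real point Re s all terms have the same sign, so convergence there is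
    absolute convergence at s.\<close>
  define \<sigma> where "\<sigma> = complex_of_real (Re s)"
  have "Re \<sigma> > 1" using assms by (simp add: \<sigma>_def)
  then have "summable (\<lambda>n. - of_real (ln (real (Suc n))) * dpow (Suc n) \<sigma>)"
    using zeta_series sums_summable by metis
  moreover have "- of_real (ln (real (Suc n))) * dpow (Suc n) \<sigma>
       = - complex_of_real (norm (of_real (ln (real (Suc n))) * dpow (Suc n) s))" for n
    by (simp add: norm_mult norm_dpow) (simp add: \<sigma>_def dpow_def flip: exp_of_real)
  ultimately have "summable (\<lambda>n. - complex_of_real (norm (of_real (ln (real (Suc n))) * dpow (Suc n) s)))"
    by simp
  then show ?thesis by (simp only: summable_minus_iff summable_complex_of_real)
qed

lemma summable_norm_mangoldt_dpow:
  assumes "Re s > 1"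
  shows "summable (\<lambda>n. norm (mangoldt n * dpow n s))"
proof -
  have "summable (\<lambda>n. norm (mangoldt (Suc n) * dpow (Suc n) s))"
  proof (rule summable_comparison_test[OF _ summable_norm_ln_dpow[OF assms]], intro exI allI impI)
    fix n :: nat
    have "mangoldt (Suc n) \<le> ln (real (Suc n))" by (rule mangoldt_le) auto
    then show "norm (norm (mangoldt (Suc n) * dpow (Suc n) s)) \<le>
                 norm (of_real (ln (real (Suc n))) * dpow (Suc n) s)"
      using ln_ge_zero[of "real (Suc n)"]
      by (auto simp: norm_mult abs_mult mangoldt_nonneg simp del: of_nat_Suc intro!: mult_right_mono)
  qed
  then show ?thesis by (simp only: summable_Suc_iff[of "\<lambda>n. norm (mangoldt n * dpow n s)"])
qed

text \<open>This rests on \<open>mangoldt_sum\<close>: the values of \<Lambda> at the divisors of k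
  add up to ln k. The double series converges absolutely, so the pairs (m, n) may be regrouped by
  their product k, with m running through the divisors of k.\<close>

lemma mangoldt_series_mult_zeta_series:
  assumes s: "Re s > 1" and Z: "(\<lambda>n. dpow (Suc n) s) sums Z"
    and Z': "(\<lambda>n. - of_real (ln (real (Suc n))) * dpow (Suc n) s) sums Z'"
    and A: "(\<lambda>n. mangoldt n * dpow n s) sums A"
  shows "- Z' = A * Z"
proof -
  define f where "f = (\<lambda>(m, n). (mangoldt m * dpow m s) * dpow n s)"
  have nZ: "summable (\<lambda>n. norm (dpow (Suc n) s))"
    using summable_Suc_powr[OF s] by (subst norm_dpow_powr) auto
  have zs: "((\<lambda>n. dpow n s) has_sum Z) {1..}"
    unfolding has_sum_atLeast_1_iff by (rule norm_summable_imp_has_sum[OF nZ Z])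
  have ls: "((\<lambda>n. of_real (ln (real n)) * dpow n s) has_sum (-Z')) {1..}"
    unfolding has_sum_atLeast_1_iff
    by (rule norm_summable_imp_has_sum[OF summable_norm_ln_dpow[OF s]]) (use sums_minus[OF Z'] in simp)
  have nA: "summable (\<lambda>n. norm (mangoldt (Suc n) * dpow (Suc n) s))"
    using summable_norm_mangoldt_dpow[OF s] by (simp only: summable_Suc_iff[of "\<lambda>n. norm (mangoldt n * dpow n s)"])
  have "(\<lambda>n. mangoldt (Suc n) * dpow (Suc n) s) sums A"
    using A sums_Suc_iff[of "\<lambda>n. mangoldt n * dpow n s" A] by simp
  then have as: "((\<lambda>n. mangoldt n * dpow n s) has_sum A) {1..}"
    unfolding has_sum_atLeast_1_iff by (rule norm_summable_imp_has_sum[OF nA])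
  have "(\<lambda>x. norm (f x)) summable_on ({1..} \<times> {1..})"
  proof (rule summable_on_SigmaI)
    have nzs: "((\<lambda>n. norm (dpow n s)) has_sum (\<Sum>n. norm (dpow (Suc n) s))) {1..}"
      unfolding has_sum_atLeast_1_iff by (rule norm_summable_imp_has_sum) (use nZ in auto)
    show "((\<lambda>y. norm (f (x, y))) has_sum norm (mangoldt x * dpow x s) * (\<Sum>n. norm (dpow (Suc n) s))) {1..}" for x
      using has_sum_cmult_right[OF nzs, of "norm (mangoldt x * dpow x s)"] by (simp add: f_def norm_mult)
    have "((\<lambda>n. norm (mangoldt n * dpow n s)) has_sum (\<Sum>n. norm (mangoldt (Suc n) * dpow (Suc n) s))) {1..}"
      unfolding has_sum_atLeast_1_iff by (rule norm_summable_imp_has_sum) (use nA in auto)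
    from has_sum_cmult_left[OF this]
    show "(\<lambda>x. norm (mangoldt x * dpow x s) * (\<Sum>n. norm (dpow (Suc n) s))) summable_on {1..}"
      by (auto simp: summable_on_def)
  qed auto
  then have summ: "f summable_on ({1..} \<times> {1..})" by (rule abs_summable_summable)
  have "(f has_sum (A * Z)) ({1..} \<times> {1..})"
    by (rule has_sum_SigmaI[OF _ has_sum_cmult_left[OF as] summ])
       (use has_sum_cmult_right[OF zs] in \<open>simp add: f_def\<close>)
  also have "(f has_sum (A * Z)) ({1..} \<times> {1..}) \<longleftrightarrow>
     ((\<lambda>(k, d). mangoldt d * dpow k s) has_sum (A * Z)) (Sigma {1..} (\<lambda>k. {d. d dvd k}))"
    by (rule has_sum_reindex_bij_witness[where j = "\<lambda>(m, n). (m * n, m)" and i = "\<lambda>(k, d). (d, k div d)"])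
       (auto simp: f_def dpow_mult dvd_div_eq_0_iff Suc_le_eq intro!: Nat.gr0I)
  finally have "((\<lambda>(k, d). mangoldt d * dpow k s) has_sum (A * Z)) (Sigma {1..} (\<lambda>k. {d. d dvd k}))" .
  then have "((\<lambda>k. of_real (ln (real k)) * dpow k s) has_sum (A * Z)) {1..}"
  proof (rule has_sum_SigmaD)
    fix k :: nat assume "k \<in> {1..}"
    then have k: "k > 0" by auto
    have "((\<lambda>d. mangoldt d * dpow k s) has_sum (\<Sum>d | d dvd k. mangoldt d * dpow k s)) {d. d dvd k}"
      by (rule has_sum_finite) (use k in auto)
    also have "(\<Sum>d | d dvd k. mangoldt d * dpow k s) = of_real (ln (real k)) * dpow k s"
      using mangoldt_sum[of k, where 'a = complex] k by (simp flip: sum_distrib_right)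
    finally show "((\<lambda>y. case (k, y) of (k, d) \<Rightarrow> mangoldt d * dpow k s) has_sum of_real (ln (real k)) * dpow k s) {d. d dvd k}"
      by simp
  qed
  from has_sum_unique[OF this ls] show ?thesis by simp
qed

definition mangoldt_series :: "complex \<Rightarrow> complex" where
  "mangoldt_series s = (\<Sum>n. mangoldt n * dpow n s)"

lemma mangoldt_series_sums:
  "Re s > 1 \<Longrightarrow> (\<lambda>n. mangoldt n * dpow n s) sums mangoldt_series s"
  unfolding mangoldt_series_def
  by (rule summable_sums, rule summable_norm_cancel, rule summable_norm_mangoldt_dpow)

text \<open>The formula for the logarithmic derivative of (s - 1) zeta(s), multiplied out because
  zeros of \<open>zeta_reg\<close> are excluded only in \<open>zeta_reg_nonzero\<close>.\<close>

lemma deriv_zeta_reg: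
  assumes s: "Re s > 1"
  shows "(s - 1) * deriv zeta_reg s = zeta_reg s * (1 - (s - 1) * mangoldt_series s)"
proof -
  obtain Z Z' where Z: "\<And>s. Re s > 1 \<Longrightarrow> (\<lambda>n. dpow (Suc n) s) sums Z s"
    "\<And>s. Re s > 1 \<Longrightarrow> (\<lambda>n. - of_real (ln (real (Suc n))) * dpow (Suc n) s) sums Z' s"
    "\<And>s. Re s > 1 \<Longrightarrow> (Z has_field_derivative Z' s) (at s)"
    using zeta_series by blast
  have "((\<lambda>s. (s - 1) * Z s) has_field_derivative (Z s + (s - 1) * Z' s)) (at s)"
    by (rule derivative_eq_intros Z s refl)+ simp
  then have "(zeta_reg has_field_derivative (Z s + (s - 1) * Z' s)) (at s)"
    by (rule has_field_derivative_transform_within_open[OF _ open_Re_gt[of 1]])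
       (use s zeta_reg_eq[OF _ Z(1)] in auto)
  then have d: "deriv zeta_reg s = Z s + (s - 1) * Z' s" by (rule DERIV_imp_deriv)
  have *: "Z' s = - (mangoldt_series s * Z s)"
    using mangoldt_series_mult_zeta_series[OF s Z(1)[OF s] Z(2)[OF s] mangoldt_series_sums[OF s]]
    by (metis minus_minus)
  show ?thesis unfolding d * zeta_reg_eq[OF s Z(1)[OF s]] by (simp add: algebra_simps)
qed

section \<open>Non-vanishing on the closed half-plane Re s >= 1\<close>

lemma mangoldt_series_3_4_1:
  assumes "\<sigma> > 1"
  shows "3 * Re (mangoldt_series (of_real \<sigma>)) + 4 * Re (mangoldt_series (Complex \<sigma> t))
           + Re (mangoldt_series (Complex \<sigma> (2 * t))) \<ge> 0"
proof -
  have S: "(\<lambda>n. Re (mangoldt n * dpow n (Complex \<sigma> t))) sums Re (mangoldt_series (Complex \<sigma> t))" for t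
    using mangoldt_series_sums[of "Complex \<sigma> t"] assms by (intro sums_Re) auto
  have eq: "Re (mangoldt n * dpow n (Complex \<sigma> t)) = mangoldt n * exp (- \<sigma> * ln n) * cos (t * ln n)" for n t
    by (simp add: dpow_def Re_exp)
  have "(\<lambda>n. mangoldt n * exp (- \<sigma> * ln n) * (3 * cos (0 * ln n) + 4 * cos (t * ln n) + cos (2 * t * ln n)))
     sums (3 * Re (mangoldt_series (Complex \<sigma> 0)) + 4 * Re (mangoldt_series (Complex \<sigma> t))
           + Re (mangoldt_series (Complex \<sigma> (2 * t))))"
    using sums_add[OF sums_add[OF sums_mult[OF S[of 0], of 3] sums_mult[OF S[of t], of 4]] S[of "2*t"]]
    unfolding eq by (simp add: algebra_simps)
  moreover have "3 * cos (0 * x) + 4 * cos (t * x) + cos (2 * t * x) \<ge> 0" for x :: real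
  proof -
    have "3 * cos (0 * x) + 4 * cos (t * x) + cos (2 * t * x) = 2 * (1 + cos (t * x))\<^sup>2"
      using cos_double_cos[of "t * x"] by (simp add: power2_eq_square algebra_simps)
    then show ?thesis by simp
  qed
  ultimately show ?thesis
    by (auto simp: complex_of_real_def mangoldt_nonneg elim!: sums_le[OF _ sums_zero, rotated] intro!: mult_nonneg_nonneg)
qed

text \<open>The exponent \<open>k\<close> is the order of vanishing, with 0 included, so that the
  limits below treat zeros and other points alike. An identically vanishing \<open>zeta_reg\<close>
  is ruled out by its value 1 at 1.\<close>

lemma zeta_reg_factor:
  assumes "Re s0 > 0"
  obtains g r k where "0 < r" "ball s0 r \<subseteq> {s. Re s > 0}" "g holomorphic_on ball s0 r"
    "\<And>w. w \<in> ball s0 r \<Longrightarrow> zeta_reg w = (w - s0) ^ k * g w"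
    "\<And>w. w \<in> ball s0 r \<Longrightarrow> g w \<noteq> 0" "zeta_reg s0 = 0 \<longleftrightarrow> k > 0"
proof (cases "zeta_reg s0 = 0")
  case True
  have "\<not> zeta_reg constant_on {s. Re s > 0}"
  proof
    assume "zeta_reg constant_on {s. Re s > 0}"
    then obtain c where "\<And>s. Re s > 0 \<Longrightarrow> zeta_reg s = c" by (auto simp: constant_on_def)
    from this[of 1] this[OF assms] True show False by simp
  qed
  moreover have "connected {s. Re s > 0}"
    by (intro convex_connected convex_halfspace_Re_gt)
  ultimately show ?thesis
    using that holomorphic_factor_zero_nonconstant[OF holomorphic_zeta_reg open_Re_gt, of s0] True assms
    by (smt (verit, del_insts) mem_Collect_eq)
next
  case False
  have "continuous_on {s. Re s > 0} zeta_reg"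
    using holomorphic_zeta_reg by (rule holomorphic_on_imp_continuous_on)
  then have "open ({s. Re s > 0} \<inter> zeta_reg -` (- {0}))"
    by (intro continuous_open_preimage open_Re_gt) auto
  moreover have "s0 \<in> {s. Re s > 0} \<inter> zeta_reg -` (- {0})" using False assms by auto
  ultimately obtain r where r: "r > 0" "ball s0 r \<subseteq> {s. Re s > 0} \<inter> zeta_reg -` (- {0})"
    by (meson open_contains_ball)
  then have "zeta_reg holomorphic_on ball s0 r"
    by (intro holomorphic_on_subset[OF holomorphic_zeta_reg]) auto
  moreover have "zeta_reg w \<noteq> 0" if "w \<in> ball s0 r" for w using r(2) that by blast
  ultimately show ?thesis using that[of r zeta_reg 0] r False by simp
qed

text \<open>The order of vanishing is the residue of the logarithmic derivative. It is read off
  along the horizontal ray to the right of s0, where the Dirichlet series is available once Re s0 >=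
  1.\<close>

lemma zeta_reg_log_deriv_limit:
  assumes "Re s0 > 0"
  obtains k :: nat where "zeta_reg s0 = 0 \<longleftrightarrow> k > 0"
    "((\<lambda>e. of_real e * (deriv zeta_reg (s0 + of_real e) / zeta_reg (s0 + of_real e))) \<longlongrightarrow> of_nat k) (at_right 0)"
    "\<forall>\<^sub>F e in at_right 0. zeta_reg (s0 + of_real e) \<noteq> 0"
proof -
  obtain g r k where gr: "0 < r" "ball s0 r \<subseteq> {s. Re s > 0}" and hol: "g holomorphic_on ball s0 r" and
    fac: "\<And>w. w \<in> ball s0 r \<Longrightarrow> zeta_reg w = (w - s0) ^ k * g w" and
    nz: "\<And>w. w \<in> ball s0 r \<Longrightarrow> g w \<noteq> 0" and k: "zeta_reg s0 = 0 \<longleftrightarrow> k > 0"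
    using zeta_reg_factor[OF assms] by metis
  have small: "\<forall>\<^sub>F e in at_right 0. e \<in> {0<..<r}"
    using gr by (intro eventually_at_right_real)
  have ball: "s0 + of_real e \<in> ball s0 r" if "e \<in> {0<..<r}" for e :: real
    using that by (simp add: dist_norm)
  have der: "deriv zeta_reg w = of_nat k * (w - s0) ^ (k - 1) * g w + (w - s0) ^ k * deriv g w"
    if w: "w \<in> ball s0 r" for w
  proof -
    have g': "(g has_field_derivative deriv g w) (at w)"
      using hol w by (intro holomorphic_derivI) auto
    have "((\<lambda>w. (w - s0) ^ k * g w) has_field_derivative
        of_nat k * (w - s0) ^ (k - 1) * g w + (w - s0) ^ k * deriv g w) (at w)"
      by (rule derivative_eq_intros g' refl)+ simp
    then have "(zeta_reg has_field_derivative
        of_nat k * (w - s0) ^ (k - 1) * g w + (w - s0) ^ k * deriv g w) (at w)"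
      by (rule has_field_derivative_transform_within_open[OF _ open_ball w]) (simp add: fac)
    then show ?thesis by (rule DERIV_imp_deriv)
  qed
  have eq: "of_real e * (deriv zeta_reg (s0 + of_real e) / zeta_reg (s0 + of_real e)) =
      of_nat k + of_real e * (deriv g (s0 + of_real e) / g (s0 + of_real e))" if e: "e \<in> {0<..<r}" for e :: real
  proof -
    have "zeta_reg (s0 + of_real e) = of_real e ^ k * g (s0 + of_real e)"
      using fac[OF ball[OF e]] by simp
    moreover have "deriv zeta_reg (s0 + of_real e) =
        of_nat k * of_real e ^ (k - 1) * g (s0 + of_real e) + of_real e ^ k * deriv g (s0 + of_real e)"
      using der[OF ball[OF e]] by simp
    ultimately show ?thesis using nz[OF ball[OF e]] e by (cases k) (auto simp: field_simps)
  qed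
  have cont: "continuous_on (ball s0 r) (\<lambda>w. deriv g w / g w)"
    using nz hol by (intro holomorphic_on_imp_continuous_on holomorphic_intros) auto
  then have "isCont (\<lambda>w. deriv g w / g w) s0" using gr by (simp add: continuous_on_eq_continuous_at)
  moreover have "((\<lambda>e. s0 + complex_of_real e) \<longlongrightarrow> s0 + of_real 0) (at_right 0)"
    by (intro tendsto_intros)
  ultimately have "((\<lambda>e. deriv g (s0 + of_real e) / g (s0 + of_real e)) \<longlongrightarrow> deriv g s0 / g s0) (at_right 0)"
    using isCont_tendsto_compose[of s0 "\<lambda>w. deriv g w / g w" "\<lambda>e. s0 + complex_of_real e"] by simp
  then have "((\<lambda>e. of_nat k + of_real e * (deriv g (s0 + of_real e) / g (s0 + of_real e)))
      \<longlongrightarrow> of_nat k + of_real 0 * (deriv g s0 / g s0)) (at_right 0)"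
    by (intro tendsto_add tendsto_mult tendsto_const tendsto_of_real tendsto_ident_at)
  then have "((\<lambda>e. of_real e * (deriv zeta_reg (s0 + of_real e) / zeta_reg (s0 + of_real e)))
      \<longlongrightarrow> of_nat k + of_real 0 * (deriv g s0 / g s0)) (at_right 0)"
    by (rule Lim_transform_eventually) (use eq in \<open>intro eventually_mono[OF small], auto\<close>)
  then have "((\<lambda>e. of_real e * (deriv zeta_reg (s0 + of_real e) / zeta_reg (s0 + of_real e))) \<longlongrightarrow> of_nat k) (at_right 0)"
    by simp
  moreover have "\<forall>\<^sub>F e in at_right 0. zeta_reg (s0 + of_real e) \<noteq> 0"
  proof (rule eventually_mono[OF small])
    fix e :: real assume e: "e \<in> {0<..<r}"
    then show "zeta_reg (s0 + of_real e) \<noteq> 0" using fac[OF ball[OF e]] nz[OF ball[OF e]] by simp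
  qed
  ultimately show ?thesis using that k by blast
qed

text \<open>By \<open>deriv_zeta_reg\<close> the series is 1 / (s - 1) minus the logarithmic
  derivative of \<open>zeta_reg\<close>; the pole accounts for the conditional, a zero of order k
  for - k.\<close>

lemma mangoldt_series_limit:
  assumes "Re s0 \<ge> 1"
  obtains k :: nat where "zeta_reg s0 = 0 \<longleftrightarrow> k > 0"
    "((\<lambda>e. of_real e * mangoldt_series (s0 + of_real e)) \<longlongrightarrow> (if s0 = 1 then 1 else 0) - of_nat k) (at_right 0)"
proof -
  have "Re s0 > 0" using assms by simp
  from zeta_reg_log_deriv_limit[OF this] obtain k :: nat where k: "zeta_reg s0 = 0 \<longleftrightarrow> k > 0"
    and lim: "((\<lambda>e. of_real e * (deriv zeta_reg (s0 + of_real e) / zeta_reg (s0 + of_real e))) \<longlongrightarrow> of_nat k) (at_right 0)"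
    and nz: "\<forall>\<^sub>F e in at_right 0. zeta_reg (s0 + of_real e) \<noteq> 0" by blast
  have "((\<lambda>e. complex_of_real e / (s0 + of_real e - 1)) \<longlongrightarrow> (if s0 = 1 then 1 else 0)) (at_right 0)"
  proof (cases "s0 = 1")
    case True
    have "\<forall>\<^sub>F e in at_right 0. complex_of_real e / (s0 + of_real e - 1) = 1"
      using eventually_at_right_less[of 0] by eventually_elim (use True in auto)
    then show ?thesis using True by (simp add: tendsto_eventually)
  next
    case False
    have "((\<lambda>e. complex_of_real e / (s0 + of_real e - 1)) \<longlongrightarrow> complex_of_real 0 / (s0 + of_real 0 - 1)) (at_right 0)"
      using False by (intro tendsto_intros) auto
    then show ?thesis using False by simp
  qed
  from tendsto_diff[OF this lim]
  have "((\<lambda>e. of_real e * mangoldt_series (s0 + of_real e)) \<longlongrightarrow> (if s0 = 1 then 1 else 0) - of_nat k) (at_right 0)"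
  proof (rule Lim_transform_eventually)
    show "\<forall>\<^sub>F e in at_right 0. complex_of_real e / (s0 + of_real e - 1) -
        of_real e * (deriv zeta_reg (s0 + of_real e) / zeta_reg (s0 + of_real e)) =
        of_real e * mangoldt_series (s0 + of_real e)"
      using nz eventually_at_right_less[of 0]
    proof eventually_elim
      case (elim e)
      define w where "w = s0 + of_real e"
      have w: "Re w > 1" using elim assms by (simp add: w_def)
      then have "w - 1 \<noteq> 0" by auto
      with deriv_zeta_reg[OF w] elim have "deriv zeta_reg w / zeta_reg w = 1 / (w - 1) - mangoldt_series w"
        unfolding w_def[symmetric] by (simp add: field_simps)
      then show ?case unfolding w_def[symmetric] by (simp add: ring_distribs)
    qed
  qed
  then show ?thesis using that k by blast
qed

lemma norm_mangoldt_series_le: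
  assumes "1 < c" "c \<le> Re s"
  shows "norm (mangoldt_series s) \<le> (\<Sum>n. norm (mangoldt n * dpow n (of_real c)))"
proof -
  have *: "norm (mangoldt n * dpow n s) \<le> norm (mangoldt n * dpow n (of_real c))" for n
    using assms by (cases "n = 0") (auto simp: norm_mult norm_dpow mangoldt_nonneg intro!: mult_left_mono mult_right_mono)
  have "norm (mangoldt_series s) \<le> (\<Sum>n. norm (mangoldt n * dpow n s))"
    unfolding mangoldt_series_def using assms by (intro summable_norm summable_norm_mangoldt_dpow) auto
  also have "\<dots> \<le> (\<Sum>n. norm (mangoldt n * dpow n (of_real c)))"
    using assms by (intro suminf_le * summable_norm_mangoldt_dpow) auto
  finally show ?thesis .
qed

text \<open>To the right of the line the series stays bounded, which forces order 0. On the line, at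
  height t different from 0, let k1 and k2 be the orders at heights t and 2 t. The inequality
  \<open>mangoldt_series_3_4_1\<close>, multiplied by e and taken to the limit, becomes 3 - 4 k1 -
  k2 >= 0, where the 3 comes from the pole at 1; hence k1 = 0.\<close>

lemma zeta_reg_nonzero:
  assumes "Re s0 \<ge> 1"
  shows "zeta_reg s0 \<noteq> 0"
proof (cases "Re s0 > 1")
  case True
  obtain k :: nat where k: "zeta_reg s0 = 0 \<longleftrightarrow> k > 0" and
    lim: "((\<lambda>e. of_real e * mangoldt_series (s0 + of_real e)) \<longlongrightarrow> (if s0 = 1 then 1 else 0) - of_nat k) (at_right 0)"
    using mangoldt_series_limit[OF assms] by blast
  define M where "M = (\<Sum>n. norm (mangoldt n * dpow n (of_real (Re s0))))"
  have "((\<lambda>e. of_real e * mangoldt_series (s0 + of_real e)) \<longlongrightarrow> 0) (at_right 0)"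
  proof (rule Lim_null_comparison)
    show "\<forall>\<^sub>F e in at_right 0. norm (of_real e * mangoldt_series (s0 + of_real e)) \<le> e * M"
      using eventually_at_right_less[of 0]
    proof eventually_elim
      case (elim e)
      then have "norm (mangoldt_series (s0 + of_real e)) \<le> M"
        unfolding M_def using True by (intro norm_mangoldt_series_le) auto
      then show ?case using elim by (simp add: norm_mult mult_left_mono)
    qed
    show "((\<lambda>e. e * M) \<longlongrightarrow> 0) (at_right 0)"
      by (rule tendsto_eq_intros refl | simp)+
  qed
  from tendsto_unique[OF _ lim this] have "of_nat k = (0 :: complex)" using True by (auto split: if_splits)
  then show ?thesis using k by simp
next
  case False
  define t where "t = Im s0"
  have s0: "s0 = Complex 1 t" using False assms by (simp add: t_def complex_eq_iff)
  have L: "\<exists>k::nat. (zeta_reg (Complex 1 t) = 0 \<longleftrightarrow> k > 0) \<and>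
    ((\<lambda>e. e * Re (mangoldt_series (Complex (1 + e) t))) \<longlongrightarrow> (if t = 0 then 1 else 0) - real k) (at_right 0)" for t
  proof -
    obtain k :: nat where k: "zeta_reg (Complex 1 t) = 0 \<longleftrightarrow> k > 0" and
    lim: "((\<lambda>e. of_real e * mangoldt_series (Complex 1 t + of_real e)) \<longlongrightarrow> (if Complex 1 t = 1 then 1 else 0) - of_nat k) (at_right 0)"
      using mangoldt_series_limit[of "Complex 1 t"] by auto
    have e: "Complex 1 t + of_real e = Complex (1 + e) t" for e by (simp add: complex_eq_iff)
    have r: "Re ((if Complex 1 t = 1 then 1 else 0) - of_nat k) = (if t = 0 then 1 else 0) - real k"
      by (simp add: complex_eq_iff)
    have "Re (of_real e * z) = e * Re z" for e z by simp
    then have "((\<lambda>e. e * Re (mangoldt_series (Complex (1 + e) t))) \<longlongrightarrow> (if t = 0 then 1 else 0) - real k) (at_right 0)"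
      using tendsto_Re[OF lim] unfolding e r by simp
    with k show ?thesis by blast
  qed
  show ?thesis
  proof (cases "t = 0")
    case True
    then show ?thesis using zeta_reg_1 by (simp add: s0 flip: one_complex.code)
  next
    case False
    obtain k0 :: nat where k0: "zeta_reg (Complex 1 0) = 0 \<longleftrightarrow> k0 > 0"
      "((\<lambda>e. e * Re (mangoldt_series (Complex (1 + e) 0))) \<longlongrightarrow> 1 - real k0) (at_right 0)"
      using L[of 0] by auto
    have "k0 = 0" using k0(1) by (simp flip: one_complex.code)
    obtain k1 :: nat where k1: "zeta_reg (Complex 1 t) = 0 \<longleftrightarrow> k1 > 0"
      "((\<lambda>e. e * Re (mangoldt_series (Complex (1 + e) t))) \<longlongrightarrow> 0 - real k1) (at_right 0)"
      using L[of t] False by auto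
    obtain k2 :: nat where k2:
      "((\<lambda>e. e * Re (mangoldt_series (Complex (1 + e) (2 * t)))) \<longlongrightarrow> 0 - real k2) (at_right 0)"
      using L[of "2 * t"] False by auto
    have "((\<lambda>e. 3 * (e * Re (mangoldt_series (Complex (1 + e) 0))) + 4 * (e * Re (mangoldt_series (Complex (1 + e) t)))
        + e * Re (mangoldt_series (Complex (1 + e) (2 * t)))) \<longlongrightarrow>
        3 * (1 - real k0) + 4 * (0 - real k1) + (0 - real k2)) (at_right 0)"
      by (intro tendsto_intros k0 k1 k2)
    moreover have "\<forall>\<^sub>F e in at_right 0. 0 \<le> 3 * (e * Re (mangoldt_series (Complex (1 + e) 0))) +
       4 * (e * Re (mangoldt_series (Complex (1 + e) t))) + e * Re (mangoldt_series (Complex (1 + e) (2 * t)))"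
      using eventually_at_right_less[of 0]
    proof eventually_elim
      case (elim e)
      have "0 \<le> e * (3 * Re (mangoldt_series (of_real (1 + e))) + 4 * Re (mangoldt_series (Complex (1 + e) t))
           + Re (mangoldt_series (Complex (1 + e) (2 * t))))"
        using elim by (intro mult_nonneg_nonneg mangoldt_series_3_4_1) auto
      then show ?case by (simp add: complex_of_real_def algebra_simps)
    qed
    ultimately have "0 \<le> 3 * (1 - real k0) + 4 * (0 - real k1) + (0 - real k2)"
      by (intro tendsto_lowerbound[where F = "at_right 0"]) auto
    then have "k1 = 0" using \<open>k0 = 0\<close> by auto
    then show ?thesis using k1 s0 by simp
  qed
qed

section \<open>The upper bound in the prime number theorem\<close>

text \<open>The Fejer kernel, of total mass 2 pi. It is nonnegative, and by
  \<open>fejer_has_integral\<close> it is the cosine transform of the triangle 2 (1 - t / L) on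
  [0, L]; the argument lives on these two properties.\<close>

definition fejer :: "real \<Rightarrow> real \<Rightarrow> real" where
  "fejer L v = L * (sinc (L * v / 2))\<^sup>2"

lemma fejer_nonneg: "L \<ge> 0 \<Longrightarrow> fejer L v \<ge> 0"
  by (simp add: fejer_def)

lemma continuous_on_fejer: "continuous_on S (fejer L)"
  unfolding fejer_def by (intro continuous_intros) simp

lemma one_minus_cos_eq: "1 - cos x = 2 * (sin (x / 2))\<^sup>2" for x :: real
  using cos_double_sin[of "x / 2"] by simp

lemma one_minus_cos_bounds: "0 \<le> 4 * (1 - cos x)" "4 * (1 - cos x) \<le> 8" for x :: real
proof -
  have "0 \<le> 4 * (1 - c) \<and> 4 * (1 - c) \<le> 8" if "-1 \<le> c" "c \<le> 1" for c :: real using that by simp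
  from this[OF cos_ge_minus_one cos_le_one] show "0 \<le> 4 * (1 - cos x)" "4 * (1 - cos x) \<le> 8" by auto
qed

lemma fejer_altdef: "L > 0 \<Longrightarrow> v \<noteq> 0 \<Longrightarrow> fejer L v = 2 * (1 - cos (L * v)) / (L * v\<^sup>2)"
  unfolding one_minus_cos_eq by (simp add: fejer_def power2_eq_square field_simps)

lemma fejer_has_integral:
  assumes L: "L > 0"
  shows "((\<lambda>t. 2 * (1 - t / L) * cos (t * v)) has_integral fejer L v) {0..L}"
proof (cases "v = 0")
  case True
  have "((\<lambda>t. 2 * (1 - t / L)) has_integral ((\<lambda>t. 2 * t - t\<^sup>2 / L) L - (\<lambda>t. 2 * t - t\<^sup>2 / L) 0)) {0..L}"
    using L by (intro fundamental_theorem_of_calculus)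
      (auto simp flip: has_real_derivative_iff_has_vector_derivative intro!: derivative_eq_intros simp: field_simps)
  moreover have "(\<lambda>t. 2 * t - t\<^sup>2 / L) L - (\<lambda>t. 2 * t - t\<^sup>2 / L) 0 = fejer L v"
    using L True by (simp add: fejer_def power2_eq_square)
  ultimately show ?thesis using True by simp
next
  case False
  define F where "F = (\<lambda>t. 2 * (1 - t / L) * sin (t * v) / v - 2 * cos (t * v) / (L * v\<^sup>2))"
  have "((\<lambda>t. 2 * (1 - t / L) * cos (t * v)) has_integral (F L - F 0)) {0..L}"
    using L False unfolding F_def by (intro fundamental_theorem_of_calculus)
      (auto simp flip: has_real_derivative_iff_has_vector_derivative intro!: derivative_eq_intros
            simp: field_simps power2_eq_square)
  moreover have "F L - F 0 = fejer L v"
    using L False by (simp add: F_def fejer_altdef diff_divide_distrib right_diff_distrib)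
  ultimately show ?thesis by simp
qed

lemma fejer_mass:
  assumes L: "L > 0" and r: "r > 0"
  shows "(fejer L has_integral (4 * Si (L * r) - 4 * (1 - cos (L * r)) / (L * r))) {-r..r}"
proof -
  \<comment> \<open>An antiderivative of the kernel. Its second part is written with
    \<open>sinc\<close> so that it is continuous at 0; away from 0 it is the elementary quotient of
    the next fact, and the point 0 is exempted from the derivative condition.\<close>
  define \<Phi> where "\<Phi> = (\<lambda>v. 2 * Si (L * v) - L * v * (sinc (L * v / 2))\<^sup>2)"
  have \<Phi>: "\<Phi> v = 2 * Si (L * v) - 2 * (1 - cos (L * v)) / (L * v)" if "v \<noteq> 0" for v
    unfolding one_minus_cos_eq using that L by (simp add: \<Phi>_def power2_eq_square field_simps)
  have "(fejer L has_integral (\<Phi> r - \<Phi> (-r))) {-r..r}"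
  proof (rule fundamental_theorem_of_calculus_interior_strong[of "{0}"])
    have "continuous_on {-r..r} (\<lambda>v. Si (L * v))"
      by (intro continuous_at_imp_continuous_on ballI isCont_o2[OF _ isCont_Si] continuous_intros)
    then show "continuous_on {-r..r} \<Phi>" unfolding \<Phi>_def by (intro continuous_on_diff continuous_on_mult continuous_on_const continuous_on_id continuous_on_power continuous_on_sinc continuous_on_divide) auto
    fix v assume "v \<in> {-r<..<r} - {0}"
    then have v: "v \<noteq> 0" by auto
    have "((\<lambda>v. 2 * Si (L * v) - 2 * (1 - cos (L * v)) / (L * v)) has_real_derivative fejer L v) (at v)"
      using L v by (auto intro!: derivative_eq_intros DERIV_chain2[OF DERIV_Si] simp: fejer_altdef)
        (simp add: field_simps power2_eq_square)
    then have "(\<Phi> has_real_derivative fejer L v) (at v)"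
      by (rule has_field_derivative_transform_within_open[of _ _ _ "-{0}"]) (use v \<Phi> in auto)
    then show "(\<Phi> has_vector_derivative fejer L v) (at v)"
      by (simp add: has_real_derivative_iff_has_vector_derivative)
  qed (use r in auto)
  moreover have "\<Phi> r - \<Phi> (-r) = 4 * Si (L * r) - 4 * (1 - cos (L * r)) / (L * r)"
  proof -
    have "Si (- (L * r)) = - Si (L * r)" using L r by (intro Si_neg) auto
    then show ?thesis using r L by (simp add: \<Phi>) (simp add: field_simps)
  qed
  ultimately show ?thesis by simp
qed

text \<open>For fixed r the whole mass concentrates in [-r, r] as L grows, because Si tends to pi /
  2.\<close>

lemma fejer_mass_limit:
  assumes r: "r > 0"
  shows "((\<lambda>L. 4 * Si (L * r) - 4 * (1 - cos (L * r)) / (L * r)) \<longlongrightarrow> 2 * pi) at_top"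
proof -
  have f: "filterlim (\<lambda>L. L * r) at_top at_top"
    using r by (intro filterlim_at_top_mult_tendsto_pos[OF tendsto_const]) (auto simp: filterlim_ident)
  have S: "((\<lambda>x. 4 * Si x) \<longlongrightarrow> 4 * (pi / 2)) at_top" by (intro tendsto_intros Si_at_top)
  have C: "((\<lambda>x. 4 * (1 - cos x) / x) \<longlongrightarrow> 0) (at_top :: real filter)"
  proof (rule Lim_null_comparison)
    show "\<forall>\<^sub>F x :: real in at_top. norm (4 * (1 - cos x) / x) \<le> 8 / x"
      using eventually_gt_at_top[of 0]
    proof eventually_elim
      case (elim x)
      then show ?case using one_minus_cos_bounds[of x] unfolding real_norm_def abs_divide
        by (simp only: abs_of_nonneg abs_of_pos divide_right_mono less_imp_le)
    qed
    show "((\<lambda>x::real. 8 / x) \<longlongrightarrow> 0) at_top"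
      by (intro tendsto_divide_0[OF tendsto_const] filterlim_at_top_imp_at_infinity filterlim_ident)
  qed
  have "((\<lambda>x. 4 * Si x - 4 * (1 - cos x) / x) \<longlongrightarrow> 2 * pi) at_top"
    using tendsto_diff[OF S C] by simp
  from filterlim_compose[OF this f] show ?thesis by simp
qed

text \<open>
  Since the Fourier transform of the kernel has compact support, weighted sums of \<open>\<Lambda>\<close> with this kernel only
  involve the logarithmic derivative of zeta on a bounded piece of the line \<open>Re s = 1\<close>; no growth
  estimates for zeta are needed.
\<close>

lemma mangoldt_fejer_le_integral:
  assumes L: "L > 0" and e: "e > 0"
  obtains J where "((\<lambda>t. 2 * (1 - t / L) * Re (cis (t * u) * mangoldt_series (Complex (1 + e) t))) has_integral J) {0..L}"
    "\<And>N. (\<Sum>n<N. mangoldt n * exp (- (1 + e) * ln (real n)) * fejer L (ln (real n) - u)) \<le> J"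
proof -
  define a where "a = (\<lambda>n. mangoldt n * exp (- (1 + e) * ln (real n)))"
  define P where "P = (\<lambda>N t. \<Sum>n<N. a n * (2 * (1 - t / L) * cos (t * (ln (real n) - u))))"
  define g where "g = (\<lambda>t. 2 * (1 - t / L) * Re (cis (t * u) * mangoldt_series (Complex (1 + e) t)))"
  have a0: "a n \<ge> 0" for n by (simp add: a_def mangoldt_nonneg)
  have norm_a: "norm (mangoldt n * dpow n (Complex (1 + e) t)) = a n" for n t
    by (simp add: norm_mult norm_dpow a_def mangoldt_nonneg)
  have "summable (\<lambda>n. norm (mangoldt n * dpow n (Complex (1 + e) 0)))"
    using e by (intro summable_norm_mangoldt_dpow) auto
  then have suma: "summable a" unfolding norm_a .
  have sums_g: "(\<lambda>n. a n * (2 * (1 - t / L) * cos (t * (ln (real n) - u)))) sums g t" for t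
  proof -
    have "(\<lambda>n. mangoldt n * dpow n (Complex (1 + e) t)) sums mangoldt_series (Complex (1 + e) t)"
      using e by (intro mangoldt_series_sums) auto
    from sums_mult[OF sums_Re[OF sums_mult[OF this, of "cis (t * u)"]], of "2 * (1 - t / L)"]
    have "(\<lambda>n. 2 * (1 - t / L) * Re (cis (t * u) * (mangoldt n * dpow n (Complex (1 + e) t)))) sums g t"
      unfolding g_def .
    moreover have "Re (cis (t * u) * (mangoldt n * dpow n (Complex (1 + e) t))) = a n * cos (t * (ln (real n) - u))" for n
      by (simp add: dpow_def a_def Re_exp Im_exp right_diff_distrib cos_diff) (simp add: algebra_simps)
    ultimately have "(\<lambda>n. 2 * (1 - t / L) * (a n * cos (t * (ln (real n) - u)))) sums g t" by (simp only:)
    then show ?thesis by (simp only: mult_ac)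
  qed
  have "uniform_limit {0..L} P (\<lambda>t. \<Sum>n. a n * (2 * (1 - t / L) * cos (t * (ln (real n) - u)))) sequentially"
    unfolding P_def
  proof (rule Weierstrass_m_test)
    fix n t assume t: "t \<in> {0..L}"
    have "\<bar>2 * (1 - t / L) * cos (t * (ln (real n) - u))\<bar> \<le> 2 * 1"
      unfolding abs_mult using t L by (intro mult_mono) (auto simp: field_simps)
    then show "norm (a n * (2 * (1 - t / L) * cos (t * (ln (real n) - u)))) \<le> a n * 2"
      using a0[of n] by (simp add: abs_mult mult_left_mono)
  next
    show "summable (\<lambda>n. a n * 2)" using suma by (rule summable_mult2)
  qed
  then have lim: "uniform_limit (cbox 0 L) P g sequentially"
    using sums_g by (simp add: sums_iff cbox_interval)
  have "continuous_on (cbox 0 L) (P N)" for N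
    unfolding P_def using L by (intro continuous_intros) auto
  from uniform_limit_integral_cbox[OF lim this] obtain I J where
    I: "\<And>N. (P N has_integral I N) (cbox 0 L)" and J: "(g has_integral J) (cbox 0 L)" and IJ: "I \<longlonglongrightarrow> J"
    by auto
  have "(P N has_integral (\<Sum>n<N. a n * fejer L (ln (real n) - u))) {0..L}" for N
    unfolding P_def by (intro has_integral_sum has_integral_mult_right fejer_has_integral L) auto
  then have Ieq: "I N = (\<Sum>n<N. a n * fejer L (ln (real n) - u))" for N
    by (intro has_integral_unique[OF I[of N]]) (simp add: cbox_interval)
  have "mono I"
    unfolding incseq_Suc_iff Ieq using a0 L by (simp add: fejer_nonneg)
  then have "I N \<le> J" for N
    using IJ by (simp add: incseq_le)
  with J that[of J] show ?thesis by (simp add: g_def Ieq a_def cbox_interval)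
qed

text \<open>Integration by parts against \<open>cis (t * u)\<close> gains 1/u. The constant is
  uniform in e because the logarithmic derivative of \<open>zeta_reg\<close> and its derivative are
  bounded on the compact rectangle 1 <= Re s <= 2, 0 <= Im s <= L. Its left edge is where the
  non-vanishing on the line Re s = 1 enters.\<close>

lemma zeta_log_deriv_fourier_decay:
  assumes L: "L > 0"
  obtains C where "\<And>e u. 0 < e \<Longrightarrow> e \<le> 1 \<Longrightarrow> u > 0 \<Longrightarrow>
    \<exists>I. ((\<lambda>t. of_real (2 * (1 - t / L)) * (cis (t * u) * (deriv zeta_reg (Complex (1 + e) t) / zeta_reg (Complex (1 + e) t))))
            has_integral I) {0..L} \<and> norm I \<le> C / u"
proof -
  define q where "q = (\<lambda>s. deriv zeta_reg s / zeta_reg s)"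
  define U where "U = {s. Re s > 0} \<inter> zeta_reg -` (- {0})"
  have "continuous_on {s. Re s > 0} zeta_reg"
    using holomorphic_zeta_reg by (rule holomorphic_on_imp_continuous_on)
  then have U: "open U"
    unfolding U_def by (intro continuous_open_preimage open_Re_gt) auto
  have hol: "zeta_reg holomorphic_on U"
    by (rule holomorphic_on_subset[OF holomorphic_zeta_reg]) (auto simp: U_def)
  have holq: "q holomorphic_on U"
    unfolding q_def using U hol by (intro holomorphic_intros) (auto simp: U_def)
  define R where "R = cbox (Complex 1 0) (Complex 2 L)"
  have R: "s \<in> R \<longleftrightarrow> 1 \<le> Re s \<and> Re s \<le> 2 \<and> 0 \<le> Im s \<and> Im s \<le> L" for s
    by (auto simp: R_def in_cbox_complex_iff)
  have RU: "R \<subseteq> U" using zeta_reg_nonzero by (force simp: U_def R)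
  have "compact R" by (simp add: R_def)
  have "bounded (q ` R)"
    by (intro compact_imp_bounded compact_continuous_image \<open>compact R\<close> holomorphic_on_imp_continuous_on
        holomorphic_on_subset[OF holq RU])
  then obtain B1 where B1: "\<And>s. s \<in> R \<Longrightarrow> norm (q s) \<le> B1" by (auto simp: bounded_iff)
  have "bounded (deriv q ` R)"
    by (intro compact_imp_bounded compact_continuous_image \<open>compact R\<close> holomorphic_on_imp_continuous_on
        holomorphic_on_subset[OF holomorphic_deriv[OF holq U] RU])
  then obtain B2 where B2: "\<And>s. s \<in> R \<Longrightarrow> norm (deriv q s) \<le> B2" by (auto simp: bounded_iff)
  have "norm (q 1) \<le> B1" using L by (intro B1) (auto simp: R)
  then have B10: "B1 \<ge> 0" using norm_ge_zero order_trans by blast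
  have "norm (deriv q 1) \<le> B2" using L by (intro B2) (auto simp: R)
  then have B20: "B2 \<ge> 0" using norm_ge_zero order_trans by blast
  \<comment> \<open>The first part bounds the boundary term at 0, as the weight vanishes at t = L;
    the second is the length L times a bound for \<open>h'\<close>.\<close>
  define C where "C = 2 * B1 + L * (2 / L * B1 + 2 * B2)"
  show ?thesis
  proof (rule that[of C])
    fix e u :: real assume e: "0 < e" "e \<le> 1" and u: "u > 0"
    define E where "E = (\<lambda>t. cis (t * u) / (\<i> * of_real u))"
    define h where "h = (\<lambda>t. of_real (2 * (1 - t / L)) * q (Complex (1 + e) t))"
    define h' where "h' = (\<lambda>t. of_real (- 2 / L) * q (Complex (1 + e) t)
        + of_real (2 * (1 - t / L)) * (\<i> * deriv q (Complex (1 + e) t)))"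
    have inR: "Complex (1 + e) t \<in> R" if "t \<in> {0..L}" for t using that e by (simp add: R)
    have cline: "continuous_on {0..L} (\<lambda>t. Complex (1 + e) t)"
      unfolding complex_eq_iff Complex_eq by (intro continuous_intros)
    have contq: "continuous_on {0..L} (\<lambda>t. q (Complex (1 + e) t))"
      by (rule continuous_on_compose2[OF holomorphic_on_imp_continuous_on[OF holq] cline]) (use inR RU in auto)
    have contq': "continuous_on {0..L} (\<lambda>t. deriv q (Complex (1 + e) t))"
      by (rule continuous_on_compose2[OF holomorphic_on_imp_continuous_on[OF holomorphic_deriv[OF holq U]] cline])
         (use inR RU in auto)
    have dE: "(E has_vector_derivative cis (t * u)) (at t within {0..L})" for t
    proof -
      have "((\<lambda>t. exp (\<i> * of_real t * of_real u) / (\<i> * of_real u)) has_vector_derivative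
          exp (\<i> * of_real t * of_real u)) (at t within {0..L})"
        using u by (auto intro!: derivative_eq_intros has_vector_derivative_real_field)
      then show ?thesis by (simp add: E_def cis_conv_exp mult_ac)
    qed
    have dq: "((\<lambda>t. q (Complex (1 + e) t)) has_vector_derivative \<i> * deriv q (Complex (1 + e) t)) (at t within {0..L})"
      if "t \<in> {0..L}" for t
    proof -
      have "((\<lambda>t. Complex (1 + e) t) has_vector_derivative \<i>) (at t within {0..L})"
        unfolding Complex_eq by (auto intro!: derivative_eq_intros)
      moreover have "(q has_field_derivative deriv q (Complex (1 + e) t)) (at (Complex (1 + e) t) within (\<lambda>t. Complex (1 + e) t) ` {0..L})"
        using inR[OF that] RU holomorphic_derivI[OF holq U] has_field_derivative_at_within by blast
      ultimately show ?thesis using field_vector_diff_chain_within by (force simp: o_def)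
    qed
    have dh: "(h has_vector_derivative h' t) (at t within {0..L})" if "t \<in> {0..L}" for t
      unfolding h_def h'_def using dq[OF that] L
      by (auto intro!: derivative_eq_intros simp: field_simps)
    have ft: "((\<lambda>t. h' t * E t + h t * cis (t * u)) has_integral (h L * E L - h 0 * E 0)) {0..L}"
      using L by (intro fundamental_theorem_of_calculus)
        (auto intro!: derivative_eq_intros dh dE simp: algebra_simps)
    have "continuous_on {0..L} (\<lambda>t. h' t * E t)"
      unfolding h'_def E_def using L u by (intro continuous_intros contq contq') auto
    then have int': "((\<lambda>t. h' t * E t) has_integral integral {0..L} (\<lambda>t. h' t * E t)) {0..L}"
      by (intro integrable_integral integrable_continuous_real)
    have I: "((\<lambda>t. h t * cis (t * u)) has_integral (h L * E L - h 0 * E 0 - integral {0..L} (\<lambda>t. h' t * E t))) {0..L}"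
      using has_integral_diff[OF ft int'] by simp
    have nE: "norm (E t) = 1 / u" for t using u by (simp add: E_def norm_divide norm_mult)
    have "norm (h' t * E t) \<le> (2 / L * B1 + 2 * B2) * (1 / u)" if t: "t \<in> {0..L}" for t
    proof -
      have w: "\<bar>2 * (1 - t / L)\<bar> \<le> 2" using t L by (auto simp: field_simps)
      have "norm (h' t) \<le> norm (of_real (- 2 / L) * q (Complex (1 + e) t)) +
         norm (of_real (2 * (1 - t / L)) * (\<i> * deriv q (Complex (1 + e) t)))"
        unfolding h'_def by (rule norm_triangle_ineq)
      also have "\<dots> = 2 / L * norm (q (Complex (1 + e) t)) + \<bar>2 * (1 - t / L)\<bar> * norm (deriv q (Complex (1 + e) t))"
        using L by (simp only: norm_mult norm_of_real) simp
      also have "\<dots> \<le> 2 / L * B1 + 2 * B2"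
        using w L B20 by (intro add_mono mult_mono B1 B2 inR t) auto
      finally show ?thesis unfolding norm_mult nE using u by (intro mult_right_mono) auto
    qed
    note bound = this
    have B: "0 \<le> (2 / L * B1 + 2 * B2) * (1 / u)" using L u B10 B20 by (intro mult_nonneg_nonneg add_nonneg_nonneg) auto
    have "norm (integral {0..L} (\<lambda>t. h' t * E t)) \<le> ((2 / L * B1 + 2 * B2) * (1 / u)) * (L - 0)"
      by (rule order_trans[OF has_integral_bound_real[OF B _ int', of "{}"]]) (use L bound in auto)
    then have n1: "norm (integral {0..L} (\<lambda>t. h' t * E t)) \<le> L * (2 / L * B1 + 2 * B2) / u"
      by (simp add: mult_ac)
    have "norm (h 0 * E 0) = 2 * norm (q (Complex (1 + e) 0)) / u"
      by (simp add: norm_mult nE h_def)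
    also have "\<dots> \<le> 2 * B1 / u"
      using L u by (intro divide_right_mono mult_left_mono B1 inR) auto
    finally have n2: "norm (h 0 * E 0) \<le> 2 * B1 / u" .
    have hL: "h L = 0" using L by (simp add: h_def)
    have "norm (h L * E L - h 0 * E 0 - integral {0..L} (\<lambda>t. h' t * E t)) \<le>
       norm (h 0 * E 0) + norm (integral {0..L} (\<lambda>t. h' t * E t))"
      unfolding hL using norm_triangle_ineq4[of "- (h 0 * E 0)"] by simp
    also have "\<dots> \<le> C / u" using n1 n2 by (simp add: C_def add_divide_distrib)
    finally show "\<exists>I. ((\<lambda>t. of_real (2 * (1 - t / L)) * (cis (t * u) * (deriv zeta_reg (Complex (1 + e) t) / zeta_reg (Complex (1 + e) t))))
            has_integral I) {0..L} \<and> norm I \<le> C / u"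
      using I by (intro exI[of _ "h L * E L - h 0 * E 0 - integral {0..L} (\<lambda>t. h' t * E t)"] conjI)
        (auto simp: h_def q_def mult_ac)
  qed
qed

text \<open>\<open>sinc\<close> abbreviates a conditional; an opaque name keeps the removable
  singularity out of the algebra below.\<close>

definition sinc_fun :: "real \<Rightarrow> real" where
  "sinc_fun x = sinc x"

lemma sin_eq_mult_sinc: "sin x = x * sinc_fun x"
  by (simp add: sinc_fun_def)

lemma abs_sinc_le_1: "\<bar>sinc_fun x\<bar> \<le> 1"
  using abs_sin_x_le_abs_x[of x] by (cases "x = 0") (auto simp: sinc_fun_def field_simps)

lemma Si_has_real_derivative: "(Si has_real_derivative sinc_fun x) (at x)"
  unfolding sinc_fun_def by (rule DERIV_Si)

lemma Si_0 [simp]: "Si 0 = 0"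
  using Si_neg[of 0] by simp

text \<open>The real part of the pole term contains t sin (t u), which is u sinc (t u) times t^2,
  and t^2 is D - e^2. This leaves three pieces: a Poisson kernel of width e, the sinc term that
  produces Si, and a remainder of size u e times a Poisson kernel, which dies as e tends to
  0.\<close>

lemma fourier_pole_part_le:
  fixes e t u w :: real
  assumes e: "e > 0" and u: "u > 0" and w: "0 \<le> w" "w \<le> 2"
  shows "w * Re (cis (t * u) / Complex e t) \<le> 2 * e / (e\<^sup>2 + t\<^sup>2) + w * (u * sinc_fun (t * u)) + 2 * u * e * (e / (e\<^sup>2 + t\<^sup>2))"
proof -
  define D where "D = e\<^sup>2 + t\<^sup>2"
  have D: "D > 0" using e by (simp add: D_def add_pos_nonneg)
  have eq: "Re (cis (t * u) / Complex e t) = e * cos (t * u) / D + u * sinc_fun (t * u) - u * sinc_fun (t * u) * (e\<^sup>2 / D)"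
  proof -
    have "Re (cis (t * u) / Complex e t) = (e * cos (t * u) + t * sin (t * u)) / D"
      by (simp add: Re_divide D_def algebra_simps)
    also have "sin (t * u) = t * u * sinc_fun (t * u)" by (rule sin_eq_mult_sinc)
    also have "(e * cos (t * u) + t * (t * u * sinc_fun (t * u))) / D = e * cos (t * u) / D + u * sinc_fun (t * u) * ((D - e\<^sup>2) / D)"
      by (simp add: D_def power2_eq_square add_divide_distrib mult_ac)
    also have "(D - e\<^sup>2) / D = 1 - e\<^sup>2 / D" using D by (simp add: field_simps)
    finally show ?thesis by (simp add: algebra_simps)
  qed
  have "w * (e * cos (t * u) / D) \<le> 2 * (e * 1 / D)"
  proof -
    have "w * (e * cos (t * u) / D) \<le> w * (e * 1 / D)"
      using e D w by (intro mult_left_mono divide_right_mono) auto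
    also have "\<dots> \<le> 2 * (e * 1 / D)" using e D w by (intro mult_right_mono) auto
    finally show ?thesis .
  qed
  moreover have "- (w * (u * sinc_fun (t * u) * (e\<^sup>2 / D))) \<le> 2 * (u * 1 * (e\<^sup>2 / D))"
  proof -
    have "- sinc_fun (t * u) \<le> 1" using abs_sinc_le_1[of "t * u"] by linarith
    have "w * (u * (- sinc_fun (t * u)) * (e\<^sup>2 / D)) \<le> w * (u * 1 * (e\<^sup>2 / D))"
      using u D w abs_sinc_le_1[of "t * u"] by (intro mult_left_mono mult_right_mono) auto
    also have "\<dots> \<le> 2 * (u * 1 * (e\<^sup>2 / D))" using u D w by (intro mult_right_mono) auto
    finally show ?thesis by simp
  qed
  ultimately show ?thesis unfolding eq D_def[symmetric] by (simp add: algebra_simps power2_eq_square)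
qed

text \<open>The Poisson kernel contributes pi, and 2 Si (L u) contributes another pi as u grows. The
  sum 2 pi is the total mass of the kernel, which is why the leading constant for psi comes out as
  1.\<close>

lemma mangoldt_fejer_bound_aux:
  assumes L: "L > 0"
  obtains C where "\<And>e u N. 0 < e \<Longrightarrow> e \<le> 1 \<Longrightarrow> u > 0 \<Longrightarrow>
     (\<Sum>n<N. mangoldt n * exp (- (1 + e) * ln (real n)) * fejer L (ln (real n) - u))
       \<le> pi + 2 * Si (L * u) + u * e * pi + C / u"
proof -
  obtain C where C: "\<And>e u. 0 < e \<Longrightarrow> e \<le> 1 \<Longrightarrow> u > 0 \<Longrightarrow>
    \<exists>I. ((\<lambda>t. of_real (2 * (1 - t / L)) * (cis (t * u) * (deriv zeta_reg (Complex (1 + e) t) / zeta_reg (Complex (1 + e) t))))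
            has_integral I) {0..L} \<and> norm I \<le> C / u"
    using zeta_log_deriv_fourier_decay[OF L] by blast
  show ?thesis
  proof (rule that[of C])
    fix e u :: real and N :: nat
    assume e: "0 < e" "e \<le> 1" and u: "u > 0"
    obtain J where J: "((\<lambda>t. 2 * (1 - t / L) * Re (cis (t * u) * mangoldt_series (Complex (1 + e) t))) has_integral J) {0..L}"
      and le: "\<And>N. (\<Sum>n<N. mangoldt n * exp (- (1 + e) * ln (real n)) * fejer L (ln (real n) - u)) \<le> J"
      by (rule mangoldt_fejer_le_integral[OF L e(1), of u]) (rule that)
    obtain I where I: "((\<lambda>t. of_real (2 * (1 - t / L)) * (cis (t * u) * (deriv zeta_reg (Complex (1 + e) t) / zeta_reg (Complex (1 + e) t))))
            has_integral I) {0..L}" and nI: "norm I \<le> C / u"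
      using C[OF e u] by blast
    have i1: "((\<lambda>t. e / (e\<^sup>2 + t\<^sup>2)) has_integral (arctan (L / e) - arctan (0 / e))) {0..L}"
    proof (intro fundamental_theorem_of_calculus)
      fix t assume "t \<in> {0..L}"
      have "((\<lambda>t. arctan (t / e)) has_real_derivative (e / (e\<^sup>2 + t\<^sup>2))) (at t within {0..L})"
        using e by (auto intro!: derivative_eq_intros simp: field_simps power2_eq_square add_pos_nonneg)
      then show "((\<lambda>t. arctan (t / e)) has_vector_derivative (e / (e\<^sup>2 + t\<^sup>2))) (at t within {0..L})"
        by (simp add: has_real_derivative_iff_has_vector_derivative)
    qed (use L in auto)
    \<comment> \<open>The antiderivative comes from (t / L) u sinc (t u) = sin (t u) / L.\<close>
    have i2: "((\<lambda>t. 2 * (1 - t / L) * (u * sinc_fun (t * u))) has_integral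
        ((2 * Si (L * u) + 2 * cos (L * u) / (L * u)) - (2 * Si (0 * u) + 2 * cos (0 * u) / (L * u)))) {0..L}"
    proof (intro fundamental_theorem_of_calculus)
      fix t assume "t \<in> {0..L}"
      have "((\<lambda>t. 2 * Si (t * u) + 2 * cos (t * u) / (L * u)) has_real_derivative
         2 * (sinc_fun (t * u) * u) - 2 * sin (t * u) * u / (L * u)) (at t within {0..L})"
        using u L by (auto intro!: derivative_eq_intros DERIV_chain2[OF Si_has_real_derivative])
      also have "2 * (sinc_fun (t * u) * u) - 2 * sin (t * u) * u / (L * u) = 2 * (1 - t / L) * (u * sinc_fun (t * u))"
        unfolding sin_eq_mult_sinc[of "t * u"] using L u by (simp add: field_simps )
      finally show "((\<lambda>t. 2 * Si (t * u) + 2 * cos (t * u) / (L * u)) has_vector_derivative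
         2 * (1 - t / L) * (u * sinc_fun (t * u))) (at t within {0..L})"
        by (simp only: has_real_derivative_iff_has_vector_derivative)
    qed (use L in auto)
    have "((\<lambda>t. 2 * (e / (e\<^sup>2 + t\<^sup>2)) + 2 * (1 - t / L) * (u * sinc_fun (t * u)) + 2 * u * e * (e / (e\<^sup>2 + t\<^sup>2)) -
        Re (of_real (2 * (1 - t / L)) * (cis (t * u) * (deriv zeta_reg (Complex (1 + e) t) / zeta_reg (Complex (1 + e) t)))))
       has_integral (2 * (arctan (L / e) - arctan (0 / e)) +
         ((2 * Si (L * u) + 2 * cos (L * u) / (L * u)) - (2 * Si (0 * u) + 2 * cos (0 * u) / (L * u)))
        + 2 * u * e * (arctan (L / e) - arctan (0 / e)) - Re I)) {0..L}"
      by (intro has_integral_add has_integral_diff has_integral_mult_right i1 i2 has_integral_Re I)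
    then have "J \<le> 2 * (arctan (L / e) - arctan (0 / e)) +
         ((2 * Si (L * u) + 2 * cos (L * u) / (L * u)) - (2 * Si (0 * u) + 2 * cos (0 * u) / (L * u)))
        + 2 * u * e * (arctan (L / e) - arctan (0 / e)) - Re I"
    proof (rule has_integral_le[OF J])
      fix t assume t: "t \<in> {0..L}"
      define s where "s = Complex (1 + e) t"
      define w where "w = 2 * (1 - t / L)"
      have w: "0 \<le> w" "w \<le> 2" using t L by (auto simp: w_def field_simps)
      have s: "Re s > 1" "s - 1 = Complex e t" using e by (auto simp: s_def complex_eq_iff)
      have nz: "zeta_reg s \<noteq> 0" using s by (intro zeta_reg_nonzero) auto
      have "s - 1 \<noteq> 0" using s(1) by auto
      with nz deriv_zeta_reg[OF s(1)] have "mangoldt_series s = 1 / (s - 1) - deriv zeta_reg s / zeta_reg s"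
        by (simp add: field_simps)
      then have A: "cis (t * u) * mangoldt_series s = cis (t * u) / Complex e t - cis (t * u) * (deriv zeta_reg s / zeta_reg s)"
        unfolding s(2) by (simp add: right_diff_distrib)
      have Re_w: "Re (of_real w * z) = w * Re z" for z by simp
      have "w * Re (cis (t * u) * mangoldt_series s) =
         w * Re (cis (t * u) / Complex e t) - Re (of_real w * (cis (t * u) * (deriv zeta_reg s / zeta_reg s)))"
        unfolding A Re_w by (simp only: minus_complex.simps right_diff_distrib)
      also have "w * Re (cis (t * u) / Complex e t) \<le> 2 * e / (e\<^sup>2 + t\<^sup>2) + w * (u * sinc_fun (t * u)) + 2 * u * e * (e / (e\<^sup>2 + t\<^sup>2))"
        by (rule fourier_pole_part_le[OF e(1) u w])
      finally show "2 * (1 - t / L) * Re (cis (t * u) * mangoldt_series (Complex (1 + e) t)) \<le>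
         2 * (e / (e\<^sup>2 + t\<^sup>2)) + 2 * (1 - t / L) * (u * sinc_fun (t * u)) + 2 * u * e * (e / (e\<^sup>2 + t\<^sup>2)) -
        Re (of_real (2 * (1 - t / L)) * (cis (t * u) * (deriv zeta_reg (Complex (1 + e) t) / zeta_reg (Complex (1 + e) t))))"
        unfolding s_def w_def by simp
    qed
    also have "\<dots> = 2 * arctan (L / e) + (2 * Si (L * u) - 2 * (1 - cos (L * u)) / (L * u)) + 2 * u * e * arctan (L / e) - Re I"
      by (simp add: diff_divide_distrib)
    also have "\<dots> \<le> pi + 2 * Si (L * u) + u * e * pi + C / u"
    proof -
      have a: "2 * arctan (L / e) \<le> pi" using arctan_ubound[of "L / e"] by linarith
      then have "u * e * (2 * arctan (L / e)) \<le> u * e * pi" using u e by (intro mult_left_mono) auto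
      moreover have "- Re I \<le> C / u" using nI abs_Re_le_cmod[of I] by linarith
      moreover have "0 \<le> 2 * (1 - cos (L * u)) / (L * u)" using L u by simp
      moreover have "2 * u * e * arctan (L / e) = u * e * (2 * arctan (L / e))" by simp
      ultimately show ?thesis using a by linarith
    qed
    finally show "(\<Sum>n<N. mangoldt n * exp (- (1 + e) * ln (real n)) * fejer L (ln (real n) - u))
       \<le> pi + 2 * Si (L * u) + u * e * pi + C / u" using le[of N] by linarith
  qed
qed

text \<open>The limit e to 0 can be taken termwise because the sums are finite, and the bound does
  not depend on N.\<close>

lemma mangoldt_fejer_bound:
  assumes L: "L > 0"
  obtains C where "\<And>u N. u > 0 \<Longrightarrow>
     (\<Sum>n<N. mangoldt n / real n * fejer L (ln (real n) - u)) \<le> pi + 2 * Si (L * u) + C / u"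
proof -
  obtain C where C: "\<And>e u N. 0 < e \<Longrightarrow> e \<le> 1 \<Longrightarrow> u > 0 \<Longrightarrow>
     (\<Sum>n<N. mangoldt n * exp (- (1 + e) * ln (real n)) * fejer L (ln (real n) - u))
       \<le> pi + 2 * Si (L * u) + u * e * pi + C / u"
    using mangoldt_fejer_bound_aux[OF L] by blast
  show ?thesis
  proof (rule that[of C])
    fix u :: real and N :: nat assume u: "u > 0"
    have "((\<lambda>e. \<Sum>n<N. mangoldt n * exp (- (1 + e) * ln (real n)) * fejer L (ln (real n) - u)) \<longlongrightarrow>
       (\<Sum>n<N. mangoldt n * exp (- (1 + 0) * ln (real n)) * fejer L (ln (real n) - u))) (at_right 0)"
      by (intro tendsto_intros)
    moreover have "((\<lambda>e. pi + 2 * Si (L * u) + u * e * pi + C / u) \<longlongrightarrow> pi + 2 * Si (L * u) + u * 0 * pi + C / u) (at_right 0)"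
      by (intro tendsto_intros)
    moreover have "\<forall>\<^sub>F e :: real in at_right 0. e \<in> {0<..<1}" by (rule eventually_at_right_real) simp
    then have "\<forall>\<^sub>F e in at_right 0. (\<Sum>n<N. mangoldt n * exp (- (1 + e) * ln (real n)) * fejer L (ln (real n) - u))
       \<le> pi + 2 * Si (L * u) + u * e * pi + C / u"
      by eventually_elim (use C u in auto)
    ultimately have lim: "(\<Sum>n<N. mangoldt n * exp (- (1 + 0) * ln (real n)) * fejer L (ln (real n) - u))
        \<le> pi + 2 * Si (L * u) + u * 0 * pi + C / u"
      by (intro tendsto_le[of "at_right 0"]) auto
    have eq: "mangoldt n * exp (- (1 + 0) * ln (real n)) = mangoldt n / real n" for n
      by (cases "n = 0") (auto simp: exp_minus field_simps)
    show "(\<Sum>n<N. mangoldt n / real n * fejer L (ln (real n) - u)) \<le> pi + 2 * Si (L * u) + C / u"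
      using lim unfolding eq by simp
  qed
qed

text \<open>The smoothed bound is averaged over all u in an interval that exceeds
  [ln x, ln x + \<eta>] by r at both ends. Each n of the sum then collects at least the mass of the
  kernel on [-r, r], nearly 2 pi, while the right-hand side is nearly 2 pi times the length of the
  interval.\<close>

lemma mangoldt_short_sum_bound:
  fixes \<eta> \<kappa> :: real
  assumes \<eta>: "\<eta> > 0" and \<kappa>: "0 < \<kappa>" "\<kappa> \<le> 1"
  obtains X0 where "X0 \<ge> 1" "\<And>x. x \<ge> X0 \<Longrightarrow> (\<Sum>n | x < real n \<and> real n \<le> x * exp \<eta>. mangoldt n / real n) \<le> \<eta> * (1 + \<kappa>)"
proof -
  \<comment> \<open>With these q and r the averaging interval has length \<eta> q; the collected
    mass is at least 2 pi / q and the bound at most 2 pi q. The total loss is the factor q^3, at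
    most 1 + \<kappa>.\<close>
  define q where "q = 1 + \<kappa> / 4"
  have q: "q > 1" using \<kappa> by (simp add: q_def)
  define r where "r = \<eta> * \<kappa> / 8"
  have r: "r > 0" using \<eta> \<kappa> by (simp add: r_def)
  have "2 * pi / q < 2 * pi" using q pi_gt_zero by (simp add: field_simps)
  then have "\<forall>\<^sub>F L in at_top. 2 * pi / q < 4 * Si (L * r) - 4 * (1 - cos (L * r)) / (L * r)"
    by (rule order_tendstoD(1)[OF fejer_mass_limit[OF r]])
  then have "\<forall>\<^sub>F L in at_top. L > 0 \<and> 2 * pi / q < 4 * Si (L * r) - 4 * (1 - cos (L * r)) / (L * r)"
    using eventually_gt_at_top[of 0] by eventually_elim auto
  then obtain L where L: "L > 0" and mL: "2 * pi / q < 4 * Si (L * r) - 4 * (1 - cos (L * r)) / (L * r)"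
    by (auto simp: eventually_at_top_linorder)
  define m where "m = 4 * Si (L * r) - 4 * (1 - cos (L * r)) / (L * r)"
  have mass: "(fejer L has_integral m) {-r..r}" unfolding m_def by (rule fejer_mass[OF L r])
  have m: "m > 2 * pi / q" using mL by (simp add: m_def)
  obtain C where C: "\<And>u N. u > 0 \<Longrightarrow>
     (\<Sum>n<N. mangoldt n / real n * fejer L (ln (real n) - u)) \<le> pi + 2 * Si (L * u) + C / u"
    using mangoldt_fejer_bound[OF L] by blast
  have "filterlim (\<lambda>u. L * u) at_top at_top"
    using L by (intro filterlim_tendsto_pos_mult_at_top[OF tendsto_const]) (auto simp: filterlim_ident)
  then have "((\<lambda>u. pi + 2 * Si (L * u) + C / u) \<longlongrightarrow> pi + 2 * (pi / 2) + 0) at_top"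
    by (intro tendsto_intros filterlim_compose[OF Si_at_top] tendsto_divide_0[OF tendsto_const]
        filterlim_at_top_imp_at_infinity filterlim_ident)
  moreover have "pi + 2 * (pi / 2) + 0 < 2 * pi * q" using q pi_gt_zero by simp
  ultimately have "\<forall>\<^sub>F u in at_top. pi + 2 * Si (L * u) + C / u < 2 * pi * q"
    by (rule order_tendstoD(2))
  then have "\<forall>\<^sub>F u in at_top. u > 0 \<and> pi + 2 * Si (L * u) + C / u < 2 * pi * q"
    using eventually_gt_at_top[of 0] by eventually_elim auto
  then obtain U where U: "\<And>u. u \<ge> U \<Longrightarrow> u > 0 \<and> pi + 2 * Si (L * u) + C / u < 2 * pi * q"
    by (auto simp: eventually_at_top_linorder)
  have U0: "U > 0" using U[of U] by simp
  show ?thesis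
  proof (rule that[of "exp (U + r)"])
    show "exp (U + r) \<ge> 1" using U0 r by simp
    fix x :: real assume x: "x \<ge> exp (U + r)"
    have x0: "x > 0" using x by (rule less_le_trans[OF exp_gt_zero])
    define u0 where "u0 = ln x"
    have u0: "u0 \<ge> U + r" using x x0 by (simp add: u0_def ln_ge_iff)
    define F where "F = {n. x < real n \<and> real n \<le> x * exp \<eta>}"
    have FN: "F \<subseteq> {..<Suc (nat \<lfloor>x * exp \<eta>\<rfloor>)}" by (auto simp: F_def less_Suc_eq_le le_nat_floor)
    have finF: "finite F" using FN finite_subset by blast
    define a b where "a = u0 - r" and "b = u0 + \<eta> + r"
    have ab: "a \<le> b" using r \<eta> by (simp add: a_def b_def)
    have int: "(\<lambda>u. fejer L (ln (real n) - u)) integrable_on {a..b}" for n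
      by (intro integrable_continuous_real continuous_on_compose2[OF continuous_on_fejer[of UNIV]] continuous_intros) auto
    have "((\<lambda>u. \<Sum>n\<in>F. mangoldt n / real n * fejer L (ln (real n) - u)) has_integral
        (\<Sum>n\<in>F. mangoldt n / real n * integral {a..b} (\<lambda>u. fejer L (ln (real n) - u)))) {a..b}"
      by (intro has_integral_sum finF has_integral_mult_right integrable_integral int)
    moreover have "((\<lambda>u. 2 * pi * q) has_integral (2 * pi * q * (b - a))) {a..b}"
      using has_integral_const_real[of "2 * pi * q" a b] ab by (simp add: mult.commute)
    moreover have "(\<Sum>n\<in>F. mangoldt n / real n * fejer L (ln (real n) - u)) \<le> 2 * pi * q" if u: "u \<in> {a..b}" for u
    proof -
      have "(\<Sum>n\<in>F. mangoldt n / real n * fejer L (ln (real n) - u)) \<le>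
         (\<Sum>n<Suc (nat \<lfloor>x * exp \<eta>\<rfloor>). mangoldt n / real n * fejer L (ln (real n) - u))"
        using L by (intro sum_mono2 FN mult_nonneg_nonneg fejer_nonneg divide_nonneg_nonneg mangoldt_nonneg) auto
      also have "\<dots> \<le> pi + 2 * Si (L * u) + C / u"
        using U[of u] u u0 by (intro C) (auto simp: a_def)
      also have "\<dots> \<le> 2 * pi * q" using U[of u] u u0 by (auto simp: a_def)
      finally show ?thesis .
    qed
    ultimately have up: "(\<Sum>n\<in>F. mangoldt n / real n * integral {a..b} (\<lambda>u. fejer L (ln (real n) - u))) \<le> 2 * pi * q * (b - a)"
      by (rule has_integral_le)
    have low: "m \<le> integral {a..b} (\<lambda>u. fejer L (ln (real n) - u))" if n: "n \<in> F" for n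
    proof -
      define c where "c = ln (real n)"
      have nx: "x < real n" "real n \<le> x * exp \<eta>" using n by (auto simp: F_def)
      have "u0 \<le> c" using nx x0 by (simp add: u0_def c_def)
      moreover have "c \<le> ln (x * exp \<eta>)" unfolding c_def using nx x0 by (subst ln_le_cancel_iff) auto
      then have "c \<le> u0 + \<eta>" using x0 by (simp add: u0_def ln_mult)
      ultimately have sub: "{c - r..c + r} \<subseteq> {a..b}" by (auto simp: a_def b_def)
      have "((\<lambda>u. fejer L (u + (- c))) has_integral m) {-r - (-c)..r - (-c)}"
        by (rule has_integral_shift_real_ivl[OF mass])
      moreover have "fejer L (u + (- c)) = fejer L (c - u)" for u
      proof -
        have "L * (u - c) / 2 = - (L * (c - u) / 2)" by (simp add: field_simps)
        then show ?thesis unfolding fejer_def by (simp only: add_uminus_conv_diff sinc_neg)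
      qed
      ultimately have "((\<lambda>u. fejer L (c - u)) has_integral m) {c - r..c + r}" by (simp add: add.commute)
      then have "integral {c - r..c + r} (\<lambda>u. fejer L (c - u)) = m" "(\<lambda>u. fejer L (c - u)) integrable_on {c - r..c + r}"
        by (auto intro: integral_unique)
      then show ?thesis using integral_subset_le[OF sub _ int[of n, folded c_def]] L
        by (simp add: fejer_nonneg c_def)
    qed
    have "(\<Sum>n\<in>F. mangoldt n / real n) * m \<le> (\<Sum>n\<in>F. mangoldt n / real n * integral {a..b} (\<lambda>u. fejer L (ln (real n) - u)))"
      unfolding sum_distrib_right by (intro sum_mono mult_left_mono low divide_nonneg_nonneg mangoldt_nonneg) auto
    also note up
    also have "b - a = \<eta> * q" by (simp add: a_def b_def r_def q_def field_simps)
    finally have le: "(\<Sum>n\<in>F. mangoldt n / real n) * m \<le> 2 * pi * q * (\<eta> * q)" .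
    have S0: "(\<Sum>n\<in>F. mangoldt n / real n) \<ge> (0::real)"
      by (intro sum_nonneg divide_nonneg_nonneg mangoldt_nonneg) auto
    have "(\<Sum>n\<in>F. mangoldt n / real n) * (2 * pi / q) \<le> 2 * pi * q * (\<eta> * q)"
      using mult_left_mono[OF less_imp_le[OF m] S0] le by linarith
    then have "(\<Sum>n\<in>F. mangoldt n / real n) \<le> \<eta> * (q * q * q)"
      using q pi_gt_zero by (simp add: field_simps)
    also have "\<dots> \<le> \<eta> * (1 + \<kappa>)"
    proof (intro mult_left_mono)
      have 1: "\<kappa> * \<kappa> \<le> \<kappa> * 1" by (intro mult_left_mono) (use \<kappa> in auto)
      have 2: "\<kappa> * \<kappa> * \<kappa> \<le> \<kappa> * \<kappa> * 1" by (intro mult_left_mono) (use \<kappa> in auto)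
      have "q * q * q = 1 + 3 / 4 * \<kappa> + 3 / 16 * (\<kappa> * \<kappa>) + 1 / 64 * (\<kappa> * \<kappa> * \<kappa>)"
        by (simp add: q_def field_simps)
      then show "q * q * q \<le> 1 + \<kappa>" using 1 2 \<kappa> by linarith
    qed (use \<eta> in auto)
    finally show "(\<Sum>n | x < real n \<and> real n \<le> x * exp \<eta>. mangoldt n / real n) \<le> \<eta> * (1 + \<kappa>)"
      by (simp add: F_def)
  qed
qed

section \<open>Chebyshev's function\<close>

definition chebyshev_psi :: "real \<Rightarrow> real" where
  "chebyshev_psi x = (\<Sum>n | real n \<le> x. mangoldt n)"

lemma finite_nat_le_real: "finite {n. real n \<le> x}"
  by (rule finite_subset[of _ "{..nat \<lfloor>x\<rfloor>}"]) (auto simp: le_nat_floor)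

lemma chebyshev_psi_mono: "x \<le> y \<Longrightarrow> chebyshev_psi x \<le> chebyshev_psi y"
  unfolding chebyshev_psi_def by (intro sum_mono2 finite_nat_le_real) (auto simp: mangoldt_nonneg)

lemma chebyshev_psi_nonneg: "chebyshev_psi x \<ge> 0"
  unfolding chebyshev_psi_def by (intro sum_nonneg mangoldt_nonneg)

text \<open>Induction on the scale. Passing from y to x = y exp \<eta> adds at most x times the
  short sum of \<Lambda>(n) / n, hence at most y \<eta> (1 + \<epsilon>), and \<eta> <= exp \<eta> -
  1 turns this into (1 + \<epsilon>) (x - y). The constant absorbs the range in which the short sum
  is not controlled.\<close>

theorem chebyshev_psi_upper_bound:
  assumes \<epsilon>: "\<epsilon> > 0"
  obtains C0 where "\<And>x. x \<ge> 0 \<Longrightarrow> chebyshev_psi x \<le> (1 + \<epsilon>) * x + C0"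
proof -
  \<comment> \<open>This choice makes (1 + \<kappa>)^2 = 1 + 2 \<kappa> + \<kappa>^2 at most 1 + 3
    \<kappa>, hence at most 1 + \<epsilon>.\<close>
  define \<kappa> where "\<kappa> = min 1 (\<epsilon> / 3)"
  have \<kappa>: "0 < \<kappa>" "\<kappa> \<le> 1" "\<kappa> \<le> \<epsilon> / 3" using \<epsilon> by (auto simp: \<kappa>_def)
  define \<eta> where "\<eta> = ln (1 + \<kappa>)"
  have \<eta>: "\<eta> > 0" "exp \<eta> = 1 + \<kappa>" using \<kappa> by (auto simp: \<eta>_def)
  have ke: "(1 + \<kappa>) * exp \<eta> \<le> 1 + \<epsilon>"
  proof -
    have 1: "\<kappa> * \<kappa> \<le> \<kappa> * 1" by (intro mult_left_mono) (use \<kappa> in auto)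
    have "(1 + \<kappa>) * exp \<eta> = 1 + 2 * \<kappa> + \<kappa> * \<kappa>" unfolding \<eta> by (simp add: algebra_simps)
    then show ?thesis using 1 \<kappa> by linarith
  qed
  obtain X0 where X0: "X0 \<ge> 1" "\<And>x. x \<ge> X0 \<Longrightarrow> (\<Sum>n | x < real n \<and> real n \<le> x * exp \<eta>. mangoldt n / real n) \<le> \<eta> * (1 + \<kappa>)"
    using mangoldt_short_sum_bound[OF \<eta>(1) \<kappa>(1,2)] by blast
  define C0 where "C0 = chebyshev_psi (X0 * exp \<eta>)"
  have base: "chebyshev_psi x \<le> (1 + \<epsilon>) * x + C0" if "0 \<le> x" "x \<le> X0 * exp \<eta>" for x
  proof -
    have "0 \<le> (1 + \<epsilon>) * x" using that \<epsilon> by simp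
    then show ?thesis using chebyshev_psi_mono[OF that(2)] unfolding C0_def by linarith
  qed
  have step: "chebyshev_psi x \<le> (1 + \<epsilon>) * x + C0" if "0 \<le> x" "x \<le> X0 * exp \<eta> ^ Suc k" for k x
    using that
  proof (induction k arbitrary: x)
    case 0
    then show ?case using base by simp
  next
    case (Suc k)
    show ?case
    proof (cases "x \<le> X0 * exp \<eta>")
      case True
      then show ?thesis using base Suc.prems by simp
    next
      case False
      define y where "y = x / exp \<eta>"
      have xy: "x = y * exp \<eta>" by (simp add: y_def)
      have y: "y \<ge> X0" using False by (simp add: xy)
      have "y \<le> X0 * exp \<eta> ^ Suc k" using Suc.prems(2) by (simp add: xy mult_ac)
      then have IH: "chebyshev_psi y \<le> (1 + \<epsilon>) * y + C0" using y X0 by (intro Suc.IH) auto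
      have yx: "y \<le> x" using y X0 \<eta> \<kappa> by (simp add: xy)
      have "{n. real n \<le> x} = {n. real n \<le> y} \<union> {n. y < real n \<and> real n \<le> x}" using yx by auto
      moreover have "finite {n. y < real n \<and> real n \<le> x}"
        by (rule finite_subset[OF _ finite_nat_le_real[of x]]) auto
      ultimately have "chebyshev_psi x = chebyshev_psi y + (\<Sum>n | y < real n \<and> real n \<le> x. mangoldt n)"
        unfolding chebyshev_psi_def by (simp add: sum.union_disjoint[OF finite_nat_le_real] disjoint_iff not_le)
      also have "(\<Sum>n | y < real n \<and> real n \<le> x. mangoldt n) \<le> (\<Sum>n | y < real n \<and> real n \<le> x. x * (mangoldt n / real n))"
      proof (intro sum_mono)
        fix n assume "n \<in> {n. y < real n \<and> real n \<le> x}"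
        then have n: "0 < real n" "real n \<le> x" using y X0 by auto
        have "real n * mangoldt n \<le> x * mangoldt n" using n by (intro mult_right_mono mangoldt_nonneg) auto
        then show "mangoldt n \<le> x * (mangoldt n / real n)" using n by (simp add: field_simps)
      qed
      also have "\<dots> = x * (\<Sum>n | y < real n \<and> real n \<le> x. mangoldt n / real n)" by (simp add: sum_distrib_left)
      also have "\<dots> \<le> x * (\<eta> * (1 + \<kappa>))"
        using X0(2)[OF y] Suc.prems(1) unfolding xy[symmetric] by (intro mult_left_mono)
      also note IH
      also have "(1 + \<epsilon>) * y + C0 + x * (\<eta> * (1 + \<kappa>)) \<le> (1 + \<epsilon>) * x + C0"
      proof -
        have e1: "1 + \<eta> \<le> exp \<eta>" by (rule exp_ge_add_one_self)
        have "x * (\<eta> * (1 + \<kappa>)) = y * (\<eta> * ((1 + \<kappa>) * exp \<eta>))" by (simp add: xy mult_ac)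
        also have "\<dots> \<le> y * (\<eta> * (1 + \<epsilon>))" using ke y X0 \<eta> by (intro mult_left_mono) auto
        also have "\<dots> \<le> y * ((exp \<eta> - 1) * (1 + \<epsilon>))" by (intro mult_left_mono mult_right_mono) (use e1 y X0 \<epsilon> in linarith)+
        finally show ?thesis unfolding xy by (simp add: algebra_simps)
      qed
      finally show ?thesis by simp
    qed
  qed
  show ?thesis
  proof (rule that[of C0])
    fix x :: real assume x: "x \<ge> 0"
    obtain k where "x < exp \<eta> ^ k" using real_arch_pow[of "exp \<eta>" x] \<eta>(1) by (auto simp del: \<eta>(2))
    also have "exp \<eta> ^ k \<le> exp \<eta> ^ Suc k" using \<eta> \<kappa> by simp
    also have "\<dots> \<le> X0 * exp \<eta> ^ Suc k" using mult_right_mono[OF X0(1), of "exp \<eta> ^ Suc k"] by simp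
    finally show "chebyshev_psi x \<le> (1 + \<epsilon>) * x + C0" using x by (intro step[where k = k]) auto
  qed
qed

section \<open>Linear recurrences modulo integers\<close>

text \<open>The forcing term may vary with n because splitting a factor X - 1 off the characteristic
  polynomial replaces a constant by a sequence.\<close>

definition rec_mod :: "int \<Rightarrow> nat \<Rightarrow> (nat \<Rightarrow> int) \<Rightarrow> (nat \<Rightarrow> int) \<Rightarrow> (nat \<Rightarrow> int) \<Rightarrow> bool" where
  "rec_mod m k a V x \<longleftrightarrow> (\<forall>n\<ge>1. [x (n + k) = (\<Sum>j<k. a j * x (n + j)) + V n] (mod m))"

lemma rec_modD: "rec_mod m k a V x \<Longrightarrow> n \<ge> 1 \<Longrightarrow> [x (n + k) = (\<Sum>j<k. a j * x (n + j)) + V n] (mod m)"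
  by (simp add: rec_mod_def)

lemma rec_mod_shift:
  assumes "rec_mod m k a V x" "\<And>n. n \<ge> 1 \<Longrightarrow> [V (n + s) = V n] (mod m)"
  shows "rec_mod m k a V (\<lambda>n. x (n + s))"
  unfolding rec_mod_def
proof (intro allI impI)
  fix n :: nat assume n: "n \<ge> 1"
  have "[x (n + s + k) = (\<Sum>j<k. a j * x (n + s + j)) + V (n + s)] (mod m)"
    using rec_modD[OF assms(1), of "n + s"] n by simp
  moreover have "[(\<Sum>j<k. a j * x (n + s + j)) + V (n + s) = (\<Sum>j<k. a j * x (n + s + j)) + V n] (mod m)"
    by (intro cong_add cong_refl assms(2) n)
  ultimately show "[x (n + k + s) = (\<Sum>j<k. a j * x (n + j + s)) + V n] (mod m)"
    by (simp add: add_ac cong_trans)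
qed

lemma rec_mod_mult:
  assumes "rec_mod m k a (\<lambda>_. 0) x"
  shows "rec_mod m k a (\<lambda>_. 0) (\<lambda>n. c * x n)"
  unfolding rec_mod_def
proof (intro allI impI)
  fix n :: nat assume n: "n \<ge> 1"
  have "[c * x (n + k) = c * ((\<Sum>j<k. a j * x (n + j)) + 0)] (mod m)"
    by (intro cong_mult cong_refl rec_modD[OF assms n])
  then show "[c * x (n + k) = (\<Sum>j<k. a j * (c * x (n + j))) + 0] (mod m)"
    by (simp add: sum_distrib_left mult_ac)
qed

lemma rec_mod_agree_forward:
  assumes x: "rec_mod m k a V x" and y: "rec_mod m k a V y"
    and N: "N \<ge> 1" and win: "\<And>j. j < k \<Longrightarrow> [x (N + j) = y (N + j)] (mod m)"
    and n: "n \<ge> N"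
  shows "[x n = y n] (mod m)"
  using n
proof (induction n rule: less_induct)
  case (less n)
  show ?case
  proof (cases "n < N + k")
    case True
    then show ?thesis using win[of "n - N"] less.prems by simp
  next
    case False
    define i where "i = n - k"
    have i: "i \<ge> 1" "i \<ge> N" "n = i + k" using False N by (auto simp: i_def)
    have "[x n = (\<Sum>j<k. a j * x (i + j)) + V i] (mod m)" using rec_modD[OF x i(1)] i(3) by simp
    also have "[(\<Sum>j<k. a j * x (i + j)) + V i = (\<Sum>j<k. a j * y (i + j)) + V i] (mod m)"
      using i by (intro cong_add cong_sum cong_mult cong_refl less.IH) auto
    also have "[(\<Sum>j<k. a j * y (i + j)) + V i = y n] (mod m)"
      using rec_modD[OF y i(1)] i(3) by (simp add: cong_sym)
    finally show ?thesis .
  qed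
qed

text \<open>If a 0 is a unit, the recurrence can be solved for its oldest term, so agreement on one
  window spreads backwards to index 1 as well as forwards.\<close>

lemma rec_mod_agree:
  assumes x: "rec_mod m k a V x" and y: "rec_mod m k a V y"
    and a0: "k > 0 \<Longrightarrow> coprime (a 0) m"
    and N: "N \<ge> 1" and win: "\<And>j. j < k \<Longrightarrow> [x (N + j) = y (N + j)] (mod m)"
    and n: "n \<ge> 1"
  shows "[x n = y n] (mod m)"
proof -
  have fwd: "[x n = y n] (mod m)" if "n \<ge> N" for n
    using rec_mod_agree_forward[OF x y N win that] .
  have bwd: "\<forall>n. n \<ge> 1 \<and> n + t \<ge> N \<longrightarrow> [x n = y n] (mod m)" for t
  proof (induction t)
    case 0
    then show ?case using fwd by simp
  next
    case (Suc t)
    show ?case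
    proof (intro allI impI)
      fix n assume n: "n \<ge> 1 \<and> n + Suc t \<ge> N"
      have later: "[x i = y i] (mod m)" if "i > n" for i using Suc that n by auto
      show "[x n = y n] (mod m)"
      proof (cases k)
        case 0
        then show ?thesis using rec_modD[OF x, of n] rec_modD[OF y, of n] n
          by (auto intro: cong_trans cong_sym)
      next
        case (Suc l)
        have split: "(\<Sum>j<k. a j * z (n + j)) = a 0 * z n + (\<Sum>j<l. a (Suc j) * z (n + Suc j))" for z
          unfolding Suc by (subst sum.lessThan_Suc_shift) simp
        have "[a 0 * z n = z (n + k) - ((\<Sum>j<l. a (Suc j) * z (n + Suc j)) + V n)] (mod m)"
          if z: "rec_mod m k a V z" for z
        proof -
          have "[z (n + k) - ((\<Sum>j<l. a (Suc j) * z (n + Suc j)) + V n) =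
             (a 0 * z n + (\<Sum>j<l. a (Suc j) * z (n + Suc j))) + V n - ((\<Sum>j<l. a (Suc j) * z (n + Suc j)) + V n)] (mod m)"
            using rec_modD[OF z, of n] n unfolding split by (intro cong_diff cong_refl) auto
          then show ?thesis by (simp add: cong_sym)
        qed note iso = this
        have "[a 0 * x n = x (n + k) - ((\<Sum>j<l. a (Suc j) * x (n + Suc j)) + V n)] (mod m)" by (rule iso[OF x])
        also have "[x (n + k) - ((\<Sum>j<l. a (Suc j) * x (n + Suc j)) + V n) =
             y (n + k) - ((\<Sum>j<l. a (Suc j) * y (n + Suc j)) + V n)] (mod m)"
          using Suc by (intro cong_diff cong_add cong_sum cong_mult cong_refl later) auto
        also have "[y (n + k) - ((\<Sum>j<l. a (Suc j) * y (n + Suc j)) + V n) = a 0 * y n] (mod m)"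
          by (rule cong_sym[OF iso[OF y]])
        finally show ?thesis using a0 Suc by (simp add: cong_mult_lcancel)
      qed
    qed
  qed
  show ?thesis using bwd[of N] n by auto
qed

text \<open>Pigeonhole for the m ^ k + 1 windows at 1, 1 + P, 1 + 2 P, and so on. The step P is
  meant for forcing terms of period P. The bound is for i + t rather than t, so that the start of an
  eventual period is controlled as well.\<close>

lemma rec_mod_window_collision:
  fixes m :: nat
  assumes m: "m \<ge> 1"
  obtains i t where "t \<ge> 1" "i + t \<le> m ^ k"
    "\<And>j. j < k \<Longrightarrow> [x (1 + P * (i + t) + j) = x (1 + P * i + j)] (mod int m)"
proof -
  define s where "s = (\<lambda>i. \<lambda>j\<in>{..<k}. x (1 + P * i + j) mod int m)"
  have "s ` {..m ^ k} \<subseteq> PiE {..<k} (\<lambda>_. {0..<int m})"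
    using m by (auto simp: s_def PiE_iff extensional_def split: if_splits)
  then have "card (s ` {..m ^ k}) \<le> card (PiE {..<k} (\<lambda>_. {0..<int m}))"
    by (intro card_mono finite_PiE) auto
  also have "\<dots> = m ^ k" by (simp add: card_PiE)
  also have "\<dots> < card {..m ^ k}" by simp
  finally have "\<not> inj_on s {..m ^ k}" by (rule pigeonhole)
  then obtain u v where uv: "u \<le> m ^ k" "v \<le> m ^ k" "u \<noteq> v" "s u = s v" by (auto simp: inj_on_def)
  have eq: "[x (1 + P * u + j) = x (1 + P * v + j)] (mod int m)" if "j < k" for j
    using fun_cong[OF uv(4), of j] that by (simp add: s_def cong_def)
  show ?thesis
  proof (cases "u < v")
    case True
    then show ?thesis using that[of "v - u" u] uv eq by (auto simp: cong_sym)
  next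
    case False
    then show ?thesis using that[of "u - v" v] uv eq by auto
  qed
qed

text \<open>Serves moduli that may share a factor with a 0, at the price of a late start; it is
  applied to the small primes in \<open>ilrs_short_common_period\<close>.\<close>

lemma rec_mod_eventual_period:
  fixes m :: nat
  assumes m: "m \<ge> 1" and x: "rec_mod (int m) k a (\<lambda>_. b) x"
  obtains t where "t \<ge> 1" "t \<le> m ^ k" "\<And>n. n \<ge> 1 + m ^ k \<Longrightarrow> [x (n + t) = x n] (mod int m)"
proof -
  obtain i t where t: "t \<ge> 1" "i + t \<le> m ^ k"
    and win: "\<And>j. j < k \<Longrightarrow> [x (1 + 1 * (i + t) + j) = x (1 + 1 * i + j)] (mod int m)"
    using rec_mod_window_collision[OF m, where P = 1] by blast
  have "[x (n + t) = x n] (mod int m)" if "n \<ge> 1 + m ^ k" for n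
    by (rule rec_mod_agree_forward[OF rec_mod_shift[OF x] x, where N = "1 + i"])
       (use win t that in \<open>auto simp: add_ac\<close>)
  then show ?thesis using that[of t] t by auto
qed

lemma rec_mod_period:
  fixes m :: nat
  assumes m: "m \<ge> 1" and x: "rec_mod (int m) k a V x" and a0: "k > 0 \<Longrightarrow> coprime (a 0) (int m)"
    and V: "\<And>n. n \<ge> 1 \<Longrightarrow> [V (n + P) = V n] (mod int m)"
  obtains t where "t \<ge> 1" "t \<le> m ^ k" "\<And>n. n \<ge> 1 \<Longrightarrow> [x (n + P * t) = x n] (mod int m)"
proof -
  obtain i t where t: "t \<ge> 1" "i + t \<le> m ^ k"
    and win: "\<And>j. j < k \<Longrightarrow> [x (1 + P * (i + t) + j) = x (1 + P * i + j)] (mod int m)"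
    using rec_mod_window_collision[OF m] by blast
  have Vt: "[V (n + P * t) = V n] (mod int m)" if "n \<ge> 1" for n t
  proof (induction t)
    case (Suc t)
    have "[V (n + P * t + P) = V (n + P * t)] (mod int m)" using that by (intro V) auto
    then show ?case using Suc by (auto intro: cong_trans simp: add_ac)
  qed simp
  have "[x (n + P * t) = x n] (mod int m)" if "n \<ge> 1" for n
    by (rule rec_mod_agree[OF rec_mod_shift[OF x Vt] x a0, where N = "1 + P * i"])
       (use win t that in \<open>auto simp: algebra_simps\<close>)
  then show ?thesis using that[of t] t by auto
qed

lemma cong_period_mult:
  assumes "\<And>n. n \<ge> N \<Longrightarrow> [x (n + T) = x n] (mod m)" "n \<ge> (N::nat)"
  shows "[x (n + T * i) = (x n :: int)] (mod m)"
proof (induction i)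
  case (Suc i)
  have "[x (n + T * i + T) = x (n + T * i)] (mod m)" using assms by auto
  then show ?case using Suc by (auto intro: cong_trans simp: add_ac)
qed simp

text \<open>A projective pigeonhole: each window is counted together with its p - 1 nonzero
  multiples, so slightly more than p ^ k / (p - 1) windows already contain two proportional ones.
  The relation between x n and x (n + r), iterated p - 1 times, loses its scalars by Fermat. A
  window of zeros, whose multiples do not differ, is treated first; it makes the whole sequence
  vanish.\<close>

lemma homogeneous_rec_period:
  fixes p :: nat
  assumes p: "prime p" and x: "rec_mod (int p) k a (\<lambda>_. 0) x" and k: "k > 0" and a0: "coprime (a 0) (int p)"
  obtains r where "r \<ge> 1" "r * (p - 1) \<le> p ^ k" "\<And>n. n \<ge> 1 \<Longrightarrow> [x (n + r * (p - 1)) = x n] (mod int p)"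
proof (cases "\<exists>i. \<forall>j<k. [x (1 + i + j) = 0] (mod int p)")
  case True
  then obtain i where i: "\<And>j. j < k \<Longrightarrow> [x (1 + i + j) = 0] (mod int p)" by blast
  have z: "rec_mod (int p) k a (\<lambda>_. 0) (\<lambda>_. 0)" by (simp add: rec_mod_def)
  have "[x n = 0] (mod int p)" if "n \<ge> 1" for n
    by (rule rec_mod_agree[OF x z a0, where N = "1 + i"]) (use i that in auto)
  then have "[x (n + 1 * (p - 1)) = x n] (mod int p)" if "n \<ge> 1" for n
    using that by (meson cong_sym cong_trans le_add1 order_trans)
  moreover have "1 * (p - 1) \<le> p ^ k"
    using self_le_power[of p k] k prime_gt_0_nat[OF p] by linarith
  ultimately show ?thesis using that[of 1] by blast
next
  case False
  note period_intro = that
  \<comment> \<open>The largest N with N (p - 1) <= p ^ k: its N + 1 starting points give more than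
    p ^ k pairs, while r <= N gives the claimed bound.\<close>
  define N where "N = p ^ k div (p - 1)"
  have p2: "p \<ge> 2" using p by (rule prime_ge_2_nat)
  define D where "D = {0..N} \<times> {1..<p}"
  define s where "s = (\<lambda>(i, c). \<lambda>j\<in>{..<k}. (int c * x (1 + i + j)) mod int p)"
  have "s ` D \<subseteq> PiE {..<k} (\<lambda>_. {0..<int p})"
    using p2 by (auto simp: s_def PiE_iff extensional_def split: if_splits)
  then have "card (s ` D) \<le> card (PiE {..<k} (\<lambda>_. {0..<int p}))"
    by (intro card_mono finite_PiE) auto
  also have "\<dots> = p ^ k" by (simp add: card_PiE)
  also have "\<dots> < (N + 1) * (p - 1)"
    using p2 dividend_less_div_times[of "p - 1" "p ^ k"] by (simp add: N_def algebra_simps)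
  also have "\<dots> = card D" by (simp add: D_def)
  finally have "\<not> inj_on s D" by (rule pigeonhole)
  then obtain u c v e where uv: "u \<le> N" "v \<le> N" "c \<in> {1..<p}" "e \<in> {1..<p}" "(u, c) \<noteq> (v, e)" "s (u, c) = s (v, e)"
    by (fastforce simp: inj_on_def D_def)
  have eq: "[int c * x (1 + u + j) = int e * x (1 + v + j)] (mod int p)" if "j < k" for j
    using fun_cong[OF uv(6), of j] that by (simp add: s_def cong_def)
  \<comment> \<open>With equal starting points the unit c - e would annihilate a window, which would
    then consist of zeros.\<close>
  have "u \<noteq> v"
  proof
    assume "u = v"
    then have "c \<noteq> e" using uv by auto
    have "\<not> int p dvd (int c - int e)"
    proof
      assume "int p dvd (int c - int e)"
      then have "[int c = int e] (mod int p)" by (simp add: cong_iff_dvd_diff)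
      then have "[c = e] (mod p)" by (simp add: cong_int_iff)
      then show False using uv \<open>c \<noteq> e\<close> by (simp add: cong_def)
    qed
    moreover have "int p dvd (int c - int e) * x (1 + u + j)" if "j < k" for j
      using eq[OF that] \<open>u = v\<close> by (simp add: cong_iff_dvd_diff left_diff_distrib)
    ultimately have "int p dvd x (1 + u + j)" if "j < k" for j
      using that p by (meson prime_dvd_mult_iff prime_nat_int_transfer)
    then show False using False by (auto simp: cong_0_iff)
  qed
  have key: thesis if uv: "u < v" "v \<le> N" "c \<in> {1..<p}" "e \<in> {1..<p}"
    and eq: "\<And>j. j < k \<Longrightarrow> [int c * x (1 + u + j) = int e * x (1 + v + j)] (mod int p)" for u v c e
  proof -
    define r where "r = v - u"
    have r: "r \<ge> 1" "v = u + r" using uv by (auto simp: r_def)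
    have "r \<le> N" using uv by (simp add: r_def)
    then have "r * (p - 1) \<le> N * (p - 1)" by (rule mult_le_mono1)
    also have "\<dots> \<le> p ^ k" unfolding N_def by (rule div_times_less_eq_dividend)
    finally have rp: "r * (p - 1) \<le> p ^ k" .
    have sh: "[int c * x n = int e * x (n + r)] (mod int p)" if "n \<ge> 1" for n
      by (rule rec_mod_agree[OF rec_mod_mult[OF x] rec_mod_mult[OF rec_mod_shift[OF x]] a0, where N = "1 + u"])
         (use eq r that in \<open>auto simp: add_ac\<close>)
    have iter: "[int c ^ i * x n = int e ^ i * x (n + r * i)] (mod int p)" if "n \<ge> 1" for n i
    proof (induction i)
      case (Suc i)
      have "[int c ^ Suc i * x n = int c * (int c ^ i * x n)] (mod int p)"
        by (simp only: power_Suc mult.assoc cong_refl)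
      also have "[int c * (int c ^ i * x n) = int c * (int e ^ i * x (n + r * i))] (mod int p)"
        by (intro cong_mult cong_refl Suc)
      also have "int c * (int e ^ i * x (n + r * i)) = int e ^ i * (int c * x (n + r * i))" by simp
      also have "[int e ^ i * (int c * x (n + r * i)) = int e ^ i * (int e * x (n + r * i + r))] (mod int p)"
        using that by (intro cong_mult cong_refl sh) auto
      also have "int e ^ i * (int e * x (n + r * i + r)) = int e ^ Suc i * x (n + r * Suc i)" by (simp add: add_ac)
      finally show ?case .
    qed simp
    have f: "[int z ^ (p - 1) = 1] (mod int p)" if "z \<in> {1..<p}" for z
    proof -
      have "\<not> p dvd z" using that by (auto dest: dvd_imp_le)
      from fermat_theorem[OF p this] have "[int (z ^ (p - 1)) = int 1] (mod int p)" by (simp only: cong_int_iff)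
      then show ?thesis by simp
    qed
    have "[x (n + r * (p - 1)) = x n] (mod int p)" if n: "n \<ge> 1" for n
    proof -
      have "[1 * x (n + r * (p - 1)) = int e ^ (p - 1) * x (n + r * (p - 1))] (mod int p)"
        by (intro cong_mult cong_refl cong_sym[OF f] uv)
      also have "[int e ^ (p - 1) * x (n + r * (p - 1)) = int c ^ (p - 1) * x n] (mod int p)"
        by (rule cong_sym[OF iter[OF n]])
      also have "[int c ^ (p - 1) * x n = 1 * x n] (mod int p)"
        by (intro cong_mult cong_refl f uv)
      finally show ?thesis by simp
    qed
    then show thesis by (rule period_intro[OF r(1) rp])
  qed
  show ?thesis
  proof (cases "u < v")
    case True
    then show ?thesis using key[of u v c e, OF _ uv(2-4) eq] by simp
  next
    case False
    then have "v < u" using \<open>u \<noteq> v\<close> by simp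
    then show ?thesis using key[of v u e c, OF _ uv(1,4,3) cong_sym[OF eq]] by simp
  qed
qed

section \<open>Splitting off the characteristic root 1\<close>

lemma sum_partial_sums_shift:
  fixes a y :: "nat \<Rightarrow> int"
  shows "(\<Sum>j<k. (\<Sum>i\<le>j. a i) * y (Suc j)) + (\<Sum>i\<le>k. a i * y i) = (\<Sum>j\<le>k. (\<Sum>i\<le>j. a i) * y j)"
  by (induction k) (auto simp: algebra_simps)

text \<open>If the coefficients sum to 1, the characteristic polynomial is X - 1 times the
  polynomial with coefficients A 0, ..., A k, where A k = 1. Applying the second factor to x gives
  U, so that U obeys a first-order recurrence; solved for x (n + k), its definition is a recurrence
  of order one less with forcing term U.\<close>

lemma rec_reduce_order:
  fixes a x V :: "nat \<Rightarrow> int"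
  assumes rec: "\<And>n. n \<ge> 1 \<Longrightarrow> x (n + Suc k) = (\<Sum>i<Suc k. a i * x (n + i)) + V n"
    and one: "(\<Sum>i<Suc k. a i) = 1"
  defines "A \<equiv> \<lambda>j. \<Sum>i\<le>j. a i"
  defines "U \<equiv> \<lambda>n. \<Sum>j\<le>k. A j * x (n + j)"
  shows "n \<ge> 1 \<Longrightarrow> U (Suc n) = U n + V n"
    and "x (n + k) = (\<Sum>j<k. - A j * x (n + j)) + U n"
proof -
  have Ak: "A k = 1" using one by (simp add: A_def lessThan_Suc_atMost)
  have Uk: "U n = (\<Sum>j<k. A j * x (n + j)) + x (n + k)" for n
    by (simp add: U_def Ak flip: lessThan_Suc_atMost)
  then show "x (n + k) = (\<Sum>j<k. - A j * x (n + j)) + U n"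
    by (simp add: sum_negf)
  assume n: "n \<ge> 1"
  have "U (Suc n) = (\<Sum>j<k. A j * x (n + Suc j)) + x (n + Suc k)" by (simp add: Uk)
  also have "x (n + Suc k) = (\<Sum>i\<le>k. a i * x (n + i)) + V n"
    using rec[OF n] by (simp add: lessThan_Suc_atMost)
  finally show "U (Suc n) = U n + V n"
    using sum_partial_sums_shift[of a "\<lambda>j. x (n + j)" k] by (simp add: U_def A_def)
qed

lemma coprime_int_prime_gt:
  fixes p :: nat and c :: int
  assumes "prime p" "c \<noteq> 0" "nat \<bar>c\<bar> < p"
  shows "coprime c (int p)"
proof -
  have "\<not> int p dvd c"
    using assms zdvd_imp_le[of "int p" "\<bar>c\<bar>"] by auto
  then show ?thesis using assms(1) by (metis coprime_commute prime_imp_coprime prime_nat_int_transfer)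
qed

text \<open>Subtracting the fixed point e / q makes the recurrence homogeneous, and H is this
  difference with the denominator cleared. The form of \<open>hom\<close> covers both the fixed
  point b / (1 - sum of the coefficients) and the case b = 0 with q = 1 and e = 0.\<close>

lemma short_period_case_affine:
  fixes S :: "nat \<Rightarrow> int"
  assumes rec: "ilrs_recurrence d a b S" and d: "d \<ge> 1" and a0: "a 0 \<noteq> 0"
    and q: "q \<noteq> 0" and hom: "q * b = e * (1 - (\<Sum>i<d. a i))"
    and p: "prime p" and pB: "nat \<bar>q\<bar> + nat \<bar>a 0\<bar> < p"
  obtains t where "t \<ge> 1" "t * (p - 1) \<le> p ^ d" "\<And>n. n \<ge> 1 \<Longrightarrow> [S (n + t * (p - 1)) = S n] (mod int p)"
proof -
  define H where "H = (\<lambda>n. q * S n - e)"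
  have "H (n + d) = (\<Sum>j<d. a j * H (n + j))" if n: "n \<ge> 1" for n
  proof -
    have Sn: "S (n + d) = (\<Sum>i<d. a i * S (n + i)) + b" using rec n unfolding ilrs_recurrence_def by blast
    have "H (n + d) = q * (\<Sum>i<d. a i * S (n + i)) + q * b - e"
      unfolding H_def Sn by (simp only: distrib_left)
    also have "\<dots> = q * (\<Sum>i<d. a i * S (n + i)) - e * (\<Sum>i<d. a i)"
      unfolding hom by (simp add: algebra_simps)
    also have "\<dots> = (\<Sum>j<d. a j * H (n + j))"
      unfolding H_def by (simp add: sum_distrib_left sum_subtractf algebra_simps)
    finally show ?thesis .
  qed
  then have H: "rec_mod (int p) d a (\<lambda>_. 0) H" by (simp add: rec_mod_def)
  have cop: "coprime (a 0) (int p)" using pB by (intro coprime_int_prime_gt p a0) auto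
  have d0: "d > 0" using d by simp
  obtain t where t: "t \<ge> 1" "t * (p - 1) \<le> p ^ d"
    and per: "\<And>n. n \<ge> 1 \<Longrightarrow> [H (n + t * (p - 1)) = H n] (mod int p)"
    using homogeneous_rec_period[OF p H d0 cop] by blast
  have cq: "coprime q (int p)" using pB by (intro coprime_int_prime_gt p q) auto
  have "[S (n + t * (p - 1)) = S n] (mod int p)" if "n \<ge> 1" for n
  proof -
    have "[H (n + t * (p - 1)) + e = H n + e] (mod int p)" by (intro cong_add cong_refl per that)
    then show ?thesis using cq by (simp add: H_def cong_mult_lcancel)
  qed
  with t that show ?thesis by blast
qed

text \<open>The situation after a simple characteristic root 1 has been split off: the forcing term
  is linear in n and 1 is not a root again. A linear particular solution exists; it has period p,
  which costs one factor p, and the homogeneous rest has order k.\<close>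

lemma short_period_case_linear:
  fixes S :: "nat \<Rightarrow> int"
  assumes rec: "\<And>n. n \<ge> 1 \<Longrightarrow> S (n + k) = (\<Sum>j<k. a j * S (n + j)) + (b * int n + c)"
    and k: "k \<ge> 1" and a0: "a 0 \<noteq> 0" and q: "1 - (\<Sum>i<k. a i) \<noteq> 0"
    and p: "prime p" and pB: "nat \<bar>1 - (\<Sum>i<k. a i)\<bar> + nat \<bar>a 0\<bar> < p"
  obtains t where "t \<ge> 1" "t * (p - 1) \<le> p ^ Suc k" "\<And>n. n \<ge> 1 \<Longrightarrow> [S (n + t * (p - 1)) = S n] (mod int p)"
proof -
  define q where "q = 1 - (\<Sum>i<k. a i)"
  \<comment> \<open>The value for which (q b n + e) / q^2 solves the recurrence.\<close>
  define e where "e = q * c - b * int k + b * (\<Sum>j<k. a j * int j)"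
  define H where "H = (\<lambda>n. q\<^sup>2 * S n - q * b * int n - e)"
  have "H (n + k) = (\<Sum>j<k. a j * H (n + j))" if n: "n \<ge> 1" for n
  proof -
    have sa: "(\<Sum>i<k. a i) = 1 - q" by (simp add: q_def)
    have "(\<Sum>j<k. a j * H (n + j)) =
       q\<^sup>2 * (\<Sum>j<k. a j * S (n + j)) - q * b * int n * (\<Sum>j<k. a j) - q * b * (\<Sum>j<k. a j * int j) - e * (\<Sum>j<k. a j)"
      unfolding H_def by (simp add: sum_distrib_left sum_subtractf sum.distrib algebra_simps)
    also have "\<dots> = q\<^sup>2 * ((\<Sum>j<k. a j * S (n + j)) + (b * int n + c)) - q * b * int (n + k) - e"
      unfolding sa unfolding e_def by (simp add: algebra_simps power2_eq_square)
    also have "\<dots> = H (n + k)" using rec[OF n] by (simp add: H_def)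
    finally show ?thesis by simp
  qed
  then have H: "rec_mod (int p) k a (\<lambda>_. 0) H" by (simp add: rec_mod_def)
  have cop: "coprime (a 0) (int p)" using pB by (intro coprime_int_prime_gt p a0) auto
  have k0: "k > 0" using k by simp
  obtain r where r: "r \<ge> 1" "r * (p - 1) \<le> p ^ k"
    and per: "\<And>n. n \<ge> 1 \<Longrightarrow> [H (n + r * (p - 1)) = H n] (mod int p)"
    using homogeneous_rec_period[OF p H k0 cop] by blast
  define t where "t = p * r"
  have "t \<ge> 1" using r prime_gt_0_nat[OF p] by (simp add: t_def Suc_le_eq)
  moreover have "t * (p - 1) \<le> p ^ Suc k"
    using mult_le_mono2[OF r(2), of p] by (simp add: t_def mult_ac)
  moreover have "[S (n + t * (p - 1)) = S n] (mod int p)" if n: "n \<ge> 1" for n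
  proof -
    have "coprime q (int p)" using pB assms(4) by (intro coprime_int_prime_gt p) (auto simp: q_def)
    then have cq: "coprime (q\<^sup>2) (int p)" by simp
    have "[H (n + r * (p - 1) * p) = H n] (mod int p)"
      by (rule cong_period_mult[where x = H and T = "r * (p - 1)", OF per n])
    then have Hp: "[H (n + t * (p - 1)) = H n] (mod int p)" by (simp add: t_def mult_ac)
    have "int p dvd int (n + t * (p - 1)) - int n" by (simp add: t_def)
    then have np: "[int (n + t * (p - 1)) = int n] (mod int p)" by (simp only: cong_iff_dvd_diff)
    have "[H (n + t * (p - 1)) + q * b * int (n + t * (p - 1)) + e = H n + q * b * int n + e] (mod int p)"
      by (intro cong_add cong_mult cong_refl Hp np)
    then show ?thesis using cq by (simp add: H_def cong_mult_lcancel)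
  qed
  ultimately show ?thesis using that by blast
qed

text \<open>Here 1 is at least a double characteristic root of the original recurrence. A second
  reduction produces W, a quadratic polynomial in n, of period p for odd p, and leaves the order k.
  The factor p - 1 is merely appended to obtain the common shape; the two orders split off pay for p
  and for p - 1.\<close>

lemma short_period_case_quadratic:
  fixes S :: "nat \<Rightarrow> int"
  assumes rec: "\<And>n. n \<ge> 1 \<Longrightarrow> S (n + Suc k) = (\<Sum>j<Suc k. a j * S (n + j)) + (b * int n + c)"
    and a0: "a 0 \<noteq> 0" and q: "(\<Sum>i<Suc k. a i) = 1"
    and p: "prime p" and pB: "2 + nat \<bar>a 0\<bar> < p"
  obtains t where "t \<ge> 1" "t * (p - 1) \<le> p ^ (k + 2)" "\<And>n. n \<ge> 1 \<Longrightarrow> [S (n + t * (p - 1)) = S n] (mod int p)"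
proof -
  define A where "A = (\<lambda>j. \<Sum>i\<le>j. a i)"
  define W where "W = (\<lambda>n. \<Sum>j\<le>k. A j * S (n + j))"
  have W: "W (Suc n) = W n + (b * int n + c)" if "n \<ge> 1" for n
    using rec_reduce_order(1)[OF rec q that] unfolding W_def A_def by simp
  have S: "S (n + k) = (\<Sum>j<k. - A j * S (n + j)) + W n" for n
    using rec_reduce_order(2)[OF rec q, of n] unfolding W_def A_def by simp
  \<comment> \<open>Doubling avoids the halves in the quadratic polynomial; 2 is a unit modulo p >
    2.\<close>
  have Wm: "2 * W (n + m) = 2 * W n + int m * (2 * b * int n + b * (int m - 1) + 2 * c)" if "n \<ge> 1" for n m
    using that by (induction m) (auto simp: W algebra_simps)
  have Wp: "[W (n + p) = W n] (mod int p)" if "n \<ge> 1" for n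
  proof -
    have "[2 * W (n + p) = 2 * W n] (mod int p)"
      unfolding Wm[OF that] cong_iff_dvd_diff by simp
    moreover have "coprime 2 (int p)" using pB by (intro coprime_int_prime_gt p) auto
    ultimately show ?thesis by (simp add: cong_mult_lcancel)
  qed
  have R: "rec_mod (int p) k (\<lambda>j. - A j) W S" unfolding rec_mod_def using S by simp
  have cop: "coprime (- A 0) (int p)" using pB a0 by (intro coprime_int_prime_gt p) (auto simp: A_def)
  have p1: "p \<ge> 1" using pB by simp
  obtain t where t: "t \<ge> 1" "t \<le> p ^ k" "\<And>n. n \<ge> 1 \<Longrightarrow> [S (n + p * t) = S n] (mod int p)"
    using rec_mod_period[OF p1 R cop Wp] by blast
  have "p * t \<ge> 1" using t pB by (simp add: Suc_le_eq)
  moreover have "p * t * (p - 1) \<le> p ^ (k + 2)"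
  proof -
    have "p * t * (p - 1) \<le> p * p ^ k * p" by (intro mult_le_mono t) auto
    then show ?thesis by (simp add: mult_ac)
  qed
  moreover have "[S (n + p * t * (p - 1)) = S n] (mod int p)" if "n \<ge> 1" for n
    by (rule cong_period_mult[where x = S and T = "p * t", OF t(3) that])
  ultimately show ?thesis using that by blast
qed

text \<open>The cases follow the multiplicity of the characteristic root 1: none (or b = 0), one, at
  least two. B removes the primes dividing a denominator or the oldest coefficient. For S (n + 1) =
  S n + b and p > 2 not dividing b, the least period is p, whereas p - 1 is the only multiple of p -
  1 allowed by the bound; hence \<open>nonlin\<close>.\<close>

lemma short_period:
  assumes rec: "ilrs_recurrence d a b S" and d: "d \<ge> 1" and a0: "a 0 \<noteq> 0"
    and nonlin: "\<not> (d = 1 \<and> a 0 = 1)"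
  obtains B :: nat where "\<And>p. prime p \<Longrightarrow> p > B \<Longrightarrow>
    \<exists>t\<ge>1. t * (p - 1) \<le> p ^ d \<and> (\<forall>n\<ge>1. [S (n + t * (p - 1)) = S n] (mod int p))"
proof (cases "(\<Sum>i<d. a i) \<noteq> 1 \<or> b = 0")
  case True
  define q where "q = (if b = 0 then 1 else 1 - (\<Sum>i<d. a i))"
  have q: "q \<noteq> 0" "q * b = b * (1 - (\<Sum>i<d. a i))" using True by (auto simp: q_def)
  show ?thesis
  proof (rule that[of "nat \<bar>q\<bar> + nat \<bar>a 0\<bar>"])
    fix p assume p: "prime p" "p > nat \<bar>q\<bar> + nat \<bar>a 0\<bar>"
    show "\<exists>t\<ge>1. t * (p - 1) \<le> p ^ d \<and> (\<forall>n\<ge>1. [S (n + t * (p - 1)) = S n] (mod int p))"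
      using short_period_case_affine[OF rec d a0 q p] by blast
  qed
next
  case False
  then have one: "(\<Sum>i<d. a i) = 1" by simp
  have "d \<noteq> 1" using nonlin one by auto
  define k where "k = d - 2"
  have k: "d = Suc (Suc k)" using d \<open>d \<noteq> 1\<close> by (simp add: k_def)
  define A where "A = (\<lambda>j. \<Sum>i\<le>j. a i)"
  define U where "U = (\<lambda>n. \<Sum>j\<le>Suc k. A j * S (n + j))"
  have rec': "S (n + Suc (Suc k)) = (\<Sum>i<Suc (Suc k). a i * S (n + i)) + b" if "n \<ge> 1" for n
    using rec that unfolding ilrs_recurrence_def k by blast
  have one': "(\<Sum>i<Suc (Suc k). a i) = 1" using one k by simp
  have U: "U (Suc n) = U n + b" if "n \<ge> 1" for n
    using rec_reduce_order(1)[OF rec' one' that] unfolding U_def A_def by simp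
  have S: "S (n + Suc k) = (\<Sum>j<Suc k. - A j * S (n + j)) + U n" for n
    using rec_reduce_order(2)[OF rec' one', of n] unfolding U_def A_def by simp
  have Un: "U n = b * int n + (U 1 - b)" if "n \<ge> 1" for n
    using that by (induction n rule: dec_induct) (auto simp: U algebra_simps)
  have recS: "S (n + Suc k) = (\<Sum>j<Suc k. - A j * S (n + j)) + (b * int n + (U 1 - b))" if "n \<ge> 1" for n
    using S Un[OF that] by simp
  have A0: "- A 0 \<noteq> 0" using a0 by (simp add: A_def)
  show ?thesis
  proof (cases "1 - (\<Sum>i<Suc k. - A i) = 0")
    case True
    then have sum1: "(\<Sum>i<Suc k. - A i) = 1" by simp
    show ?thesis
    proof (rule that[of "2 + nat \<bar>- A 0\<bar>"])
      fix p assume p: "prime p" "p > 2 + nat \<bar>- A 0\<bar>"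
      show "\<exists>t\<ge>1. t * (p - 1) \<le> p ^ d \<and> (\<forall>n\<ge>1. [S (n + t * (p - 1)) = S n] (mod int p))"
        using short_period_case_quadratic[OF recS A0 sum1 p] unfolding k add_2_eq_Suc' by blast
    qed
  next
    case False
    show ?thesis
    proof (rule that[of "nat \<bar>1 - (\<Sum>i<Suc k. - A i)\<bar> + nat \<bar>- A 0\<bar>"])
      fix p assume p: "prime p" "p > nat \<bar>1 - (\<Sum>i<Suc k. - A i)\<bar> + nat \<bar>- A 0\<bar>"
      show "\<exists>t\<ge>1. t * (p - 1) \<le> p ^ d \<and> (\<forall>n\<ge>1. [S (n + t * (p - 1)) = S n] (mod int p))"
        unfolding k by (rule short_period_case_linear[OF recS _ A0 False p]) auto
    qed
  qed
qed

section \<open>A common short period modulo many primes\<close>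

lemma chebyshev_psi_of_nat: "chebyshev_psi (real N) = (\<Sum>n\<le>N. mangoldt n)"
  by (simp add: chebyshev_psi_def atMost_def)

text \<open>Only a prime power can enlarge the least common multiple, and a power of p does so by at
  most the factor p. Any other \<open>Suc N\<close> is a product of two coprime smaller factors,
  which already divide it.\<close>

lemma ln_Lcm_le: "ln (real (Lcm {1..N})) \<le> (\<Sum>n\<le>N. mangoldt n)"
proof (induction N)
  case (Suc N)
  define A where "A = Lcm {1..N}"
  have A0: "A > 0" by (auto simp: A_def Lcm_0_iff intro!: Nat.gr0I)
  have dvdA: "k dvd A" if "k \<in> {1..N}" for k using that by (auto simp: A_def)
  have "Lcm {1..Suc N} = lcm (Suc N) A"
    by (simp add: A_def atLeastAtMostSuc_conv)
  moreover have "ln (real (lcm (Suc N) A)) \<le> ln (real A) + mangoldt (Suc N)"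
  proof (cases "N = 0")
    case True
    then show ?thesis by (simp add: A_def)
  next
    case False
    obtain p where p: "prime p" "p dvd Suc N" using prime_factor_nat[of "Suc N"] False by auto
    define k where "k = multiplicity p (Suc N)"
    obtain m where m: "Suc N = p ^ k * m" "\<not> p dvd m"
      using multiplicity_decompose'[of "Suc N" p] p unfolding k_def
      by (metis Suc_neq_Zero not_prime_unit)
    have k: "k > 0" using p m by (cases k) auto
    have m0: "m > 0" using m by (auto intro!: Nat.gr0I)
    have p2: "p \<ge> 2" using p prime_ge_2_nat by blast
    show ?thesis
    proof (cases "m = 1")
      case True
      have "p ^ (k - 1) < p ^ k" using p2 k by simp
      also have "p ^ k = Suc N" using True m by simp
      finally have "p ^ (k - 1) \<in> {1..N}" using p2 by (simp add: less_Suc_eq_le Suc_le_eq)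
      then have "p ^ (k - 1) * p dvd A * p" by (intro mult_dvd_mono dvdA) auto
      also have "p ^ (k - 1) * p = Suc N" using True m k by (simp flip: power_Suc2)
      finally have "lcm (Suc N) A dvd A * p" by (intro lcm_least) auto
      then have "lcm (Suc N) A \<le> A * p" using A0 p2 by (intro dvd_imp_le) auto
      moreover have "lcm (Suc N) A > 0" using A0 by (simp add: lcm_pos_nat)
      ultimately have "ln (real (lcm (Suc N) A)) \<le> ln (real (A * p))"
        using A0 p2 by (subst ln_le_cancel_iff) (auto simp del: of_nat_mult)
      also have "\<dots> = ln (real A) + ln (real p)" using A0 p2 by (simp add: ln_mult)
      also have "ln (real p) = mangoldt (Suc N)"
        using True m k p by (simp add: mangoldt_primepow)
      finally show ?thesis .
    next
      case False
      have "p ^ k \<ge> 2" using p2 k by (metis le_trans self_le_power one_le_numeral order_trans)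
      then have "m < p ^ k * m" "p ^ k < p ^ k * m" using m0 False p2 by auto
      then have "m < Suc N" "p ^ k < Suc N" by (simp_all only: m(1))
      then have "p ^ k \<in> {1..N}" "m \<in> {1..N}" using m0 p2 by (simp_all add: less_Suc_eq_le Suc_le_eq)
      moreover have "coprime (p ^ k) m" using m p by (simp add: prime_imp_coprime)
      ultimately have "Suc N dvd A" unfolding m(1) by (intro divides_mult dvdA)
      then show ?thesis by (simp add: lcm_proj2_if_dvd_nat mangoldt_nonneg)
    qed
  qed
  ultimately show ?case using Suc.IH by (simp add: A_def)
qed simp

lemma sum_ln_primes_le_psi: "(\<Sum>p | prime p \<and> p \<le> y. ln (real p)) \<le> chebyshev_psi (real y)"
proof -
  have "(\<Sum>p | prime p \<and> p \<le> y. ln (real p)) = (\<Sum>p | prime p \<and> p \<le> y. mangoldt p)"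
    by (intro sum.cong) auto
  also have "\<dots> \<le> chebyshev_psi (real y)" unfolding chebyshev_psi_of_nat
    by (intro sum_mono2) (auto simp: mangoldt_nonneg)
  finally show ?thesis .
qed

text \<open>The sum is dominated by the telescoping sum over all integers from 2 to y. It pays for
  the difference between p ^ d / (p - 1) and p ^ (d - 1).\<close>

lemma sum_ln_prime_ratio_le:
  assumes "y \<ge> 1"
  shows "(\<Sum>p | prime p \<and> p \<le> y. ln (real p) - ln (real (p - 1))) \<le> ln (real y)"
proof -
  have "(\<Sum>p | prime p \<and> p \<le> y. ln (real p) - ln (real (p - 1))) \<le> (\<Sum>k\<in>{Suc 1..y}. ln (real k) - ln (real (k - 1)))"
    by (intro sum_mono2) (auto dest: prime_ge_2_nat)
  also have "\<dots> = ln (real y) - ln (real 1)"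
    using assms by (rule sum_telescope'')
  finally show ?thesis by simp
qed

text \<open>The threshold \<open>n1\<close> is chosen before y. Primes above a fixed bound B have
  periods from index 1 on; those up to B contribute only the constant K to the period and a starting
  index that depends on B and d alone.\<close>

lemma ilrs_short_common_period:
  assumes rec: "ilrs_recurrence d a b S" and d: "d \<ge> 1" and a0: "a 0 \<noteq> 0"
    and nonlin: "\<not> (d = 1 \<and> a 0 = 1)"
  obtains n1 where "\<forall>\<^sub>F y in sequentially. \<exists>T\<ge>1. ln (real T) \<le> (real d - 1 / 4) * real y \<and>
     (\<forall>n\<ge>n1. \<forall>p. prime p \<and> p \<le> y \<longrightarrow> [S (n + T) = S n] (mod int p))"
proof -
  obtain B0 where B0: "\<And>p. prime p \<Longrightarrow> p > B0 \<Longrightarrow>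
    \<exists>t\<ge>1. t * (p - 1) \<le> p ^ d \<and> (\<forall>n\<ge>1. [S (n + t * (p - 1)) = S n] (mod int p))"
    using short_period[OF assms] by blast
  \<comment> \<open>At least 2, so that every prime above B is odd and (p - 1) / 2 occurs in the
    least common multiple.\<close>
  define B where "B = max B0 2"
  have "\<forall>p. \<exists>t. prime p \<and> p > B \<longrightarrow>
    t \<ge> 1 \<and> t * (p - 1) \<le> p ^ d \<and> (\<forall>n\<ge>1. [S (n + t * (p - 1)) = S n] (mod int p))"
    using B0 unfolding B_def by (meson max.strict_boundedE)
  then obtain t where "\<forall>p. prime p \<and> p > B \<longrightarrow>
    t p \<ge> 1 \<and> t p * (p - 1) \<le> p ^ d \<and> (\<forall>n\<ge>1. [S (n + t p * (p - 1)) = S n] (mod int p))"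
    unfolding choice_iff by blast
  then have t: "\<And>p. prime p \<Longrightarrow> p > B \<Longrightarrow> t p \<ge> 1" "\<And>p. prime p \<Longrightarrow> p > B \<Longrightarrow> t p * (p - 1) \<le> p ^ d"
    "\<And>p n. prime p \<Longrightarrow> p > B \<Longrightarrow> n \<ge> 1 \<Longrightarrow> [S (n + t p * (p - 1)) = S n] (mod int p)" by auto
  have recm: "rec_mod (int p) d a (\<lambda>_. b) S" for p
    using rec by (simp add: rec_mod_def ilrs_recurrence_def)
  have "\<forall>p. \<exists>u. prime p \<longrightarrow> u \<ge> 1 \<and> (\<forall>n\<ge>1 + p ^ d. [S (n + u) = S n] (mod int p))"
  proof
    fix p :: nat
    show "\<exists>u. prime p \<longrightarrow> u \<ge> 1 \<and> (\<forall>n\<ge>1 + p ^ d. [S (n + u) = S n] (mod int p))"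
    proof (cases "prime p")
      case True
      then have "p \<ge> 1" using prime_ge_1_nat by blast
      then show ?thesis using rec_mod_eventual_period[OF _ recm] by blast
    qed auto
  qed
  then obtain u where "\<forall>p. prime p \<longrightarrow> u p \<ge> 1 \<and> (\<forall>n\<ge>1 + p ^ d. [S (n + u p) = S n] (mod int p))"
    unfolding choice_iff by blast
  then have u: "\<And>p. prime p \<Longrightarrow> u p \<ge> 1" "\<And>p n. prime p \<Longrightarrow> n \<ge> 1 + p ^ d \<Longrightarrow> [S (n + u p) = S n] (mod int p)" by auto
  define K where "K = (\<Prod>p | prime p \<and> p \<le> B. u p)"
  have K1: "K \<ge> 1" unfolding K_def using u(1) by (intro prod_ge_1) auto
  define T where "T = (\<lambda>y. K * ((\<Prod>p | prime p \<and> B < p \<and> p \<le> y. t p) * (2 * Lcm {1..y div 2})))"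
  \<comment> \<open>The main term of ln T is (1 + \<epsilon>) (d - 1/2) y: d - 1 from the product of
    the \<open>t p\<close> and 1/2 from the least common multiple. This \<epsilon> keeps it below (d
    - 3/8) y, and another y / 8 is reserved for logarithmic and constant terms.\<close>
  define \<epsilon> where "\<epsilon> = 1 / (8 * real d)"
  have \<epsilon>: "\<epsilon> > 0" using d by (simp add: \<epsilon>_def)
  obtain C0 where C0: "\<And>x. x \<ge> 0 \<Longrightarrow> chebyshev_psi x \<le> (1 + \<epsilon>) * x + C0"
    using chebyshev_psi_upper_bound[OF \<epsilon>] by blast
  have C00: "C0 \<ge> 0" using C0[of 0] chebyshev_psi_nonneg[of 0] by simp
  have T1: "T y \<ge> 1" for y
  proof -
    have "(\<Prod>p | prime p \<and> B < p \<and> p \<le> y. t p) \<ge> 1" using t(1) by (intro prod_ge_1) auto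
    moreover have "Lcm {1..y div 2} > 0" by (auto simp: Lcm_0_iff intro!: Nat.gr0I)
    ultimately show ?thesis using K1 unfolding T_def by (simp add: Suc_le_eq)
  qed
  have per: "[S (n + T y) = S n] (mod int p)" if n: "n \<ge> 1 + B ^ d" and p: "prime p" "p \<le> y" for n p y
  proof (cases "p \<le> B")
    case True
    have "u p dvd K" unfolding K_def using p True by (intro dvd_prodI) auto
    then have "u p dvd T y" unfolding T_def by (rule dvd_mult2)
    then obtain i where i: "T y = u p * i" by (rule dvdE)
    have "p ^ d \<le> B ^ d" using True by (intro power_mono) auto
    then have "n \<ge> 1 + p ^ d" using n by linarith
    then show ?thesis unfolding i by (intro cong_period_mult[where x = S and T = "u p", OF u(2)[OF p(1)]])
  next
    case False
    then have pB: "p > B" by simp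
    have "odd p" using p pB primes_dvd_imp_eq[of 2 p] by (auto simp: B_def)
    then obtain h where h: "p = 2 * h + 1" by (rule oddE)
    have "h \<in> {1..y div 2}" using h p pB by (auto simp: B_def)
    then have "h dvd Lcm {1..y div 2}" by (rule dvd_Lcm)
    then have "2 * h dvd 2 * Lcm {1..y div 2}" by (intro mult_dvd_mono) auto
    then have p1: "p - 1 dvd 2 * Lcm {1..y div 2}" using h by simp
    have "t p dvd (\<Prod>p | prime p \<and> B < p \<and> p \<le> y. t p)" using p pB by (intro dvd_prodI) auto
    then have "t p * (p - 1) dvd T y" unfolding T_def by (rule dvd_mult[OF mult_dvd_mono[OF _ p1]])
    then obtain i where i: "T y = t p * (p - 1) * i" by (rule dvdE)
    show ?thesis unfolding i by (rule cong_period_mult[where x = S and T = "t p * (p - 1)", OF t(3)[OF p(1) pB]]) (use n in auto)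
  qed
  have lnT: "ln (real (T y)) \<le> (real d - 3 / 8) * real y + (ln (real y) + (ln (real K) + real d * C0 + ln 2))"
    if y: "y \<ge> 1" for y
  proof -
    define P where "P = (\<Prod>p | prime p \<and> B < p \<and> p \<le> y. t p)"
    have P1: "P \<ge> 1" unfolding P_def using t(1) by (intro prod_ge_1) auto
    have L1: "Lcm {1..y div 2} > 0" by (auto simp: Lcm_0_iff intro!: Nat.gr0I)
    have "ln (real (T y)) = ln (real K) + ln (real P) + ln 2 + ln (real (Lcm {1..y div 2}))"
      unfolding T_def P_def[symmetric] using K1 P1 L1 by (simp add: ln_mult del: Lcm_eq_0_I)
    moreover have "ln (real (Lcm {1..y div 2})) \<le> (1 + \<epsilon>) * (real y / 2) + C0"
    proof -
      have "ln (real (Lcm {1..y div 2})) \<le> chebyshev_psi (real (y div 2))"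
        unfolding chebyshev_psi_of_nat by (rule ln_Lcm_le)
      also have "\<dots> \<le> chebyshev_psi (real y / 2)" by (intro chebyshev_psi_mono) simp
      also have "\<dots> \<le> (1 + \<epsilon>) * (real y / 2) + C0" by (intro C0) simp
      finally show ?thesis .
    qed
    moreover have "ln (real P) \<le> (real d - 1) * ((1 + \<epsilon>) * real y + C0) + ln (real y)"
    proof -
      define Q where "Q = {p. prime p \<and> p \<le> y}"
      have finQ: "finite Q" by (rule finite_subset[of _ "{..y}"]) (auto simp: Q_def)
      have "ln (real P) = (\<Sum>p | prime p \<and> B < p \<and> p \<le> y. ln (real (t p)))"
      proof -
        have pos: "real (t p) \<noteq> 0" if "p \<in> {p. prime p \<and> B < p \<and> p \<le> y}" for p
          using t(1)[of p] that by simp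
        have "finite {p. prime p \<and> B < p \<and> p \<le> y}" by (rule finite_subset[OF _ finQ]) (auto simp: Q_def)
        then show ?thesis unfolding P_def of_nat_prod by (rule ln_prod) (rule pos)
      qed
      also have "\<dots> \<le> (\<Sum>p | prime p \<and> B < p \<and> p \<le> y. (real d - 1) * ln (real p) + (ln (real p) - ln (real (p - 1))))"
      proof (intro sum_mono)
        fix p assume "p \<in> {p. prime p \<and> B < p \<and> p \<le> y}"
        then have p: "prime p" "p > B" by auto
        have p2: "p \<ge> 2" using p prime_ge_2_nat by blast
        have "real (t p * (p - 1)) \<le> real (p ^ d)" using t(2)[OF p] by (rule of_nat_mono)
        then have "ln (real (t p * (p - 1))) \<le> ln (real (p ^ d))"
          using t(1)[OF p] p2 by (subst ln_le_cancel_iff) (auto simp del: of_nat_mult)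
        also have "ln (real (t p * (p - 1))) = ln (real (t p)) + ln (real (p - 1))"
          using t(1)[OF p] p2 by (simp add: ln_mult)
        also have "ln (real (p ^ d)) = real d * ln (real p)" using p2 by (simp add: ln_realpow)
        finally show "ln (real (t p)) \<le> (real d - 1) * ln (real p) + (ln (real p) - ln (real (p - 1)))"
          by (simp add: algebra_simps)
      qed
      also have "\<dots> \<le> (\<Sum>p\<in>Q. (real d - 1) * ln (real p) + (ln (real p) - ln (real (p - 1))))"
      proof (intro sum_mono2 finQ)
        fix p assume "p \<in> Q - {p. prime p \<and> B < p \<and> p \<le> y}"
        then have "p \<ge> 2" using prime_ge_2_nat by (auto simp: Q_def)
        then have "ln (real (p - 1)) \<le> ln (real p)" "ln (real p) \<ge> 0" by (auto simp: ln_le_cancel_iff)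
        then show "0 \<le> (real d - 1) * ln (real p) + (ln (real p) - ln (real (p - 1)))" using d by simp
      qed (auto simp: Q_def)
      also have "\<dots> = (real d - 1) * (\<Sum>p\<in>Q. ln (real p)) + (\<Sum>p\<in>Q. ln (real p) - ln (real (p - 1)))"
        by (simp add: sum.distrib sum_distrib_left)
      also have "\<dots> \<le> (real d - 1) * ((1 + \<epsilon>) * real y + C0) + ln (real y)"
      proof (intro add_mono mult_left_mono)
        show "(\<Sum>p\<in>Q. ln (real p)) \<le> (1 + \<epsilon>) * real y + C0"
          using sum_ln_primes_le_psi[of y] C0[of "real y"] by (simp add: Q_def)
        show "(\<Sum>p\<in>Q. ln (real p) - ln (real (p - 1))) \<le> ln (real y)"
          unfolding Q_def by (rule sum_ln_prime_ratio_le[OF y])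
      qed (use d in auto)
      finally show ?thesis .
    qed
    moreover have "(1 + \<epsilon>) * (real y / 2) + (real d - 1) * ((1 + \<epsilon>) * real y) \<le> (real d - 3 / 8) * real y"
    proof -
      have "(1 + \<epsilon>) * (real d - 1 / 2) \<le> real d - 3 / 8"
        using d by (simp add: \<epsilon>_def field_simps)
      then have "(1 + \<epsilon>) * (real d - 1 / 2) * real y \<le> (real d - 3 / 8) * real y" by (rule mult_right_mono) simp
      moreover have "(1 + \<epsilon>) * (real y / 2) + (real d - 1) * ((1 + \<epsilon>) * real y) = (1 + \<epsilon>) * (real d - 1 / 2) * real y"
        by (simp add: field_simps)
      ultimately show ?thesis by simp
    qed
    moreover have "(real d - 1) * ((1 + \<epsilon>) * real y + C0) + C0 = (real d - 1) * ((1 + \<epsilon>) * real y) + real d * C0"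
      by (simp add: algebra_simps)
    ultimately show ?thesis by linarith
  qed
  define C1 where "C1 = ln (real K) + real d * C0 + ln 2"
  have "\<forall>\<^sub>F y in sequentially. ln (real y) + C1 \<le> real y / 8" by real_asymp
  then have "\<forall>\<^sub>F y in sequentially. \<exists>T\<ge>1. ln (real T) \<le> (real d - 1 / 4) * real y \<and>
     (\<forall>n\<ge>1 + B ^ d. \<forall>p. prime p \<and> p \<le> y \<longrightarrow> [S (n + T) = S n] (mod int p))"
    using eventually_ge_at_top[of 1]
  proof eventually_elim
    case (elim y)
    have "ln (real (T y)) \<le> (real d - 3 / 8) * real y + real y / 8"
      using lnT[OF elim(2)] elim(1) unfolding C1_def by linarith
    also have "\<dots> = (real d - 1 / 4) * real y" by (simp add: field_simps)
    finally show ?case using T1 per by blast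
  qed
  then show ?thesis by (rule that)
qed

section \<open>Windows without primes\<close>

lemma cong_period_of_cong_index:
  fixes x :: "nat \<Rightarrow> int"
  assumes per: "\<And>n. n \<ge> N \<Longrightarrow> [x (n + T) = x n] (mod m)"
    and uv: "u \<ge> N" "v \<ge> N" "[int u = int v] (mod int T)"
  shows "[x u = x v] (mod m)"
proof -
  have le: "[x v = x u] (mod m)" if "u \<le> v" "u \<ge> N" "[int u = int v] (mod int T)" for u v
  proof -
    have "[v = u] (mod T)" using that(3) by (simp add: cong_int_iff cong_sym)
    then have "T dvd v - u" using that(1) by (metis cong_altdef_nat)
    then obtain i where "v - u = T * i" by (rule dvdE)
    then have "v = u + T * i" using that(1) by simp
    then show ?thesis using cong_period_mult[where x = x and T = T, OF per that(2)] by simp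
  qed
  show ?thesis
    using le[of u v] le[of v u] uv by (cases "u \<le> v") (auto simp: cong_sym)
qed

section \<open>Periods of compositions\<close>

lemma reversible_period:
  assumes R: "reversible_ilrs d R" and m: "m \<ge> 1"
  obtains t where "t \<ge> 1" "t \<le> m ^ d" "\<And>n. n \<ge> 1 \<Longrightarrow> [R (n + t) = R n] (mod int m)"
proof -
  obtain a b where ab: "a 0 \<in> {-1, 1}" "ilrs_recurrence d a b R" using R by (auto simp: reversible_ilrs_def)
  have "rec_mod (int m) d a (\<lambda>_. b) R" using ab by (simp add: rec_mod_def ilrs_recurrence_def)
  moreover have "coprime (a 0) (int m)" using ab(1) by auto
  ultimately show ?thesis using rec_mod_period[OF m, of d a "\<lambda>_. b" R 1] that by auto
qed

lemma seq_comp_list_pos: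
  assumes "\<And>j. j \<in> set js \<Longrightarrow> positive_seq (R j)" "n \<ge> 1"
  shows "foldr seq_comp (map R js) int n \<ge> 1"
  using assms
proof (induction js)
  case (Cons j js)
  define g where "g = foldr seq_comp (map R js) int"
  have "g n \<ge> 1" unfolding g_def using Cons by simp
  then have "nat (g n) \<ge> 1" by linarith
  then have "seq_comp (R j) g n > 0" using Cons.prems(1)[of j] by (simp add: seq_comp_def positive_seq_def)
  then show ?case by (simp add: g_def int_one_le_iff_zero_less)
qed simp

text \<open>A period t of R j modulo m becomes the modulus for the sequences inside, so the
  exponents multiply. The empty composition \<open>int\<close> has period m, in accordance with the
  empty product.\<close>

lemma seq_comp_list_period:
  assumes R: "\<And>j. j \<in> set js \<Longrightarrow> reversible_ilrs (d j) (R j) \<and> positive_seq (R j)" and m: "m \<ge> 1"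
  shows "\<exists>T\<ge>1. T \<le> m ^ prod_list (map d js) \<and>
    (\<forall>n\<ge>1. [foldr seq_comp (map R js) int (n + T) = foldr seq_comp (map R js) int n] (mod int m))"
  using assms
proof (induction js arbitrary: m)
  case Nil
  then show ?case by (intro exI[of _ m]) (auto simp: cong_iff_dvd_diff)
next
  case (Cons j js)
  define g where "g = foldr seq_comp (map R js) int"
  have g: "g n \<ge> 1" if "n \<ge> 1" for n
    unfolding g_def using Cons.prems that by (intro seq_comp_list_pos) auto
  have "reversible_ilrs (d j) (R j)" using Cons.prems by simp
  then obtain t where t: "t \<ge> 1" "t \<le> m ^ d j" "\<And>n. n \<ge> 1 \<Longrightarrow> [R j (n + t) = R j n] (mod int m)"
    using reversible_period Cons.prems(2) by blast
  obtain T where T: "T \<ge> 1" "T \<le> t ^ prod_list (map d js)" "\<forall>n\<ge>1. [g (n + T) = g n] (mod int t)"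
    using Cons.IH[OF _ t(1)] Cons.prems(1) unfolding g_def by force
  have "T \<le> (m ^ d j) ^ prod_list (map d js)" using T(2) power_mono[OF t(2)] by (meson le_trans zero_le)
  then have "T \<le> m ^ prod_list (map d (j # js))" by (simp add: power_mult)
  moreover have "[seq_comp (R j) g (n + T) = seq_comp (R j) g n] (mod int m)" if n: "n \<ge> 1" for n
    unfolding seq_comp_def
  proof (rule cong_period_of_cong_index[where x = "R j" and T = t, OF t(3)])
    have "g (n + T) \<ge> 1" "g n \<ge> 1" using n by (auto intro!: g)
    then show "1 \<le> nat (g (n + T))" "1 \<le> nat (g n)" "[int (nat (g (n + T))) = int (nat (g n))] (mod int t)"
      using T(3) n by auto
  qed
  ultimately show ?case using T(1) by (auto simp: g_def)
qed

section \<open>From congruences to windows\<close>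

definition prime_free_window :: "(nat \<Rightarrow> int) \<Rightarrow> nat \<Rightarrow> nat \<Rightarrow> bool" where
  "prime_free_window f D n \<longleftrightarrow> n \<ge> 1 \<and> (\<forall>p. prime p \<longrightarrow>
     real p \<notin> {real_of_int \<bar>f n\<bar> - ln (real n) / (2 * real D)<..<real_of_int \<bar>f n\<bar> + ln (real n) / (2 * real D)})"

text \<open>A prime p = |f n| + h in the window is compared with F + h or F - h, according to
  whether f n and v0 have the same sign. This number lies between 2 and 2 F, and its prime factors
  divide p as well. By \<open>big\<close> the window lies above 2 F, so p is not one of
  them.\<close>

lemma prime_free_window_of_congruent:
  assumes n: "n \<ge> 1" and cong: "\<And>q. prime q \<Longrightarrow> int q \<le> 2 * \<bar>v0\<bar> \<Longrightarrow> [f n = v0] (mod int q)"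
    and \<delta>: "ln (real n) / (2 * real D) \<le> real_of_int \<bar>v0\<bar> - 1"
    and big: "real_of_int \<bar>f n\<bar> - ln (real n) / (2 * real D) \<ge> 2 * real_of_int \<bar>v0\<bar>"
  shows "prime_free_window f D n"
  unfolding prime_free_window_def
proof (intro conjI n allI impI notI)
  fix p :: nat assume p: "prime p"
  assume in_window: "real p \<in> {real_of_int \<bar>f n\<bar> - ln (real n) / (2 * real D)<..<real_of_int \<bar>f n\<bar> + ln (real n) / (2 * real D)}"
  define F where "F = \<bar>v0\<bar>"
  define h where "h = int p - \<bar>f n\<bar>"
  have ph: "int p = \<bar>f n\<bar> + h" by (simp add: h_def)
  have "\<bar>real_of_int h\<bar> < real_of_int F - 1"
    using in_window \<delta> by (auto simp: h_def F_def abs_less_iff)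
  \<comment> \<open>The 1 subtracted from F keeps F + h and F - h away from 1, which has no prime
    factor.\<close>
  then have hF: "\<bar>h\<bar> < F - 1" by linarith
  have "real p > 2 * real_of_int F" using in_window big by (auto simp: F_def)
  then have pF: "int p > 2 * F" by linarith
  obtain w where w: "2 \<le> w" "w \<le> 2 * F" "\<And>q. prime q \<Longrightarrow> int q \<le> 2 * F \<Longrightarrow> int q dvd w \<Longrightarrow> int q dvd int p"
  proof -
    have c: "int q dvd f n - v0" if "prime q" "int q \<le> 2 * F" for q
      using cong[of q] that by (simp add: F_def cong_iff_dvd_diff)
    show ?thesis
    proof (cases "(f n \<ge> 0) = (v0 \<ge> 0)")
      case True
      show ?thesis
      proof (rule that[of "F + h"])
        fix q assume q: "prime q" "int q \<le> 2 * F" "int q dvd F + h"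
        have "int q dvd \<bar>f n\<bar> - F" using c[OF q(1,2)] True unfolding F_def
          by (auto simp: abs_if dvd_diff_commute split: if_splits)
        then have "int q dvd (\<bar>f n\<bar> - F) + (F + h)" using q(3) by (rule dvd_add)
        then show "int q dvd int p" by (simp add: ph)
      qed (use hF in auto)
    next
      case False
      show ?thesis
      proof (rule that[of "F - h"])
        fix q assume q: "prime q" "int q \<le> 2 * F" "int q dvd F - h"
        have "f n - v0 = \<bar>f n\<bar> + F \<or> f n - v0 = - (\<bar>f n\<bar> + F)" using False unfolding F_def
          by (auto simp: abs_if)
        then have "int q dvd \<bar>f n\<bar> + F" using c[OF q(1,2)] by (metis dvd_minus_iff)
        then have "int q dvd (\<bar>f n\<bar> + F) - (F - h)" using q(3) by (rule dvd_diff)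
        then show "int q dvd int p" by (simp add: ph)
      qed (use hF in auto)
    qed
  qed
  have "nat w \<noteq> 1" using w(1) by linarith
  then obtain q where q: "prime q" "q dvd nat w" using prime_factor_nat by blast
  have "q \<le> nat w" using q w(1) by (intro dvd_imp_le) auto
  then have qF: "int q \<le> 2 * F" using w(1,2) by linarith
  have "int q dvd int (nat w)" using q(2) by (simp only: int_dvd_int_iff)
  then have "int q dvd w" using w(1) by simp
  then have "int q dvd int p" using w(3) q(1) qF by blast
  then have "q = p" using p q(1) by (simp add: primes_dvd_imp_eq)
  then show False using qF pF by simp
qed

text \<open>\<open>E\<close> is the exponent in the periods of the inner composition g. Once n0 is
  fixed, F = |f n0| determines the primes, a period T and n = n0 + T k, where T k is the first
  multiple of T from exp F on. Then ln n >= F, so the growth of f puts the window above 2 F. The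
  bound X for ln T is itself at least F, so this choice of k adds only a constant to the bound for
  ln n.\<close>

lemma infinitely_many_prime_free_windows_nonlinear:
  assumes rec: "ilrs_recurrence d a b S" and d: "d \<ge> 1" and a0: "a 0 \<noteq> 0"
    and nonlin: "\<not> (d = 1 \<and> a 0 = 1)"
    and g1: "\<And>n. n \<ge> 1 \<Longrightarrow> g n \<ge> 1" and E: "E \<ge> 1"
    and gper: "\<And>m. m \<ge> 1 \<Longrightarrow> \<exists>T\<ge>1. T \<le> m ^ E \<and> (\<forall>n\<ge>1. [g (n + T) = g n] (mod int m))"
    and glim: "filterlim g at_top sequentially"
    and flim: "filterlim (\<lambda>n. real_of_int \<bar>S (nat (g n))\<bar> / ln (real n)) at_top sequentially"
  shows "\<exists>n>N. prime_free_window (\<lambda>n. S (nat (g n))) (d * E) n"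
proof -
  define f where "f = (\<lambda>n. S (nat (g n)))"
  define D where "D = real d * real E"
  have D1: "D \<ge> 1" using d E mult_mono[of 1 "real d" 1 "real E"] by (simp add: D_def)
  obtain n1 where n1: "\<forall>\<^sub>F y in sequentially. \<exists>T\<ge>1. ln (real T) \<le> (real d - 1 / 4) * real y \<and>
     (\<forall>n\<ge>n1. \<forall>p. prime p \<and> p \<le> y \<longrightarrow> [S (n + T) = S n] (mod int p))"
    using ilrs_short_common_period[OF rec d a0 nonlin] by blast
  then obtain y0 where y0: "\<And>y. y \<ge> y0 \<Longrightarrow> \<exists>T\<ge>1. ln (real T) \<le> (real d - 1 / 4) * real y \<and>
     (\<forall>n\<ge>n1. \<forall>p. prime p \<and> p \<le> y \<longrightarrow> [S (n + T) = S n] (mod int p))"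
    by (auto simp: eventually_sequentially)
  \<comment> \<open>The 4 yields |f n| >= 4 ln n, the sum 4 + 4 D absorbs the additive terms 2 + 2 D
    in the bound for ln n, and y0 makes the common period available.\<close>
  define c0 where "c0 = 4 + 4 * D + real y0"
  have c0: "c0 \<ge> 4 + 4 * D" "c0 \<ge> real y0" "c0 \<ge> 4" using D1 by (auto simp: c0_def)
  have "\<forall>\<^sub>F n in sequentially. g n \<ge> int n1" using glim by (simp add: filterlim_at_top)
  moreover have "\<forall>\<^sub>F n in sequentially. real_of_int \<bar>f n\<bar> / ln (real n) \<ge> c0"
    using flim by (simp add: filterlim_at_top f_def)
  ultimately have "\<forall>\<^sub>F n in sequentially. g n \<ge> int n1 \<and> real_of_int \<bar>f n\<bar> / ln (real n) \<ge> c0"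
    by eventually_elim auto
  then obtain N1 where N1: "\<And>n. n \<ge> N1 \<Longrightarrow> g n \<ge> int n1"
    "\<And>n. n \<ge> N1 \<Longrightarrow> real_of_int \<bar>f n\<bar> / ln (real n) \<ge> c0"
    by (auto simp: eventually_sequentially)
  define n0 where "n0 = max (max N N1) 3"
  have n0: "n0 \<ge> N" "n0 \<ge> N1" "n0 \<ge> 3" by (auto simp: n0_def)
  have ln1: "ln (real n) \<ge> 1" if "n \<ge> 3" for n
  proof -
    have "exp 1 \<le> (3 :: real)" by (rule exp_le)
    then have "exp 1 \<le> real n" using that by linarith
    then show ?thesis using that by (simp add: ln_ge_iff)
  qed
  have fbig: "real_of_int \<bar>f n\<bar> \<ge> c0 * ln (real n)" if "n \<ge> n0" for n
    using N1(2)[of n] ln1[of n] that n0 by (simp add: field_simps)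
  define F where "F = \<bar>f n0\<bar>"
  have Fn0: "real_of_int F \<ge> c0 * ln (real n0)" using fbig[of n0] by (simp add: F_def)
  have "c0 * ln (real n0) \<ge> c0 * 1"
    using ln1[OF n0(3)] c0 by (intro mult_left_mono) auto
  then have Fbig: "real_of_int F \<ge> c0" using Fn0 by simp
  have "c0 * ln (real n0) \<ge> 1 * ln (real n0)"
    using ln1[OF n0(3)] c0 by (intro mult_right_mono) auto
  then have lnn0: "ln (real n0) \<le> real_of_int F" using Fn0 by simp
  define y where "y = nat (2 * F)"
  have F0: "F \<ge> 0" by (simp add: F_def)
  have y: "real y = 2 * real_of_int F" using F0 by (simp add: y_def)
  have "y \<ge> y0" using Fbig c0 y F0 by linarith
  then obtain T0 where T0: "T0 \<ge> 1" "ln (real T0) \<le> (real d - 1 / 4) * real y"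
     "\<And>n p. n \<ge> n1 \<Longrightarrow> prime p \<Longrightarrow> p \<le> y \<Longrightarrow> [S (n + T0) = S n] (mod int p)"
    using y0 by blast
  obtain T where T: "T \<ge> 1" "T \<le> T0 ^ E" "\<And>n. n \<ge> 1 \<Longrightarrow> [g (n + T) = g n] (mod int T0)"
    using gper[OF T0(1)] by blast
  define k where "k = nat \<lceil>exp (real_of_int F) / real T\<rceil>"
  define n where "n = n0 + T * k"
  have T_pos: "real T > 0" using T by simp
  have k1: "exp (real_of_int F) \<le> real (T * k)"
  proof -
    have "exp (real_of_int F) / real T \<le> real k" unfolding k_def by linarith
    then show ?thesis using T_pos by (simp add: field_simps)
  qed
  have k2: "real (T * k) \<le> exp (real_of_int F) + real T"
  proof -
    have "exp (real_of_int F) / real T \<ge> 0" by simp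
    then have "real k \<le> exp (real_of_int F) / real T + 1" unfolding k_def by linarith
    then have "real T * real k \<le> real T * (exp (real_of_int F) / real T + 1)" using T_pos by (intro mult_left_mono) auto
    also have "\<dots> = exp (real_of_int F) + real T" using T_pos by (simp add: field_simps)
    finally show ?thesis by simp
  qed
  have k0: "T * k > 0" using k1 exp_gt_zero[of "real_of_int F"] by (metis gr0I not_le of_nat_0)
  have nn0: "n > n0" using k0 by (simp add: n_def)
  \<comment> \<open>This is E (d - 1/4) y with y = 2 F. The subtracted E / 2 is the saving in the
    exponent; it covers the step from F to F - 1.\<close>
  define X where "X = (2 * D - real E / 2) * real_of_int F"
  have D2: "real_of_int F * 1 \<le> X"
  proof -
    have "real E * 1 \<le> real E * real d" using d by (intro mult_left_mono) auto
    then have "real E \<le> D" by (simp add: D_def mult.commute)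
    moreover have "real E \<ge> 1" using E by simp
    ultimately have "1 \<le> 2 * D - real E / 2" by linarith
    then have "1 * real_of_int F \<le> X" unfolding X_def using F0 by (intro mult_right_mono) auto
    then show ?thesis by simp
  qed
  have lnn: "ln (real n) \<le> 2 * D * (real_of_int F - 1)"
  proof -
    have "real T \<le> real (T0 ^ E)" using T(2) by (rule of_nat_mono)
    then have "ln (real T) \<le> ln (real (T0 ^ E))" using T_pos T0(1) by (subst ln_le_cancel_iff) auto
    also have "\<dots> = real E * ln (real T0)" using T0(1) by (simp add: ln_realpow)
    also have "\<dots> \<le> real E * ((real d - 1 / 4) * real y)" using T0(2) by (intro mult_left_mono) auto
    also have "\<dots> = X" by (simp add: X_def y D_def algebra_simps)
    finally have "exp (ln (real T)) \<le> exp X" by simp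
    then have "real T \<le> exp X" using T_pos by simp
    moreover have "exp (real_of_int F) \<le> exp X" using D2 by simp
    moreover have "real n0 \<le> exp X"
    proof -
      have "real n0 = exp (ln (real n0))" using n0 by simp
      also have "\<dots> \<le> exp X" using lnn0 D2 by simp
      finally show ?thesis .
    qed
    moreover have "real n = real n0 + real (T * k)" by (simp add: n_def)
    ultimately have "real n \<le> 3 * exp X" using k2 by linarith
    then have "ln (real n) \<le> ln (3 * exp X)" using nn0 by (subst ln_le_cancel_iff) auto
    also have "\<dots> = ln 3 + X" by (simp add: ln_mult)
    also have "\<dots> \<le> 2 + X" using ln_le_minus_one[of 3] by simp
    also have "\<dots> \<le> 2 * D * (real_of_int F - 1)"
    proof -
      have "1 * real_of_int F \<le> real E * real_of_int F" using E F0 by (intro mult_right_mono) auto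
      then have "2 + 2 * D \<le> real E / 2 * real_of_int F" using Fbig c0 by linarith
      then show ?thesis by (simp add: X_def algebra_simps)
    qed
    finally show ?thesis .
  qed
  have nF: "ln (real n) \<ge> real_of_int F"
  proof -
    have "exp (real_of_int F) \<le> real n" using k1 by (simp add: n_def)
    then show ?thesis using nn0 by (simp add: ln_ge_iff)
  qed
  have "prime_free_window f (d * E) n"
  proof (rule prime_free_window_of_congruent[where ?v0.0 = "f n0"])
    show "n \<ge> 1" using nn0 by simp
    fix q assume q: "prime q" "int q \<le> 2 * \<bar>f n0\<bar>"
    have qy: "q \<le> y" using q(2) by (simp add: y_def F_def)
    have "g n \<ge> int n1" "g n0 \<ge> int n1" using N1(1) nn0 n0 by auto
    then have ge: "n1 \<le> nat (g n)" "n1 \<le> nat (g n0)" by linarith+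
    have "g n \<ge> 1" "g n0 \<ge> 1" using nn0 n0 by (auto intro!: g1)
    moreover have "[g n = g n0] (mod int T0)"
      unfolding n_def by (rule cong_period_mult[where x = g and T = T and N = 1, OF T(3)]) (use n0 in auto)
    ultimately have idx: "[int (nat (g n)) = int (nat (g n0))] (mod int T0)" by simp
    have per: "[S (i + T0) = S i] (mod int q)" if "i \<ge> n1" for i by (rule T0(3)[OF that q(1) qy])
    show "[f n = f n0] (mod int q)"
      unfolding f_def by (rule cong_period_of_cong_index[where x = S and N = n1 and T = T0, OF per ge idx])
  next
    have "ln (real n) / (2 * D) \<le> real_of_int F - 1"
      using lnn D1 by (simp add: field_simps)
    then show "ln (real n) / (2 * real (d * E)) \<le> real_of_int \<bar>f n0\<bar> - 1" by (simp add: D_def F_def)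
    have l0: "ln (real n) \<ge> 0" using nF F0 by (meson of_int_0_le_iff order_trans)
    have "ln (real n) / (2 * D) \<le> ln (real n) / 1" using l0 D1 by (intro divide_left_mono) auto
    moreover have "real_of_int \<bar>f n\<bar> \<ge> 4 * ln (real n)"
    proof -
      have "4 * ln (real n) \<le> c0 * ln (real n)" using l0 c0 by (intro mult_right_mono) auto
      then show ?thesis using fbig[of n] nn0 by linarith
    qed
    ultimately have "real_of_int \<bar>f n\<bar> - ln (real n) / (2 * D) \<ge> 2 * real_of_int F"
      using nF l0 by linarith
    then show "2 * real_of_int \<bar>f n0\<bar> \<le> real_of_int \<bar>f n\<bar> - ln (real n) / (2 * real (d * E))" by (simp add: D_def F_def)
  qed
  then show ?thesis using nn0 n0(1) by (intro exI[of _ n]) (auto simp: f_def)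
qed

section \<open>Elementary bounds for the number of primes\<close>

text \<open>Erdos's argument: a number up to N is determined by its square part, at most sqrt N, and
  by the set of primes in its squarefree part.\<close>

lemma le_four_power_card_primes: "N \<le> 4 ^ card {p. prime p \<and> p \<le> (N :: nat)}"
proof -
  define P where "P = {p. prime p \<and> p \<le> N}"
  define r where "r = floor_sqrt N"
  have finP: "finite P" by (rule finite_subset[of _ "{..N}"]) (auto simp: P_def)
  define \<phi> where "\<phi> = (\<lambda>k :: nat. (prime_factors (squarefree_part k), square_part k))"
  have sub: "\<phi> ` {1..N} \<subseteq> Pow P \<times> {1..r}"
  proof (clarsimp simp: \<phi>_def, intro conjI subsetI)
    fix k assume k: "Suc 0 \<le> k" "k \<le> N"
    have "square_part k ^ 2 \<le> k" using k by (intro dvd_imp_le square_part_square_dvd) auto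
    then show "square_part k \<le> r" unfolding r_def using k by (intro le_floor_sqrtI) auto
    show "Suc 0 \<le> square_part k" using k by (auto simp: Suc_le_eq intro!: Nat.gr0I)
    fix p assume p: "p \<in> prime_factors (squarefree_part k)"
    have "squarefree_part k dvd k" using squarefree_decompose[of k] by (metis dvd_triv_left)
    then have "p dvd k" using p by (meson dvd_trans in_prime_factors_imp_dvd)
    then have "p \<le> N" using k dvd_imp_le[of p k] by linarith
    then show "p \<in> P" using p by (auto simp: P_def)
  qed
  have inj: "inj_on \<phi> {1..N}"
  proof (rule inj_onI)
    fix k l assume kl: "k \<in> {1..N}" "l \<in> {1..N}" "\<phi> k = \<phi> l"
    have "squarefree_part k = squarefree_part l"
    proof (rule multiplicity_eq_nat)
      fix p :: nat assume p: "prime p"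
      have m: "multiplicity p (squarefree_part j) = (if p \<in> prime_factors (squarefree_part j) then 1 else 0)" for j
      proof -
        have "multiplicity p (squarefree_part j) \<le> 1"
          using prime_multiplicity_squarefree_part_le_Suc_0[OF p, of j] by simp
        moreover have "multiplicity p (squarefree_part j) > 0 \<longleftrightarrow> p \<in> prime_factors (squarefree_part j)"
          using p by (simp add: prime_factors_multiplicity)
        ultimately show ?thesis by auto
      qed
      show "multiplicity p (squarefree_part k) = multiplicity p (squarefree_part l)"
        unfolding m using kl(3) by (simp add: \<phi>_def)
    qed (auto intro!: Nat.gr0I)
    moreover have "square_part k = square_part l" using kl(3) by (simp add: \<phi>_def)
    ultimately show "k = l" using squarefree_decompose[of k] squarefree_decompose[of l] by simp
  qed
  have "card {1..N} \<le> card (Pow P \<times> {1..r})"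
    using card_inj_on_le[OF inj sub] finP by simp
  then have "N \<le> 2 ^ card P * r" using finP by (simp add: card_cartesian_product card_Pow)
  then have "N\<^sup>2 \<le> (2 ^ card P * r)\<^sup>2" by (rule power_mono) simp
  also have "\<dots> = (2 ^ card P)\<^sup>2 * r\<^sup>2" by (rule power_mult_distrib)
  also have "(2 ^ card P)\<^sup>2 = (4 :: nat) ^ card P"
  proof -
    have "(2 ^ card P)\<^sup>2 = (2\<^sup>2 :: nat) ^ card P" by (simp only: power_mult[symmetric] mult.commute)
    then show ?thesis by simp
  qed
  also have "4 ^ card P * r\<^sup>2 \<le> 4 ^ card P * N" unfolding r_def by (intro mult_left_mono) auto
  finally have "N * N \<le> 4 ^ card P * N" by (simp add: power2_eq_square)
  then have "N \<le> 4 ^ card P" by (cases "N = 0") simp_all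
  then show ?thesis by (simp only: P_def)
qed

text \<open>A prime above 3 is 1 or 5 modulo 6.\<close>

lemma card_primes_le: "real (card {p :: nat. prime p \<and> p \<le> y}) \<le> real y / 3 + 4"
proof -
  define A where "A = {2, 3 :: nat} \<union> (\<lambda>i. 6 * i + 1) ` {..y div 6} \<union> (\<lambda>i. 6 * i + 5) ` {..y div 6}"
  have "{p. prime p \<and> p \<le> y} \<subseteq> A"
  proof
    fix p assume "p \<in> {p. prime p \<and> p \<le> y}"
    then have p: "prime p" "p \<le> y" by auto
    show "p \<in> A"
    proof (cases "p = 2 \<or> p = 3")
      case False
      have "\<not> 2 dvd p" "\<not> 3 dvd p" using False p(1) primes_dvd_imp_eq[of 2 p] primes_dvd_imp_eq[of 3 p] by auto
      then have "p mod 6 = 1 \<or> p mod 6 = 5" by presburger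
      then have "p = 6 * (p div 6) + 1 \<or> p = 6 * (p div 6) + 5" by presburger
      moreover have "p div 6 \<in> {..y div 6}" using p(2) by (simp add: div_le_mono)
      ultimately show ?thesis unfolding A_def by blast
    qed (auto simp: A_def)
  qed
  moreover have "finite A" by (simp add: A_def)
  ultimately have "card {p. prime p \<and> p \<le> y} \<le> card A" by (intro card_mono)
  also have "card A \<le> card ({2, 3 :: nat} \<union> (\<lambda>i. 6 * i + 1) ` {..y div 6}) + card ((\<lambda>i. 6 * i + 5) ` {..y div 6})"
    unfolding A_def by (rule card_Un_le)
  also have "\<dots> \<le> (card {2, 3 :: nat} + card ((\<lambda>i. 6 * i + 1) ` {..y div 6})) + card ((\<lambda>i. 6 * i + 5) ` {..y div 6})"
    by (intro add_mono card_Un_le) simp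
  also have "\<dots> \<le> (2 + card {..y div 6}) + card {..y div 6}"
    by (intro add_mono card_image_le) auto
  finally have "card {p. prime p \<and> p \<le> y} \<le> 4 + 2 * (y div 6)" by simp
  then have "real (card {p. prime p \<and> p \<le> y}) \<le> real (4 + 2 * (y div 6))" by (rule of_nat_mono)
  also have "\<dots> \<le> 4 + 2 * (real y / 6)" by simp
  finally show ?thesis by simp
qed

text \<open>Only the logarithms of q1 and q2 will count, so exponentially large primes are good
  enough: if c primes are at most y, at least c + 2 are at most 4 ^ (c + 1) + 1. The slope 25/54 is
  2/3 times the bound 25/36 for ln 2.\<close>

lemma two_primes_above:
  obtains q1 q2 :: nat where "prime q1" "prime q2" "q1 \<noteq> q2" "y < q1" "y < q2"
    "ln (real q1) \<le> 25 / 54 * real y + 10" "ln (real q2) \<le> 25 / 54 * real y + 10"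
proof -
  define c where "c = card {p. prime p \<and> p \<le> y}"
  define N :: nat where "N = 4 ^ (c + 1) + 1"
  define A where "A = {p. prime p \<and> y < p \<and> p \<le> N}"
  have finA: "finite A" by (rule finite_subset[of _ "{..N}"]) (auto simp: A_def)
  have "(4::nat) ^ (c + 1) < 4 ^ card {p. prime p \<and> p \<le> N}"
    using le_four_power_card_primes[of N] by (simp add: N_def)
  then have "c + 1 < card {p. prime p \<and> p \<le> N}" by (simp only: power_strict_increasing_iff)
  also have "\<dots> \<le> card ({p. prime p \<and> p \<le> y} \<union> A)"
    using finA by (intro card_mono) (auto simp: A_def)
  also have "\<dots> \<le> c + card A" unfolding c_def by (rule card_Un_le)
  finally have "1 < card A" by simp
  then obtain q1 q2 where q: "q1 \<in> A" "q2 \<in> A" "q1 \<noteq> q2"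
    using card_le_Suc0_iff_eq[OF finA] by (metis One_nat_def not_le)
  have "ln (real q) \<le> 25 / 54 * real y + 10" if "q \<in> A" for q
  proof -
    have "q \<le> 4 ^ (c + 1) + 1" "(1 :: nat) \<le> 4 ^ (c + 1)" using that by (auto simp: A_def N_def)
    then have "q \<le> 2 * 4 ^ (c + 1)" by linarith
    also have "\<dots> = 2 ^ (2 * c + 3)" by (simp add: power_add power_mult)
    finally have "real q \<le> real (2 ^ (2 * c + 3))" by (rule of_nat_mono)
    moreover have "q > 0" using that prime_gt_0_nat by (auto simp: A_def)
    ultimately have "ln (real q) \<le> ln (real (2 ^ (2 * c + 3)))" by (subst ln_le_cancel_iff) auto
    also have "\<dots> = real (2 * c + 3) * ln 2" by (simp add: ln_realpow)
    also have "\<dots> \<le> real (2 * c + 3) * (25 / 36)" by (intro mult_left_mono ln2_le_25_over_36) simp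
    also have "\<dots> \<le> (2 * (real y / 3 + 4) + 3) * (25 / 36)"
      using card_primes_le[of y] by (intro mult_right_mono) (auto simp: c_def)
    also have "\<dots> \<le> 25 / 54 * real y + 10" by (simp add: field_simps)
    finally show ?thesis .
  qed
  then show ?thesis using that[of q1 q2] q by (auto simp: A_def)
qed

text \<open>
  The entries of the window are congruent to the integers from about \<open>-y\<close> to \<open>y\<close> modulo all primes up to \<open>y\<close>,
  which doubles its length.  The two entries congruent to \<open>1\<close> and \<open>-1\<close> are covered by two additional primes.
\<close>

lemma infinitely_many_prime_free_windows_linear:
  assumes rec: "\<And>n. n \<ge> 1 \<Longrightarrow> S (n + 1) = S n + b"
    and flim: "filterlim (\<lambda>n. real_of_int \<bar>S n\<bar> / ln (real n)) at_top sequentially"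
  shows "\<exists>n>N. prime_free_window S 1 n"
proof -
  define z where "z = S 1"
  have S: "S (m + 1) = z + b * int m" for m
    by (induction m) (use rec in \<open>auto simp: z_def algebra_simps\<close>)
  have b0: "b \<noteq> 0"
  proof
    assume "b = 0"
    then have Sz: "S n = z" if "n \<ge> 1" for n using S[of "n - 1"] that by simp
    have "\<forall>\<^sub>F n in sequentially. real_of_int \<bar>S n\<bar> / ln (real n) \<ge> real_of_int \<bar>z\<bar> + 1"
      using flim by (simp add: filterlim_at_top)
    moreover have "\<forall>\<^sub>F n in sequentially. ln (real n) \<ge> 1" by real_asymp
    ultimately have "\<forall>\<^sub>F n in sequentially. False"
      using eventually_ge_at_top[of 1]
    proof eventually_elim
      case (elim n)
      have "ln (real n) > 0" using elim by linarith
      then have "real_of_int \<bar>z\<bar> / ln (real n) \<le> real_of_int \<bar>z\<bar> / 1"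
        using elim by (intro divide_left_mono) simp_all
      then show ?case using elim Sz[of n] by simp
    qed
    then show False by simp
  qed
  \<comment> \<open>The slope 21/20 and twice 25/54 for the extra primes add up to less than 2, and
    a radius of about y allows ln n up to about 2 y.\<close>
  obtain C0 where C0: "\<And>x. x \<ge> 0 \<Longrightarrow> chebyshev_psi x \<le> (1 + 1 / 20) * x + C0"
    using chebyshev_psi_upper_bound[of "1/20"] by auto
  define Z where "Z = \<bar>real_of_int z\<bar>"
  have "\<forall>\<^sub>F y :: nat in sequentially. (21 / 20 + 50 / 54) * real y + (C0 + 21) \<le> 2 * (real y - Z - 1)" by real_asymp
  then have "\<forall>\<^sub>F y :: nat in sequentially. (21 / 20 + 50 / 54) * real y + (C0 + 21) \<le> 2 * (real y - Z - 1) \<and>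
     y \<ge> N + nat \<bar>z\<bar> + nat \<bar>b\<bar> + 3"
    using eventually_ge_at_top[of "N + nat \<bar>z\<bar> + nat \<bar>b\<bar> + 3"] by eventually_elim auto
  then obtain y :: nat where y: "(21 / 20 + 50 / 54) * real y + (C0 + 21) \<le> 2 * (real y - Z - 1)"
    "y \<ge> N + nat \<bar>z\<bar> + nat \<bar>b\<bar> + 3"
    by (auto simp: eventually_sequentially)
  obtain q1 q2 :: nat where q: "prime q1" "prime q2" "q1 \<noteq> q2" "y < q1" "y < q2"
    "ln (real q1) \<le> 25 / 54 * real y + 10" "ln (real q2) \<le> 25 / 54 * real y + 10"
    by (rule two_primes_above)
  define Q where "Q = (\<Prod>p | prime p \<and> p \<le> y. p)"
  have finP: "finite {p. prime p \<and> p \<le> y}" by (rule finite_subset[of _ "{..y}"]) auto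
  have Q1: "Q \<ge> 1" unfolding Q_def by (intro prod_ge_1) (auto dest: prime_ge_1_nat)
  have dvdQ: "p dvd Q" if "prime p" "p \<le> y" for p
    unfolding Q_def using that finP by (intro dvd_prodI) auto
  have "ln (real Q) = (\<Sum>p | prime p \<and> p \<le> y. ln (real p))"
    unfolding Q_def of_nat_prod by (rule ln_prod[OF finP]) (auto dest: prime_gt_0_nat)
  then have lnQ: "ln (real Q) \<le> 21 / 20 * real y + C0"
    using sum_ln_primes_le_psi[of y] C0[of "real y"] by simp
  have cop: "coprime Q q" if "prime q" "y < q" for q
    unfolding Q_def using that by (intro prod_coprime_left) (auto intro!: primes_coprime)
  have cop12: "coprime q1 q2" using q by (intro primes_coprime)
  have sol: "\<exists>x. [b * x = c] (mod int q)" if "prime q" "y < q" for q c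
  proof -
    have "coprime b (int q)" using that y(2) b0 by (intro coprime_int_prime_gt) auto
    then obtain x where "[b * x = 1] (mod int q)" using cong_solve_coprime_int by blast
    then have "[b * x * c = 1 * c] (mod int q)" by (intro cong_mult cong_refl)
    then show ?thesis by (intro exI[of _ "x * c"]) (simp add: mult_ac)
  qed
  obtain x1 where x1: "[b * x1 = -1] (mod int q1)" using sol q by blast
  obtain x2 where x2: "[b * x2 = 1] (mod int q2)" using sol q by blast
  obtain w1 where w1: "[w1 = x1] (mod int q1)" "[w1 = x2] (mod int q2)"
    using binary_chinese_remainder_int[of "int q1" "int q2"] cop12 by auto
  have "coprime (int Q) (int q1 * int q2)" using cop q by simp
  then obtain w where w: "[w = 0] (mod int Q)" "[w = w1] (mod int q1 * int q2)"
    using binary_chinese_remainder_int by blast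
  define P where "P = Q * (q1 * q2)"
  have q12: "q1 > 3" "q2 > 3" using q y(2) by auto
  have P0: "P > 0" using Q1 q12 by (simp add: P_def)
  \<comment> \<open>Adding P places m in [P, 2 P): large enough to lift the window above q1 and q2,
    small enough for n <= 2 P.\<close>
  define m where "m = nat (w mod int P) + P"
  have m: "m \<ge> P" "m < 2 * P" using P0 by (auto simp: m_def nat_less_iff)
  have "int m = w mod int P + int P" using P0 by (simp add: m_def)
  moreover have "[w mod int P + int P = w + 0] (mod int P)" by (intro cong_add) (auto simp: cong_0_iff)
  ultimately have mw: "[int m = w] (mod int P)" by simp
  have mQ: "int Q dvd int m"
  proof -
    have "[int m = w] (mod int Q)" using mw by (rule cong_dvd_modulus) (simp add: P_def)
    then show ?thesis using w(1) by (metis cong_0_iff cong_trans)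
  qed
  have mw1: "[int m = w1] (mod int (q1 * q2))"
  proof -
    have "[int m = w] (mod int (q1 * q2))" using mw by (rule cong_dvd_modulus) (simp add: P_def)
    then show ?thesis using w(2) by (simp add: cong_trans)
  qed
  have m1: "[b * int m + 1 = 0] (mod int q1)"
  proof -
    have "[int m = w1] (mod int q1)" using mw1 by (rule cong_dvd_modulus) simp
    then have "[int m = x1] (mod int q1)" using w1(1) by (rule cong_trans)
    then have "[b * int m = b * x1] (mod int q1)" by (intro cong_mult cong_refl)
    then have "[b * int m = -1] (mod int q1)" using x1 by (rule cong_trans)
    then have "[b * int m + 1 = -1 + 1] (mod int q1)" by (intro cong_add cong_refl)
    then show ?thesis by simp
  qed
  have m2: "[b * int m - 1 = 0] (mod int q2)"
  proof -
    have "[int m = w1] (mod int q2)" using mw1 by (rule cong_dvd_modulus) simp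
    then have "[int m = x2] (mod int q2)" using w1(2) by (rule cong_trans)
    then have "[b * int m = b * x2] (mod int q2)" by (intro cong_mult cong_refl)
    then have "[b * int m = 1] (mod int q2)" using x2 by (rule cong_trans)
    then have "[b * int m - 1 = 1 - 1] (mod int q2)" by (intro cong_diff cong_refl)
    then show ?thesis by simp
  qed
  define n where "n = m + 1"
  have q12P: "q1 * q2 \<le> P" using Q1 by (simp add: P_def)
  have nN: "n > N"
  proof -
    have "q1 * 1 \<le> q1 * q2" using q12 by (intro mult_le_mono) auto
    then show ?thesis using y(2) q m q12P unfolding n_def by linarith
  qed
  have fn: "S n = z + b * int m" unfolding n_def by (rule S)
  have "ln (real n) \<le> ln (2 * real P)"
    using m P0 by (subst ln_le_cancel_iff) (auto simp: n_def)
  also have "\<dots> = ln 2 + (ln (real Q) + (ln (real q1) + ln (real q2)))"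
    using Q1 q12 by (simp add: P_def ln_mult)
  also have "\<dots> \<le> 2 * (real y - Z - 1)" using lnQ q(6,7) y(1) ln_2_less_1 by simp
  finally have lnn: "ln (real n) / 2 \<le> real y - Z - 1" by simp
  have big: "real_of_int \<bar>S n\<bar> - ln (real n) / 2 > real q1" "real_of_int \<bar>S n\<bar> - ln (real n) / 2 > real q2"
  proof -
    have "1 * int P \<le> \<bar>b\<bar> * int m" using b0 m by (intro mult_mono) auto
    also have "\<dots> = \<bar>S n - z\<bar>" by (simp add: fn abs_mult)
    also have "\<dots> \<le> \<bar>S n\<bar> + \<bar>z\<bar>" by (rule abs_triangle_ineq4)
    finally have "int (q1 * q2) \<le> \<bar>S n\<bar> + \<bar>z\<bar>" using q12P by linarith
    then have "real_of_int (int (q1 * q2)) \<le> real_of_int (\<bar>S n\<bar> + \<bar>z\<bar>)" by (simp only: of_int_le_iff)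
    then have *: "real (q1 * q2) - Z \<le> real_of_int \<bar>S n\<bar>" by (simp add: Z_def)
    have "2 * q1 \<le> q2 * q1" "2 * q2 \<le> q1 * q2" using q12 by (intro mult_le_mono; simp)+
    then have "real (2 * q1) \<le> real (q1 * q2)" "real (2 * q2) \<le> real (q1 * q2)"
      unfolding of_nat_le_iff by (simp_all add: mult.commute)
    then have "2 * real q1 \<le> real (q1 * q2)" "2 * real q2 \<le> real (q1 * q2)" by simp_all
    moreover have "real y < real q1" "real y < real q2" using q(4,5) by simp_all
    ultimately show "real_of_int \<bar>S n\<bar> - ln (real n) / 2 > real q1" "real_of_int \<bar>S n\<bar> - ln (real n) / 2 > real q2"
      using * lnn by linarith+
  qed
  have "prime_free_window S 1 n"
    unfolding prime_free_window_def
  proof (intro conjI allI impI notI)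
    show "n \<ge> 1" by (simp add: n_def)
    fix p :: nat assume p: "prime p"
    assume "real p \<in> {real_of_int \<bar>S n\<bar> - ln (real n) / (2 * real 1)<..<real_of_int \<bar>S n\<bar> + ln (real n) / (2 * real 1)}"
    then have pw: "real p > real_of_int \<bar>S n\<bar> - ln (real n) / 2" "real p < real_of_int \<bar>S n\<bar> + ln (real n) / 2" by auto
    define \<sigma> :: int where "\<sigma> = (if S n \<ge> 0 then 1 else -1)"
    \<comment> \<open>Up to sign, p is b m + v with |v| <= y. As b m is 0 modulo every prime up to
      y, a prime factor of v divides p; b m is -1 modulo q1 and 1 modulo q2, which settles v = 1 and
      v = -1.\<close>
    define v where "v = z + \<sigma> * (int p - \<bar>S n\<bar>)"
    have \<sigma>p: "\<sigma> * int p = b * int m + v" by (auto simp: v_def \<sigma>_def fn algebra_simps)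
    have dvdp: "q = p" if "prime q" "int q dvd b * int m + v" for q
    proof -
      have "int q dvd int p" using that(2) unfolding \<sigma>p[symmetric] by (auto simp: \<sigma>_def split: if_splits)
      then show ?thesis using that(1) p by (simp add: primes_dvd_imp_eq)
    qed
    have "\<bar>real_of_int (int p - \<bar>S n\<bar>)\<bar> < real y - Z - 1" using pw lnn by (simp add: abs_less_iff)
    then have "\<bar>real_of_int v\<bar> < real y - 1"
      unfolding v_def Z_def by (auto simp: \<sigma>_def abs_less_iff)
    then have vy: "\<bar>v\<bar> \<le> int y" by linarith
    consider "v = 1" | "v = -1" | "\<bar>v\<bar> \<noteq> 1" by linarith
    then show False
    proof cases
      case 1
      then have "q1 = p" using m1 by (intro dvdp q) (simp add: cong_0_iff)
      then show False using big pw by simp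
    next
      case 2
      then have "q2 = p" using m2 by (intro dvdp q) (simp add: cong_0_iff)
      then show False using big pw by simp
    next
      case 3
      obtain r where r: "prime r" "int r dvd v" "r \<le> y"
      proof (cases "v = 0")
        case True
        then show ?thesis using that[of 2] y(2) by auto
      next
        case False
        have "nat \<bar>v\<bar> \<noteq> 1" using 3 by linarith
        then obtain r where r: "prime r" "r dvd nat \<bar>v\<bar>" using prime_factor_nat by blast
        have "r \<le> nat \<bar>v\<bar>" using r False by (intro dvd_imp_le) auto
        then have "r \<le> y" using vy by linarith
        moreover have "int r dvd v"
          using r(2) by (metis dvd_abs_iff int_dvd_int_iff int_nat_eq abs_ge_zero)
        ultimately show ?thesis using that r by blast
      qed
      have "int r dvd int m" using dvdQ[OF r(1,3)] mQ by (meson dvd_trans int_dvd_int_iff)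
      then have "int r dvd b * int m + v" using r(2) by simp
      then have "r = p" by (rule dvdp[OF r(1)])
      then show False using r(3) q(4) big pw by simp
    qed
  qed
  then show ?thesis using nN by blast
qed

section \<open>Induction on the number of composed sequences\<close>

text \<open>Allows an outer recurrence S (n + 1) = S n + b to be merged into the sequence inside it:
  an affine image keeps the coefficients and changes only the constant. The outer order is 1, so the
  product of the orders stays the same.\<close>

lemma reversible_ilrs_affine:
  assumes "reversible_ilrs d R"
  shows "ilrs d (\<lambda>n. e * R n + c)"
proof -
  obtain a b where ab: "d \<ge> 1" "a 0 \<in> {-1, 1}" "ilrs_recurrence d a b R"
    using assms by (auto simp: reversible_ilrs_def)
  have "ilrs_recurrence d a (e * b + c - c * (\<Sum>i<d. a i)) (\<lambda>n. e * R n + c)"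
    unfolding ilrs_recurrence_def
  proof (intro allI impI)
    fix n :: nat assume "n \<ge> 1"
    then have "R (n + d) = (\<Sum>i<d. a i * R (n + i)) + b" using ab(3) by (simp add: ilrs_recurrence_def)
    then show "e * R (n + d) + c = (\<Sum>i<d. a i * (e * R (n + i) + c)) + (e * b + c - c * (\<Sum>i<d. a i))"
      by (simp add: sum.distrib sum_distrib_left sum_distrib_right algebra_simps)
  qed
  moreover have "a 0 \<noteq> 0" using ab(2) by auto
  ultimately show ?thesis using ab(1) unfolding ilrs_def by blast
qed

text \<open>R is bounded on the indices up to K, so larger values force larger indices. This hands
  the growth hypothesis to the shorter composition after a merge.\<close>

lemma filterlim_inner_at_top:
  fixes R :: "nat \<Rightarrow> int" and g :: "nat \<Rightarrow> int"
  assumes lim: "filterlim (seq_comp R g) at_top sequentially"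
  shows "filterlim g at_top sequentially"
  unfolding filterlim_at_top
proof
  fix K :: int
  define B where "B = Max (R ` {..nat K})"
  have "\<forall>\<^sub>F n in sequentially. seq_comp R g n \<ge> B + 1"
    using lim by (simp add: filterlim_at_top)
  then show "\<forall>\<^sub>F n in sequentially. K \<le> g n"
  proof eventually_elim
    case (elim n)
    show ?case
    proof (rule ccontr)
      assume "\<not> K \<le> g n"
      then have "R (nat (g n)) \<le> B" unfolding B_def by (intro Max_ge) auto
      then show False using elim by (simp add: seq_comp_def)
    qed
  qed
qed

lemma prime_free_window_cong:
  assumes "f n = f' n"
  shows "prime_free_window f D n \<longleftrightarrow> prime_free_window f' D n"
  using assms by (simp add: prime_free_window_def)

text \<open>S and d vary in the induction because a merged sequence may again satisfy S (n + 1) = S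
  n + b and must then be merged with the next one. If this goes on down to the empty list, the
  linear construction takes over.\<close>

lemma infinitely_many_prime_free_windows:
  assumes "ilrs d S" "\<And>j. j \<in> set js \<Longrightarrow> reversible_ilrs (e j) (R j) \<and> positive_seq (R j)"
    and "js \<noteq> [] \<Longrightarrow> filterlim (foldr seq_comp (map R js) int) at_top sequentially"
    and "filterlim (\<lambda>n. real_of_int \<bar>S (nat (foldr seq_comp (map R js) int n))\<bar> / ln (real n)) at_top sequentially"
  shows "\<exists>n>N. prime_free_window (\<lambda>n. S (nat (foldr seq_comp (map R js) int n))) (d * prod_list (map e js)) n"
  using assms
proof (induction js arbitrary: S d)
  case Nil
  obtain a b where ab: "d \<ge> 1" "a 0 \<noteq> 0" "ilrs_recurrence d a b S"
    using Nil.prems(1) by (auto simp: ilrs_def)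
  show ?case
  proof (cases "d = 1 \<and> a 0 = 1")
    case True
    then have "S (n + 1) = S n + b" if "n \<ge> 1" for n using ab(3) that by (simp add: ilrs_recurrence_def)
    from infinitely_many_prime_free_windows_linear[where S = S and b = b, OF this] Nil.prems(4) True show ?thesis by simp
  next
    case False
    have "filterlim int at_top sequentially" by (rule filterlim_int_sequentially)
    moreover have "\<exists>T\<ge>1. T \<le> m ^ 1 \<and> (\<forall>n\<ge>1. [int (n + T) = int n] (mod int m))" if "m \<ge> 1" for m
      using that by (intro exI[of _ m]) (auto simp: cong_iff_dvd_diff)
    ultimately show ?thesis
      using infinitely_many_prime_free_windows_nonlinear[OF ab(3,1,2) False, of int 1 N] Nil.prems(4) by simp
  qed
next
  case (Cons j js)
  define g where "g = foldr seq_comp (map R js) int"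
  define G where "G = seq_comp (R j) g"
  have G: "foldr seq_comp (map R (j # js)) int = G" by (simp add: G_def g_def)
  obtain a b where ab: "d \<ge> 1" "a 0 \<noteq> 0" "ilrs_recurrence d a b S"
    using Cons.prems(1) by (auto simp: ilrs_def)
  have Gpos: "G n \<ge> 1" if "n \<ge> 1" for n
    unfolding G[symmetric] using Cons.prems(2) that by (intro seq_comp_list_pos) auto
  have gpos: "g n \<ge> 1" if "n \<ge> 1" for n
    unfolding g_def using Cons.prems(2) that by (intro seq_comp_list_pos) auto
  have Glim: "filterlim G at_top sequentially" using Cons.prems(3) unfolding G by simp
  have rev_e: "reversible_ilrs (e i) (R i)" if "i \<in> set (j # js)" for i
    using Cons.prems(2)[OF that] by simp
  have e1: "prod_list (map e js') \<ge> 1" if "set js' \<subseteq> set (j # js)" for js'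
    using that
  proof (induction js')
    case (Cons i il)
    then have "e i \<ge> 1" using rev_e[of i] by (simp add: reversible_ilrs_def)
    then show ?case using Cons by (simp add: Suc_le_eq)
  qed simp
  show ?case
  proof (cases "d = 1 \<and> a 0 = 1")
    case True
    have rec: "S (n + 1) = S n + b" if "n \<ge> 1" for n using ab(3) that True by (simp add: ilrs_recurrence_def)
    have S: "S n = b * int n + (S 1 - b)" if "n \<ge> 1" for n
      using that by (induction n rule: dec_induct) (use rec in \<open>auto simp: algebra_simps\<close>)
    define S' where "S' = (\<lambda>n. b * R j n + (S 1 - b))"
    have eq: "S (nat (G n)) = S' (nat (g n))" if "n \<ge> 1" for n
    proof -
      have "nat (G n) \<ge> 1" using Gpos[OF that] by linarith
      then have "S (nat (G n)) = b * int (nat (G n)) + (S 1 - b)" by (rule S)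
      then show ?thesis using Gpos[OF that] by (simp add: S'_def G_def seq_comp_def)
    qed
    have "ilrs (e j) S'" unfolding S'_def using Cons.prems(2) by (intro reversible_ilrs_affine) auto
    moreover have "filterlim g at_top sequentially" using filterlim_inner_at_top Glim unfolding G_def by blast
    moreover have "filterlim (\<lambda>n. real_of_int \<bar>S' (nat (g n))\<bar> / ln (real n)) at_top sequentially"
    proof (rule filterlim_cong[THEN iffD1, OF refl refl])
      show "\<forall>\<^sub>F n in sequentially. real_of_int \<bar>S (nat (G n))\<bar> / ln (real n) = real_of_int \<bar>S' (nat (g n))\<bar> / ln (real n)"
        using eventually_ge_at_top[of 1] by eventually_elim (simp add: eq)
      show "filterlim (\<lambda>n. real_of_int \<bar>S (nat (G n))\<bar> / ln (real n)) at_top sequentially"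
        using Cons.prems(4) unfolding G .
    qed
    ultimately have "\<exists>n>N. prime_free_window (\<lambda>n. S' (nat (g n))) (e j * prod_list (map e js)) n"
      using Cons.IH[of "e j" S'] Cons.prems(2) unfolding g_def by simp
    then obtain n where n: "n > N" "prime_free_window (\<lambda>n. S' (nat (g n))) (e j * prod_list (map e js)) n" by blast
    then have "n \<ge> 1" by simp
    then have "prime_free_window (\<lambda>n. S (nat (G n))) (e j * prod_list (map e js)) n"
      using n(2) prime_free_window_cong[of "\<lambda>n. S (nat (G n))" n "\<lambda>n. S' (nat (g n))"] eq by blast
    then show ?thesis unfolding G using n(1) True by auto
  next
    case False
    show ?thesis unfolding G
    proof (rule infinitely_many_prime_free_windows_nonlinear[OF ab(3,1,2) False Gpos])
      show "prod_list (map e (j # js)) \<ge> 1" by (rule e1) simp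
      show "\<exists>T\<ge>1. T \<le> m ^ prod_list (map e (j # js)) \<and> (\<forall>n\<ge>1. [G (n + T) = G n] (mod int m))" if "m \<ge> 1" for m
        using seq_comp_list_period[where js = "j # js" and d = e and R = R, OF Cons.prems(2) that] unfolding G by blast
      show "filterlim (\<lambda>n. real_of_int \<bar>S (nat (G n))\<bar> / ln (real n)) at_top sequentially"
        using Cons.prems(4) unfolding G .
    qed (use Glim in auto)
  qed
qed

theorem theorem1p2:
  "\<exists>C>0. \<exists>c>0. \<forall>(M :: nat) (d :: nat \<Rightarrow> nat) (R :: nat \<Rightarrow> nat \<Rightarrow> int).
     (\<forall>j\<le>M. ilrs (d j) (R j)) \<longrightarrow>
     (\<forall>j. 1 \<le> j \<and> j \<le> M \<longrightarrow> reversible_ilrs (d j) (R j) \<and> positive_seq (R j)) \<longrightarrow>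
     (M \<ge> 1 \<longrightarrow> filterlim (seq_comps R 1 M) at_top sequentially) \<longrightarrow>
     filterlim (\<lambda>n. real_of_int \<bar>seq_comps R 0 M n\<bar> / ln (real n)) at_top sequentially \<longrightarrow>
     (\<exists>\<delta> :: nat \<Rightarrow> real.
        (\<forall>\<^sub>F n in sequentially.
           \<bar>\<delta> n - ln (real n) / (2 * real (\<Prod>j\<le>M. d j))\<bar>
             \<le> c * (ln (real n) / real (\<Prod>j\<le>M. d j) * exp (- C * sqrt (ln (ln (real n)))))) \<and>
        infinite {n :: nat. n \<ge> 1 \<and>
          (\<forall>p :: nat. prime p \<longrightarrow>
             real p \<notin> {real_of_int \<bar>seq_comps R 0 M n\<bar> - \<delta> n <..<
                        real_of_int \<bar>seq_comps R 0 M n\<bar> + \<delta> n})})"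
proof (rule exI[of _ 1], intro conjI, simp, rule exI[of _ 1], intro conjI, simp, intro allI impI)
  fix M :: nat and d :: "nat \<Rightarrow> nat" and R :: "nat \<Rightarrow> nat \<Rightarrow> int"
  assume ilrs: "\<forall>j\<le>M. ilrs (d j) (R j)"
    and rev: "\<forall>j. 1 \<le> j \<and> j \<le> M \<longrightarrow> reversible_ilrs (d j) (R j) \<and> positive_seq (R j)"
    and lim: "M \<ge> 1 \<longrightarrow> filterlim (seq_comps R 1 M) at_top sequentially"
    and flim: "filterlim (\<lambda>n. real_of_int \<bar>seq_comps R 0 M n\<bar> / ln (real n)) at_top sequentially"
  define D where "D = (\<Prod>j\<le>M. d j)"
  \<comment> \<open>Taking the main term itself leaves the error 0, so both absolute constants can
    be 1.\<close>
  define \<delta> where "\<delta> = (\<lambda>n. ln (real n) / (2 * real D))"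
  define js where "js = [1..<Suc M]"
  have split: "[0..<Suc M] = 0 # js" by (simp add: js_def upt_conv_Cons del: upt_Suc)
  have comps1: "seq_comps R 1 M = foldr seq_comp (map R js) int" by (simp add: seq_comps_def js_def)
  have comps0: "seq_comps R 0 M n = R 0 (nat (foldr seq_comp (map R js) int n))" for n
    unfolding seq_comps_def split by (simp add: seq_comp_def)
  have "D = prod_list (map d [0..<Suc M])"
    unfolding D_def by (simp add: prod.list_conv_set_nth atMost_atLeast0 atLeastLessThanSuc_atLeastAtMost[symmetric]
        prod.distinct_set_conv_list del: upt_Suc)
  then have D: "D = d 0 * prod_list (map d js)" unfolding split by simp
  have "\<exists>n>N. prime_free_window (\<lambda>n. R 0 (nat (foldr seq_comp (map R js) int n))) (d 0 * prod_list (map d js)) n" for N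
  proof (rule infinitely_many_prime_free_windows)
    show "ilrs (d 0) (R 0)" using ilrs by simp
    show "reversible_ilrs (d j) (R j) \<and> positive_seq (R j)" if "j \<in> set js" for j
      using rev that by (auto simp: js_def)
    show "filterlim (foldr seq_comp (map R js) int) at_top sequentially" if "js \<noteq> []"
      using lim that unfolding comps1 by (auto simp: js_def)
    show "filterlim (\<lambda>n. real_of_int \<bar>R 0 (nat (foldr seq_comp (map R js) int n))\<bar> / ln (real n)) at_top sequentially"
      using flim unfolding comps0 .
  qed
  then have "infinite {n. prime_free_window (seq_comps R 0 M) D n}"
    unfolding infinite_nat_iff_unbounded comps0 D by auto
  then have "infinite {n :: nat. n \<ge> 1 \<and> (\<forall>p :: nat. prime p \<longrightarrow>
             real p \<notin> {real_of_int \<bar>seq_comps R 0 M n\<bar> - \<delta> n <..< real_of_int \<bar>seq_comps R 0 M n\<bar> + \<delta> n})}"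
    unfolding prime_free_window_def \<delta>_def .
  moreover have "\<forall>\<^sub>F n in sequentially. \<bar>\<delta> n - ln (real n) / (2 * real D)\<bar>
             \<le> 1 * (ln (real n) / real D * exp (- 1 * sqrt (ln (ln (real n)))))"
    using eventually_ge_at_top[of 1] by eventually_elim (simp add: \<delta>_def)
  ultimately show "\<exists>\<delta> :: nat \<Rightarrow> real.
        (\<forall>\<^sub>F n in sequentially.
           \<bar>\<delta> n - ln (real n) / (2 * real (\<Prod>j\<le>M. d j))\<bar>
             \<le> 1 * (ln (real n) / real (\<Prod>j\<le>M. d j) * exp (- 1 * sqrt (ln (ln (real n)))))) \<and>
        infinite {n :: nat. n \<ge> 1 \<and>
          (\<forall>p :: nat. prime p \<longrightarrow>
             real p \<notin> {real_of_int \<bar>seq_comps R 0 M n\<bar> - \<delta> n <..<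
                        real_of_int \<bar>seq_comps R 0 M n\<bar> + \<delta> n})}"
    unfolding D_def[symmetric] by blast
qed

end
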